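(* Let $R$ be a valuation ring such that, for every nonzero zero divisor $x\in R$, the annihilator ideal $\operatorname{Ann}_R(x)$ is not finitely generated. Then $R$ is $\mathsf{K}_0$-regular.
   Context: Rings are commutative with identity. A valuation ring is a ring $R$ (possibly with zero divisors) in which, for all $x,y\in R$, either $x\in Ry$ or $y\in Rx$. $\mathsf{K}_0(R)$ is the Grothendieck group of finitely generated projective $R$-modules. $R$ is $\mathsf{K}_0$-regular if for every integer $m\ge 1$ the natural homomorphism $\mathsf{K}_0(R)\to\mathsf{K}_0(R[x_1,\dots,x_m])$ induced by the inclusion is an isomorphism. *)

theory Defs
  imports "HOL-Algebra.Algebra" "HOL-Algebra.Free_Abelian_Groups" "HOL-Algebra.Indexed_Polynomials"
begin

locale valuation_ring = cring +
  assumes principal_total: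
    "\<lbrakk>x \<in> carrier R; y \<in> carrier R\<rbrakk> \<Longrightarrow> x \<in> PIdl\<^bsub>R\<^esub> y \<or> y \<in> PIdl\<^bsub>R\<^esub> x"

definition zero_divisor :: "('a, 'r) ring_scheme \<Rightarrow> 'a \<Rightarrow> bool"
  where "zero_divisor R x \<longleftrightarrow>
    x \<in> carrier R \<and> (\<exists>y\<in>carrier R. y \<noteq> \<zero>\<^bsub>R\<^esub> \<and> x \<otimes>\<^bsub>R\<^esub> y = \<zero>\<^bsub>R\<^esub>)"

definition annihilator :: "('a, 'r) ring_scheme \<Rightarrow> 'a \<Rightarrow> 'a set"
  where "annihilator R x = {a \<in> carrier R. a \<otimes>\<^bsub>R\<^esub> x = \<zero>\<^bsub>R\<^esub>}"

definition fin_gen_ideal :: "('a, 'r) ring_scheme \<Rightarrow> 'a set \<Rightarrow> bool"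
  where "fin_gen_ideal R I \<longleftrightarrow> (\<exists>A \<subseteq> carrier R. finite A \<and> I = Idl\<^bsub>R\<^esub> A)"

text \<open>The library supplies the underlying set, the constants and the addition of
  \<open>R[x\<^sub>i | i \<in> I]\<close> (functions from monomials, i.e. multisets of indeterminates, to
  coefficients), but neither the multiplication nor the ring record.\<close>

definition mpoly_ring :: "('a, 'r) ring_scheme \<Rightarrow> 'i set \<Rightarrow> ('i multiset \<Rightarrow> 'a) ring"
  where "mpoly_ring R I =
   \<lparr>carrier = ring.indexed_pset R I (carrier R),
    monoid.mult = (\<lambda>p q \<mu>. \<Oplus>\<^bsub>R\<^esub>\<nu>\<in>{\<nu>. \<nu> \<subseteq># \<mu>}. p \<nu> \<otimes>\<^bsub>R\<^esub> q (\<mu> - \<nu>)),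
    one = ring.indexed_const R \<one>\<^bsub>R\<^esub>,
    ring.zero = ring.indexed_const R \<zero>\<^bsub>R\<^esub>,
    ring.add = ring.indexed_padd R\<rparr>"

text \<open>Maps between modules that are semilinear over a map \<open>\<phi>\<close> of the scalars;
  \<open>\<phi> = id\<close> gives the linear maps.\<close>

definition semilinear_maps ::
    "('a, 'r) ring_scheme \<Rightarrow> ('a \<Rightarrow> 'b) \<Rightarrow> ('a, 'm, 'x) module_scheme \<Rightarrow>
     ('b, 'n, 'y) module_scheme \<Rightarrow> ('m \<Rightarrow> 'n) set"
  where "semilinear_maps R \<phi> M N = {f \<in> carrier M \<rightarrow> carrier N.
    (\<forall>x\<in>carrier M. \<forall>y\<in>carrier M. f (x \<oplus>\<^bsub>M\<^esub> y) = f x \<oplus>\<^bsub>N\<^esub> f y) \<and>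
    (\<forall>a\<in>carrier R. \<forall>x\<in>carrier M. f (a \<odot>\<^bsub>M\<^esub> x) = \<phi> a \<odot>\<^bsub>N\<^esub> f x)}"

abbreviation linear_maps ::
    "('a, 'r) ring_scheme \<Rightarrow> ('a, 'm, 'x) module_scheme \<Rightarrow> ('a, 'n, 'y) module_scheme \<Rightarrow> ('m \<Rightarrow> 'n) set"
  where "linear_maps R M N \<equiv> semilinear_maps R id M N"

definition module_iso ::
    "('a, 'r) ring_scheme \<Rightarrow> ('a, 'm, 'x) module_scheme \<Rightarrow> ('a, 'n, 'y) module_scheme \<Rightarrow> bool"
  where "module_iso R M N \<longleftrightarrow> (\<exists>f\<in>linear_maps R M N. bij_betw f (carrier M) (carrier N))"

definition direct_sum ::
    "('a, 'm, 'x) module_scheme \<Rightarrow> ('a, 'n, 'y) module_scheme \<Rightarrow> ('a, 'm \<times> 'n) module"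
  where "direct_sum M N =
    ring.extend (RDirProd M N) (module.fields (\<lambda>a (x, y). (a \<odot>\<^bsub>M\<^esub> x, a \<odot>\<^bsub>N\<^esub> y)))"

definition fin_gen_module :: "('a, 'r) ring_scheme \<Rightarrow> ('a, 'm, 'x) module_scheme \<Rightarrow> bool"
  where "fin_gen_module R M \<longleftrightarrow>
    (\<exists>A \<subseteq> carrier M. finite A \<and> (\<forall>H. submodule H R M \<and> A \<subseteq> H \<longrightarrow> H = carrier M))"

text \<open>One cannot quantify over all types, so from here on the elements of all \<open>R\<close>-modules
  are drawn from the type \<^typ>\<open>nat \<Rightarrow> 'a\<close>, where \<^typ>\<open>'a\<close> is the element type of \<open>R\<close>.
  For finitely generated modules this loses nothing.  Every finitely generated projective
  module is isomorphic to a submodule of some \<open>R\<^sup>n\<close>, realized as the functions vanishing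
  from \<open>n\<close> on.  And lifting the identity of \<open>M\<close> through a surjection \<open>R\<^sup>n \<rightarrow> M\<close>,
  which the following definition covers, exhibits a finitely generated \<open>M\<close> as a direct
  summand of \<open>R\<^sup>n\<close>; hence it is projective with respect to arbitrary modules.\<close>

definition projective_module :: "('a, 'r) ring_scheme \<Rightarrow> ('a, nat \<Rightarrow> 'a) module \<Rightarrow> bool"
  where "projective_module R M \<longleftrightarrow>
    (\<forall>(N :: ('a, nat \<Rightarrow> 'a) module) (P :: ('a, nat \<Rightarrow> 'a) module).
      module R N \<and> module R P \<longrightarrow>
      (\<forall>g\<in>linear_maps R N P. \<forall>f\<in>linear_maps R M P. g ` carrier N = carrier P \<longrightarrow>
        (\<exists>h\<in>linear_maps R M N. \<forall>x\<in>carrier M. g (h x) = f x)))"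

definition fgp_modules :: "('a, 'r) ring_scheme \<Rightarrow> ('a, nat \<Rightarrow> 'a) module set"
  where "fgp_modules R = {M. module R M \<and> fin_gen_module R M \<and> projective_module R M}"

text \<open>Isomorphic modules have equal classes: \<open>P \<cong> Q\<close> implies \<open>P \<cong> Q \<oplus> 0\<close>, and \<open>[0] = 0\<close>
  because \<open>0 \<cong> 0 \<oplus> 0\<close>.  So the generators need not be isomorphism classes.\<close>

definition K0_relations ::
    "('a, 'r) ring_scheme \<Rightarrow> (('a, nat \<Rightarrow> 'a) module \<Rightarrow>\<^sub>0 int) set"
  where "K0_relations R = generate (free_Abelian_group (fgp_modules R))
    {frag_of P - (frag_of P1 + frag_of P2) | P P1 P2.
      P \<in> fgp_modules R \<and> P1 \<in> fgp_modules R \<and> P2 \<in> fgp_modules R \<and>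
      module_iso R P (direct_sum P1 P2)}"

definition K0 ::
    "('a, 'r) ring_scheme \<Rightarrow> (('a, nat \<Rightarrow> 'a) module \<Rightarrow>\<^sub>0 int) set monoid"
  where "K0 R = free_Abelian_group (fgp_modules R) Mod K0_relations R"

text \<open>\<open>N\<close>, together with \<open>\<iota> : M \<rightarrow> N\<close>, is the extension of scalars \<open>S \<otimes>\<^sub>R M\<close> along
  \<open>\<phi> : R \<rightarrow> S\<close>, described by its universal property.  If \<open>M\<close> is finitely generated
  projective over \<open>R\<close>, then so is \<open>S \<otimes>\<^sub>R M\<close> over \<open>S\<close>; it therefore occurs, up to
  isomorphism, among the test modules \<open>P\<close>, so that the universal property with respect
  to these already determines it up to isomorphism.\<close>

definition scalar_extension ::
    "('a, 'r) ring_scheme \<Rightarrow> ('b, 's) ring_scheme \<Rightarrow> ('a \<Rightarrow> 'b) \<Rightarrow>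
     ('a, nat \<Rightarrow> 'a) module \<Rightarrow> ('b, nat \<Rightarrow> 'b) module \<Rightarrow> ((nat \<Rightarrow> 'a) \<Rightarrow> (nat \<Rightarrow> 'b)) \<Rightarrow> bool"
  where "scalar_extension R S \<phi> M N \<iota> \<longleftrightarrow>
    module S N \<and> \<iota> \<in> semilinear_maps R \<phi> M N \<and>
    (\<forall>P :: ('b, nat \<Rightarrow> 'b) module. module S P \<longrightarrow>
      (\<forall>f\<in>semilinear_maps R \<phi> M P.
        \<exists>!g. g \<in> linear_maps S N P \<and> g \<in> extensional (carrier N) \<and>
             (\<forall>x\<in>carrier M. g (\<iota> x) = f x)))"

definition extend_scalars ::
    "('a, 'r) ring_scheme \<Rightarrow> ('b, 's) ring_scheme \<Rightarrow> ('a \<Rightarrow> 'b) \<Rightarrow>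
     ('a, nat \<Rightarrow> 'a) module \<Rightarrow> ('b, nat \<Rightarrow> 'b) module"
  where "extend_scalars R S \<phi> M =
    (SOME N. N \<in> fgp_modules S \<and> (\<exists>\<iota>. scalar_extension R S \<phi> M N \<iota>))"

text \<open>The map \<open>[M] \<mapsto> [S \<otimes>\<^sub>R M]\<close> on cosets: extend \<open>M \<mapsto> S \<otimes>\<^sub>R M\<close> additively to the free
  abelian groups and take the coset of the value at any representative (all
  representatives give the same coset, so the union is over equal sets).\<close>

definition K0_map ::
    "('a, 'r) ring_scheme \<Rightarrow> ('b, 's) ring_scheme \<Rightarrow> ('a \<Rightarrow> 'b) \<Rightarrow>
     (('a, nat \<Rightarrow> 'a) module \<Rightarrow>\<^sub>0 int) set \<Rightarrow> (('b, nat \<Rightarrow> 'b) module \<Rightarrow>\<^sub>0 int) set"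
  where "K0_map R S \<phi> C =
    (\<Union>c\<in>C. K0_relations S #>\<^bsub>free_Abelian_group (fgp_modules S)\<^esub>
              frag_extend (\<lambda>M. frag_of (extend_scalars R S \<phi> M)) c)"

definition K0_regular :: "('a, 'r) ring_scheme \<Rightarrow> bool"
  where "K0_regular R \<longleftrightarrow>
    (\<forall>m::nat. m \<ge> 1 \<longrightarrow>
      K0_map R (mpoly_ring R {..<m}) (ring.indexed_const R)
        \<in> iso (K0 R) (K0 (mpoly_ring R {..<m})))"

lemma comm_group_K0: "comm_group (K0 R)"
proof -
  interpret F: comm_group "free_Abelian_group (fgp_modules R)"
    by (rule abelian_free_Abelian_group)
  have "subgroup (K0_relations R) (free_Abelian_group (fgp_modules R))"
    unfolding K0_relations_def
  proof (rule F.generate_is_subgroup, safe)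
    fix P P1 P2 assume "P \<in> fgp_modules R" "P1 \<in> fgp_modules R" "P2 \<in> fgp_modules R"
    then have "Poly_Mapping.keys (frag_of P - (frag_of P1 + frag_of P2)) \<subseteq> fgp_modules R"
      using keys_diff[of "frag_of P" "frag_of P1 + frag_of P2"]
        Poly_Mapping.keys_add[of "frag_of P1" "frag_of P2"] by fastforce
    then show "frag_of P - (frag_of P1 + frag_of P2) \<in> carrier (free_Abelian_group (fgp_modules R))"
      by simp
  qed
  then show ?thesis
    unfolding K0_def by (rule F.abelian_FactGroup)
qed

lemma direct_sum_simps [simp]:
  "carrier (direct_sum M N) = carrier M \<times> carrier N"
  "x \<oplus>\<^bsub>direct_sum M N\<^esub> y = (fst x \<oplus>\<^bsub>M\<^esub> fst y, snd x \<oplus>\<^bsub>N\<^esub> snd y)"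
  "\<zero>\<^bsub>direct_sum M N\<^esub> = (\<zero>\<^bsub>M\<^esub>, \<zero>\<^bsub>N\<^esub>)"
  "a \<odot>\<^bsub>direct_sum M N\<^esub> x = (a \<odot>\<^bsub>M\<^esub> fst x, a \<odot>\<^bsub>N\<^esub> snd x)"
  by (auto simp: direct_sum_def RDirProd_def DirProd_def monoid.defs ring.defs module.defs split: prod.splits)

lemma module_direct_sum:
  assumes "module R M" "module R N"
  shows "module R (direct_sum M N)"
proof -
  interpret M: module R M by fact
  interpret N: module R N by fact
  show ?thesis
  proof (rule moduleI)
    show "abelian_group (direct_sum M N)"
    proof (rule abelian_groupI)
      fix x assume "x \<in> carrier (direct_sum M N)"
      then show "\<exists>y\<in>carrier (direct_sum M N). y \<oplus>\<^bsub>direct_sum M N\<^esub> x = \<zero>\<^bsub>direct_sum M N\<^esub>"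
        by (intro bexI[of _ "(\<ominus>\<^bsub>M\<^esub> fst x, \<ominus>\<^bsub>N\<^esub> snd x)"]) (auto simp: M.M.l_neg N.M.l_neg)
    qed (auto simp: M.M.a_ac N.M.a_ac)
  qed (auto simp: M.R.is_cring M.smult_l_distr N.smult_l_distr M.smult_r_distr N.smult_r_distr
         M.smult_assoc1 N.smult_assoc1)
qed

lemma mset_diff_diff_self:
  assumes "\<nu> \<subseteq># \<mu>"
  shows "\<mu> - (\<mu> - \<nu>) = \<nu>"
  using assms by (auto elim!: mset_subset_eq_exists_conv[THEN iffD1, THEN exE])

context cring
begin

lemma mpoly_ring_simps:
  "carrier (mpoly_ring R I) = indexed_pset I (carrier R)"
  "p \<otimes>\<^bsub>mpoly_ring R I\<^esub> q = (\<lambda>\<mu>. \<Oplus>\<nu>\<in>{\<nu>. \<nu> \<subseteq># \<mu>}. p \<nu> \<otimes> q (\<mu> - \<nu>))"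
  "p \<oplus>\<^bsub>mpoly_ring R I\<^esub> q = indexed_padd p q"
  "\<one>\<^bsub>mpoly_ring R I\<^esub> = indexed_const \<one>"
  "\<zero>\<^bsub>mpoly_ring R I\<^esub> = indexed_const \<zero>"
  by (simp_all add: mpoly_ring_def)

lemma finite_submultisets: "finite {\<nu>. \<nu> \<subseteq># (\<mu> :: 'i multiset)}"
proof (induction \<mu>)
  case (add x \<mu>)
  have "{\<nu>. \<nu> \<subseteq># add_mset x \<mu>} \<subseteq> {\<nu>. \<nu> \<subseteq># \<mu>} \<union> add_mset x ` {\<nu>. \<nu> \<subseteq># \<mu>}"
  proof
    fix \<nu> assume \<nu>: "\<nu> \<in> {\<nu>. \<nu> \<subseteq># add_mset x \<mu>}"
    show "\<nu> \<in> {\<nu>. \<nu> \<subseteq># \<mu>} \<union> add_mset x ` {\<nu>. \<nu> \<subseteq># \<mu>}"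
    proof (cases "x \<in># \<nu>")
      case True
      then obtain \<nu>' where "\<nu> = add_mset x \<nu>'" by (metis multi_member_split)
      with \<nu> show ?thesis by auto
    next
      case False
      with \<nu> have "\<nu> \<subseteq># \<mu>"
        by (metis mem_Collect_eq add_mset_remove_trivial diff_single_trivial mset_subset_eq_add_mset_cancel
            subset_eq_diff_conv add_mset_add_single)
      then show ?thesis by simp
    qed
  qed
  with add show ?case by (meson finite_Un finite_imageI finite_subset)
qed simp

lemma mpoly_coeff_closed:
  "p \<in> carrier (mpoly_ring R I) \<Longrightarrow> p \<mu> \<in> carrier R"
  using indexed_pset_in_carrier[of "carrier R" p I] by (auto simp: mpoly_ring_simps carrier_coeff_def)

lemma mpoly_mult_commute:
  assumes "carrier_coeff p" "carrier_coeff q"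
  shows "p \<otimes>\<^bsub>mpoly_ring R I\<^esub> q = q \<otimes>\<^bsub>mpoly_ring R I\<^esub> p"
proof
  fix \<mu> :: "'c multiset"
  have [simp]: "p \<nu> \<in> carrier R" "q \<nu> \<in> carrier R" for \<nu> using assms by (auto simp: carrier_coeff_def)
  have inj: "inj_on (\<lambda>\<nu>. \<mu> - \<nu>) {\<nu>. \<nu> \<subseteq># \<mu>}"
    by (rule inj_onI) (metis mem_Collect_eq mset_diff_diff_self)
  have im: "(\<lambda>\<nu>. \<mu> - \<nu>) ` {\<nu>. \<nu> \<subseteq># \<mu>} = {\<nu>. \<nu> \<subseteq># \<mu>}"
    by (force simp: image_iff intro: mset_diff_diff_self[symmetric])
  have "(\<Oplus>\<nu>\<in>{\<nu>. \<nu> \<subseteq># \<mu>}. q \<nu> \<otimes> p (\<mu> - \<nu>)) =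
        (\<Oplus>\<nu>\<in>{\<nu>. \<nu> \<subseteq># \<mu>}. q (\<mu> - \<nu>) \<otimes> p (\<mu> - (\<mu> - \<nu>)))"
    using finsum_reindex[OF _ inj, of "\<lambda>\<nu>. q \<nu> \<otimes> p (\<mu> - \<nu>)"] by (simp add: im)
  also have "\<dots> = (\<Oplus>\<nu>\<in>{\<nu>. \<nu> \<subseteq># \<mu>}. p \<nu> \<otimes> q (\<mu> - \<nu>))"
    by (rule finsum_cong') (auto simp: mset_diff_diff_self m_comm)
  finally show "(p \<otimes>\<^bsub>mpoly_ring R I\<^esub> q) \<mu> = (q \<otimes>\<^bsub>mpoly_ring R I\<^esub> p) \<mu>"
    by (simp add: mpoly_ring_simps)
qed

lemma mpoly_mult_const_left:
  assumes "k \<in> carrier R" "carrier_coeff p"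
  shows "indexed_const k \<otimes>\<^bsub>mpoly_ring R I\<^esub> p = (\<lambda>\<mu>. k \<otimes> p \<mu>)"
proof
  fix \<mu> :: "'c multiset"
  have [simp]: "p \<nu> \<in> carrier R" for \<nu> using assms by (auto simp: carrier_coeff_def)
  have "(\<Oplus>\<nu>\<in>{\<nu>. \<nu> \<subseteq># \<mu>}. indexed_const k \<nu> \<otimes> p (\<mu> - \<nu>)) =
        (\<Oplus>\<nu>\<in>{\<nu>. \<nu> \<subseteq># \<mu>}. if {#} = \<nu> then k \<otimes> p (\<mu> - \<nu>) else \<zero>)"
    by (rule finsum_cong') (use assms in \<open>auto simp: indexed_const_def\<close>)
  also have "\<dots> = k \<otimes> p \<mu>"
    using finsum_singleton[of "{#}" "{\<nu>. \<nu> \<subseteq># \<mu>}" "\<lambda>\<nu>. k \<otimes> p (\<mu> - \<nu>)"] assms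
    by (simp add: finite_submultisets)
  finally show "(indexed_const k \<otimes>\<^bsub>mpoly_ring R I\<^esub> p) \<mu> = k \<otimes> p \<mu>"
    by (simp add: mpoly_ring_simps)
qed

lemma mpoly_mult_padd_left:
  assumes "carrier_coeff p" "carrier_coeff q" "carrier_coeff r"
  shows "indexed_padd p q \<otimes>\<^bsub>mpoly_ring R I\<^esub> r =
    indexed_padd (p \<otimes>\<^bsub>mpoly_ring R I\<^esub> r) (q \<otimes>\<^bsub>mpoly_ring R I\<^esub> r)"
  using assms
  by (auto simp: mpoly_ring_simps indexed_padd_def carrier_coeff_def l_distr fun_eq_iff
      intro!: finsum_addf[symmetric, THEN trans[rotated]] finsum_cong')

lemma mpoly_mult_pmult_left:
  assumes "carrier_coeff p" "carrier_coeff q"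
  shows "indexed_pmult p i \<otimes>\<^bsub>mpoly_ring R I\<^esub> q = indexed_pmult (p \<otimes>\<^bsub>mpoly_ring R I\<^esub> q) i"
proof
  fix \<mu> :: "'c multiset"
  have [simp]: "p \<nu> \<in> carrier R" "q \<nu> \<in> carrier R" for \<nu> using assms by (auto simp: carrier_coeff_def)
  show "(indexed_pmult p i \<otimes>\<^bsub>mpoly_ring R I\<^esub> q) \<mu> = indexed_pmult (p \<otimes>\<^bsub>mpoly_ring R I\<^esub> q) i \<mu>"
  proof (cases "i \<in># \<mu>")
    case True
    then obtain \<mu>' where \<mu>: "\<mu> = add_mset i \<mu>'" by (metis multi_member_split)
    let ?f = "\<lambda>\<nu>. indexed_pmult p i \<nu> \<otimes> q (\<mu> - \<nu>)"
    have cl: "?f \<nu> \<in> carrier R" for \<nu> by (simp add: indexed_pmult_def)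
    have sub: "add_mset i ` {\<nu>. \<nu> \<subseteq># \<mu>'} \<subseteq> {\<nu>. \<nu> \<subseteq># \<mu>}" by (auto simp: \<mu>)
    have zero: "?f \<nu> = \<zero>" if "\<nu> \<in> {\<nu>. \<nu> \<subseteq># \<mu>} - add_mset i ` {\<nu>. \<nu> \<subseteq># \<mu>'}" for \<nu>
    proof (cases "i \<in># \<nu>")
      case True
      then obtain \<nu>' where "\<nu> = add_mset i \<nu>'" by (metis multi_member_split)
      with that show ?thesis by (auto simp: \<mu>)
    qed (simp add: indexed_pmult_def)
    have "finsum R ?f {\<nu>. \<nu> \<subseteq># \<mu>} = finsum R ?f (add_mset i ` {\<nu>. \<nu> \<subseteq># \<mu>'})"
      by (rule add.finprod_mono_neutral_cong_right[OF finite_submultisets sub])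
        (use zero cl in auto)
    also have "\<dots> = (\<Oplus>\<nu>\<in>{\<nu>. \<nu> \<subseteq># \<mu>'}. ?f (add_mset i \<nu>))"
      by (rule finsum_reindex) (use cl in \<open>auto simp: inj_on_def\<close>)
    also have "\<dots> = (\<Oplus>\<nu>\<in>{\<nu>. \<nu> \<subseteq># \<mu>'}. p \<nu> \<otimes> q (\<mu>' - \<nu>))"
      by (rule finsum_cong') (auto simp: indexed_pmult_def \<mu>)
    finally show ?thesis by (simp add: mpoly_ring_simps indexed_pmult_def \<mu>)
  next
    case False
    have "finsum R (\<lambda>\<nu>. indexed_pmult p i \<nu> \<otimes> q (\<mu> - \<nu>)) {\<nu>. \<nu> \<subseteq># \<mu>} = finsum R (\<lambda>\<nu>. \<zero>) {\<nu>. \<nu> \<subseteq># \<mu>}"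
      by (rule finsum_cong') (use False in \<open>auto simp: indexed_pmult_def dest: mset_subset_eqD\<close>)
    with False show ?thesis by (simp add: mpoly_ring_simps indexed_pmult_def)
  qed
qed

lemma mpoly_smult_closed:
  fixes I :: "'c set"
  assumes "k \<in> carrier R" "p \<in> indexed_pset I (carrier R)"
  shows "(\<lambda>\<mu>. k \<otimes> p \<mu>) \<in> indexed_pset I (carrier R)"
  using assms(2)
proof induction
  case (indexed_const l)
  have "(\<lambda>\<mu> :: 'c multiset. k \<otimes> indexed_const l \<mu>) = indexed_const (k \<otimes> l)"
    using assms(1) by (auto simp: indexed_const_def)
  then show ?case
    using indexed_pset.indexed_const[of "k \<otimes> l" "carrier R" I] indexed_const assms(1) by simp
next
  case (indexed_padd P Q)
  have "(\<lambda>\<mu>. k \<otimes> indexed_padd P Q \<mu>) = indexed_padd (\<lambda>\<mu>. k \<otimes> P \<mu>) (\<lambda>\<mu>. k \<otimes> Q \<mu>)"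
    using assms(1) indexed_pset_in_carrier[OF order_refl indexed_padd.hyps(1)]
      indexed_pset_in_carrier[OF order_refl indexed_padd.hyps(2)]
    by (auto simp: indexed_padd_def carrier_coeff_def r_distr)
  then show ?case
    using indexed_pset.indexed_padd[OF indexed_padd.IH] by simp
next
  case (indexed_pmult P i)
  have "(\<lambda>\<mu>. k \<otimes> indexed_pmult P i \<mu>) = indexed_pmult (\<lambda>\<mu>. k \<otimes> P \<mu>) i"
    using assms(1) by (auto simp: indexed_pmult_def)
  then show ?case
    using indexed_pset.indexed_pmult[OF indexed_pmult.IH indexed_pmult.hyps(2)] by simp
qed

lemma mpoly_mult_closed:
  assumes "p \<in> indexed_pset I (carrier R)" "q \<in> indexed_pset I (carrier R)"
  shows "p \<otimes>\<^bsub>mpoly_ring R I\<^esub> q \<in> indexed_pset I (carrier R)"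
proof -
  note cc = indexed_pset_in_carrier[OF order_refl]
  show ?thesis
    using assms(1)
  proof induction
    case (indexed_const k)
    show ?case
      unfolding mpoly_mult_const_left[OF indexed_const cc[OF assms(2)]]
      by (rule mpoly_smult_closed[OF indexed_const assms(2)])
  next
    case (indexed_padd P Q)
    show ?case
      unfolding mpoly_mult_padd_left[OF indexed_padd.hyps[THEN cc] cc[OF assms(2)]]
      by (rule indexed_pset.indexed_padd[OF indexed_padd.IH])
  next
    case (indexed_pmult P i)
    show ?case
      unfolding mpoly_mult_pmult_left[OF cc[OF indexed_pmult.hyps(1)] cc[OF assms(2)]]
      by (rule indexed_pset.indexed_pmult[OF indexed_pmult.IH indexed_pmult.hyps(2)])
  qed
qed

lemma mpoly_mult_assoc:
  assumes "p \<in> indexed_pset I (carrier R)" "q \<in> indexed_pset I (carrier R)" "r \<in> indexed_pset I (carrier R)"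
  shows "p \<otimes>\<^bsub>mpoly_ring R I\<^esub> q \<otimes>\<^bsub>mpoly_ring R I\<^esub> r =
    p \<otimes>\<^bsub>mpoly_ring R I\<^esub> (q \<otimes>\<^bsub>mpoly_ring R I\<^esub> r)"
proof -
  note cc = indexed_pset_in_carrier[OF order_refl]
  have q: "carrier_coeff q" and r: "carrier_coeff r"
    and qr: "carrier_coeff (q \<otimes>\<^bsub>mpoly_ring R I\<^esub> r)"
    using assms cc mpoly_mult_closed by blast+
  show ?thesis
    using assms(1)
  proof induction
    case (indexed_const k)
    have "(\<lambda>\<mu>. k \<otimes> q \<mu>) \<otimes>\<^bsub>mpoly_ring R I\<^esub> r = (\<lambda>\<mu>. k \<otimes> (q \<otimes>\<^bsub>mpoly_ring R I\<^esub> r) \<mu>)"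
    proof
      fix \<mu> :: "'c multiset"
      have "k \<otimes> (\<Oplus>\<nu>\<in>{\<nu>. \<nu> \<subseteq># \<mu>}. q \<nu> \<otimes> r (\<mu> - \<nu>)) =
          (\<Oplus>\<nu>\<in>{\<nu>. \<nu> \<subseteq># \<mu>}. k \<otimes> (q \<nu> \<otimes> r (\<mu> - \<nu>)))"
        by (rule finsum_rdistr) (use indexed_const q r in \<open>auto simp: finite_submultisets carrier_coeff_def\<close>)
      also have "\<dots> = (\<Oplus>\<nu>\<in>{\<nu>. \<nu> \<subseteq># \<mu>}. k \<otimes> q \<nu> \<otimes> r (\<mu> - \<nu>))"
        by (rule finsum_cong') (use indexed_const q r in \<open>auto simp: carrier_coeff_def m_assoc\<close>)
      finally show "((\<lambda>\<mu>. k \<otimes> q \<mu>) \<otimes>\<^bsub>mpoly_ring R I\<^esub> r) \<mu> = k \<otimes> (q \<otimes>\<^bsub>mpoly_ring R I\<^esub> r) \<mu>"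
        by (simp add: mpoly_ring_simps)
    qed
    then show ?case
      by (simp add: mpoly_mult_const_left[OF indexed_const q] mpoly_mult_const_left[OF indexed_const qr])
  next
    case (indexed_padd P Q)
    note PQ = indexed_padd.hyps[THEN cc]
      and PQq = indexed_padd.hyps[THEN mpoly_mult_closed, OF assms(2), THEN cc]
    show ?case
      by (simp only: mpoly_mult_padd_left[OF PQ q] mpoly_mult_padd_left[OF PQq r]
          mpoly_mult_padd_left[OF PQ qr] indexed_padd.IH)
  next
    case (indexed_pmult P i)
    note P = cc[OF indexed_pmult.hyps(1)]
      and Pq = cc[OF mpoly_mult_closed[OF indexed_pmult.hyps(1) assms(2)]]
    show ?case
      by (simp only: mpoly_mult_pmult_left[OF P q] mpoly_mult_pmult_left[OF Pq r]
          mpoly_mult_pmult_left[OF P qr] indexed_pmult.IH)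
  qed
qed

lemma cring_mpoly_ring: "cring (mpoly_ring R I)"
proof -
  note cc = indexed_pset_in_carrier[OF order_refl]
  have cc0: "carrier_coeff p" if "p \<in> carrier (mpoly_ring R I)" for p
    using that cc by (simp add: mpoly_ring_simps)
  show ?thesis
  proof (rule cringI)
    show "abelian_group (mpoly_ring R I)"
    proof (rule abelian_groupI)
      fix p assume p: "p \<in> carrier (mpoly_ring R I)"
      have "(\<lambda>\<mu>. \<ominus> \<one> \<otimes> p \<mu>) \<in> carrier (mpoly_ring R I)"
        using mpoly_smult_closed[of "\<ominus> \<one>" p I] p by (simp add: mpoly_ring_simps)
      moreover have "(\<lambda>\<mu>. \<ominus> \<one> \<otimes> p \<mu>) \<oplus>\<^bsub>mpoly_ring R I\<^esub> p = \<zero>\<^bsub>mpoly_ring R I\<^esub>"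
        using mpoly_coeff_closed[OF p]
        by (auto simp: mpoly_ring_simps indexed_padd_def indexed_const_def fun_eq_iff l_minus l_neg)
      ultimately show "\<exists>q\<in>carrier (mpoly_ring R I). q \<oplus>\<^bsub>mpoly_ring R I\<^esub> p = \<zero>\<^bsub>mpoly_ring R I\<^esub>" by blast
    next
      fix p q r
      assume "p \<in> carrier (mpoly_ring R I)" "q \<in> carrier (mpoly_ring R I)" "r \<in> carrier (mpoly_ring R I)"
      then show "p \<oplus>\<^bsub>mpoly_ring R I\<^esub> q \<oplus>\<^bsub>mpoly_ring R I\<^esub> r =
          p \<oplus>\<^bsub>mpoly_ring R I\<^esub> (q \<oplus>\<^bsub>mpoly_ring R I\<^esub> r)"
        using mpoly_coeff_closed[of _ I] by (auto simp: mpoly_ring_simps(3) indexed_padd_def fun_eq_iff a_assoc)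
    next
      fix p q
      assume "p \<in> carrier (mpoly_ring R I)" "q \<in> carrier (mpoly_ring R I)"
      then show "p \<oplus>\<^bsub>mpoly_ring R I\<^esub> q = q \<oplus>\<^bsub>mpoly_ring R I\<^esub> p"
        using mpoly_coeff_closed[of _ I] by (auto simp: mpoly_ring_simps(3) indexed_padd_def fun_eq_iff a_comm)
    next
      fix p assume "p \<in> carrier (mpoly_ring R I)"
      then show "\<zero>\<^bsub>mpoly_ring R I\<^esub> \<oplus>\<^bsub>mpoly_ring R I\<^esub> p = p"
        using indexed_padd_zero(2)[OF cc0] by (simp add: mpoly_ring_simps)
    qed (auto simp: mpoly_ring_simps intro: indexed_pset.indexed_const indexed_pset.indexed_padd)
  next
    show "comm_monoid (mpoly_ring R I)"
    proof (rule comm_monoidI)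
      fix p assume p: "p \<in> carrier (mpoly_ring R I)"
      show "\<one>\<^bsub>mpoly_ring R I\<^esub> \<otimes>\<^bsub>mpoly_ring R I\<^esub> p = p"
        using mpoly_mult_const_left[OF one_closed cc0[OF p]] mpoly_coeff_closed[OF p]
        by (simp add: mpoly_ring_simps(4))
    next
      fix p q assume "p \<in> carrier (mpoly_ring R I)" "q \<in> carrier (mpoly_ring R I)"
      then show "p \<otimes>\<^bsub>mpoly_ring R I\<^esub> q = q \<otimes>\<^bsub>mpoly_ring R I\<^esub> p"
        by (intro mpoly_mult_commute cc0)
    qed (simp_all add: mpoly_mult_closed mpoly_mult_assoc mpoly_ring_simps(1,4) indexed_pset.indexed_const)
  next
    fix p q r
    assume "p \<in> carrier (mpoly_ring R I)" "q \<in> carrier (mpoly_ring R I)" "r \<in> carrier (mpoly_ring R I)"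
    then show "(p \<oplus>\<^bsub>mpoly_ring R I\<^esub> q) \<otimes>\<^bsub>mpoly_ring R I\<^esub> r =
        p \<otimes>\<^bsub>mpoly_ring R I\<^esub> r \<oplus>\<^bsub>mpoly_ring R I\<^esub> q \<otimes>\<^bsub>mpoly_ring R I\<^esub> r"
      unfolding mpoly_ring_simps(3) by (intro mpoly_mult_padd_left cc0)
  qed
qed

lemma indexed_const_ring_hom:
  fixes I :: "'c set"
  shows "indexed_const \<in> ring_hom R (mpoly_ring R I)"
proof (rule ring_hom_memI)
  fix x y assume xy: "x \<in> carrier R" "y \<in> carrier R"
  have "carrier_coeff (indexed_const y :: 'c multiset \<Rightarrow> 'a)"
    using xy by (simp add: carrier_coeff_def indexed_const_def)
  from mpoly_mult_const_left[OF xy(1) this]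
  show "indexed_const (x \<otimes> y) = indexed_const x \<otimes>\<^bsub>mpoly_ring R I\<^esub> (indexed_const y :: 'c multiset \<Rightarrow> 'a)"
    using xy by (auto simp: indexed_const_def)
qed (auto simp: mpoly_ring_simps(1,3,4) indexed_padd_const intro: indexed_pset.indexed_const)

end

end

theory Submission
  imports Defs "HOL-Library.Multiset_Order"
begin

text \<open>The nilradical of a valuation ring \<open>R\<close> is a prime ideal \<open>N\<close>, so \<open>V = R/N\<close> is a valuation
  domain. Let \<open>P\<close> be the image of an idempotent matrix over \<open>V[x\<^sub>1,\<dots>,x\<^sub>m]\<close>. As a submodule of a free
  module it is saturated with respect to \<open>V\<close>. Filter it by degree (equivalently, homogenize) and
  take as leading term of a vector the largest monomial with a unit coefficient. By Dickson's lemma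
  finitely many leading terms generate all of them, and by Gaussian elimination over the local ring
  \<open>V\<close> in each degree the corresponding vectors generate \<open>P\<close>. The syzygies again form a saturated
  module, and for Schreyer's order and generators sorted by the exponent of one more variable, the
  leading terms of the syzygies are generated by monomials without that variable. So the process
  stops and gives a finite free resolution of \<open>P\<close>. It lifts from \<open>V\<close> to \<open>R\<close>, since idempotent
  matrices and the splittings involved lift along nil ideals. Hence the class of every finitely
  generated projective \<open>R[x\<^sub>1,\<dots>,x\<^sub>m]\<close>-module is an integral multiple of the class of the ring, and
  \<open>K\<^sub>0(R) \<rightarrow> K\<^sub>0(R[x\<^sub>1,\<dots>,x\<^sub>m])\<close> is surjective. It is injective since the evaluation at \<open>0\<close> retracts it.

  The leading term argument takes place in rings given by type classes, where one computes modulo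
  an ideal: every carrier-based ring is a quotient of a polynomial ring over \<open>\<int>\<close> by some ideal.\<close>

section \<open>Matrices modulo an ideal and finite free resolutions\<close>

text \<open>Over a field, division by leading terms terminates because leading terms decrease. Here
  the terms above the lead merely have non-unit coefficients and cannot be cleared one by one, and V
  need not be Noetherian, so neither division nor the Hilbert basis theorem is at hand. A degree
  bound leaves finitely many monomials, and then the coefficients at all leads are cleared at once
  by solving a system that is triangular modulo the maximal ideal. Saturation shows that nothing
  remains: a nonzero remainder would be a constant times a vector with a unit coefficient, which has
  a lead again. The price: reduction modulo the maximal ideal may lower degrees, so a lead must
  remember the degree bound under which it occurs. The homogenizing variable does this, and m + 1
  variables have to be eliminated instead of m. Since R may have zero divisors, saturation is used
  only over V. What passes to R are matrix identities, which are repaired at each step by an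
  invertible factor; they also carry the result from the class-based rings to modules.\<close>

locale cr_ideal =
  fixes K :: "'p::comm_ring_1 set"
  assumes zero_mem: "0 \<in> K"
    and add_mem: "x \<in> K \<Longrightarrow> y \<in> K \<Longrightarrow> x + y \<in> K"
    and mult_mem: "x \<in> K \<Longrightarrow> y * x \<in> K"
begin

lemma mult_mem_right: "x \<in> K \<Longrightarrow> x * y \<in> K"
  using mult_mem[of x y] by (simp add: mult.commute)

lemma uminus_mem: "x \<in> K \<Longrightarrow> - x \<in> K"
  using mult_mem[of x "-1"] by simp

lemma diff_mem: "x \<in> K \<Longrightarrow> y \<in> K \<Longrightarrow> x - y \<in> K"
  using add_mem[of x "-y"] uminus_mem by simp

lemma sum_mem: "(\<And>i. i \<in> S \<Longrightarrow> f i \<in> K) \<Longrightarrow> sum f S \<in> K"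
  by (induction S rule: infinite_finite_induct) (auto simp: zero_mem add_mem)

definition eqv (infix \<open>\<asymp>\<close> 50) where "x \<asymp> y \<longleftrightarrow> x - y \<in> K"

lemma eqv_refl [simp, intro]: "x \<asymp> x" by (simp add: eqv_def zero_mem)

lemma eqv_sym: "x \<asymp> y \<Longrightarrow> y \<asymp> x"
  unfolding eqv_def using uminus_mem[of "x - y"] by simp

lemma eqv_trans [trans]: "x \<asymp> y \<Longrightarrow> y \<asymp> z \<Longrightarrow> x \<asymp> z"
  unfolding eqv_def using add_mem[of "x - y" "y - z"] by simp

lemma eqv_add: "x \<asymp> y \<Longrightarrow> x' \<asymp> y' \<Longrightarrow> x + x' \<asymp> y + y'"
  unfolding eqv_def using add_mem[of "x - y" "x' - y'"] by (simp add: algebra_simps)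

lemma eqv_diff: "x \<asymp> y \<Longrightarrow> x' \<asymp> y' \<Longrightarrow> x - x' \<asymp> y - y'"
  unfolding eqv_def using diff_mem[of "x - y" "x' - y'"] by (simp add: algebra_simps)

lemma eqv_mult: "x \<asymp> y \<Longrightarrow> x' \<asymp> y' \<Longrightarrow> x * x' \<asymp> y * y'"
  unfolding eqv_def using add_mem[OF mult_mem[of "x' - y'" x] mult_mem[of "x - y" y']]
  by (simp add: algebra_simps)

lemma eqv_sum: "(\<And>i. i \<in> S \<Longrightarrow> f i \<asymp> g i) \<Longrightarrow> sum f S \<asymp> sum g S"
  unfolding eqv_def sum_subtractf[symmetric] by (rule sum_mem)

lemma eqv_zero_iff: "x \<asymp> 0 \<longleftrightarrow> x \<in> K" by (simp add: eqv_def)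

definition inv_mod :: "'p \<Rightarrow> bool" where "inv_mod u \<longleftrightarrow> (\<exists>v. u * v \<asymp> 1)"

end

text \<open>Matrices are functions of two indices; the dimensions appear only in products and in
  congruences.\<close>

definition mm :: "nat \<Rightarrow> (nat \<Rightarrow> nat \<Rightarrow> 'p::comm_ring_1) \<Rightarrow> (nat \<Rightarrow> nat \<Rightarrow> 'p) \<Rightarrow> nat \<Rightarrow> nat \<Rightarrow> 'p"
  where "mm n A B i k = (\<Sum>j<n. A i j * B j k)"

definition mid :: "nat \<Rightarrow> nat \<Rightarrow> 'p::comm_ring_1"
  where "mid i j = (if i = j then 1 else 0)"

lemma mm_assoc: "mm k (mm l A B) C = mm l A (mm k B C)"
proof (intro ext)
  fix i j
  have "mm k (mm l A B) C i j = (\<Sum>y<k. \<Sum>x<l. A i x * B x y * C y j)"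
    by (simp add: mm_def sum_distrib_right)
  also have "\<dots> = (\<Sum>x<l. \<Sum>y<k. A i x * B x y * C y j)" by (rule sum.swap)
  also have "\<dots> = mm l A (mm k B C) i j"
    by (simp add: mm_def sum_distrib_left mult.assoc)
  finally show "mm k (mm l A B) C i j = mm l A (mm k B C) i j" .
qed

lemma mm_mid_left: "i < n \<Longrightarrow> mm n mid A i j = A i j"
  by (simp add: mm_def mid_def if_distrib[of "\<lambda>x. x * _"] cong: if_cong)

lemma mm_mid_right: "j < n \<Longrightarrow> mm n A mid i j = A i j"
  by (simp add: mm_def mid_def if_distrib[of "\<lambda>x. _ * x"] cong: if_cong)

lemma mm_diff_left: "mm n (\<lambda>i j. A i j - B i j) C i k = mm n A C i k - mm n B C i k"
  by (simp add: mm_def left_diff_distrib sum_subtractf)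

lemma mm_diff_right: "mm n C (\<lambda>i j. A i j - B i j) i k = mm n C A i k - mm n C B i k"
  by (simp add: mm_def right_diff_distrib sum_subtractf)

context cr_ideal
begin

definition meq :: "nat \<Rightarrow> nat \<Rightarrow> (nat \<Rightarrow> nat \<Rightarrow> 'p) \<Rightarrow> (nat \<Rightarrow> nat \<Rightarrow> 'p) \<Rightarrow> bool"
  where "meq r c A B \<longleftrightarrow> (\<forall>i<r. \<forall>j<c. A i j \<asymp> B i j)"

lemma meq_refl [simp, intro]: "meq r c A A" by (simp add: meq_def)

lemma meq_sym: "meq r c A B \<Longrightarrow> meq r c B A" by (auto simp: meq_def intro: eqv_sym)

lemma meq_trans [trans]: "meq r c A B \<Longrightarrow> meq r c B C \<Longrightarrow> meq r c A C"
  unfolding meq_def by (metis eqv_trans)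

lemma meq_mm: "meq r n A A' \<Longrightarrow> meq n c B B' \<Longrightarrow> meq r c (mm n A B) (mm n A' B')"
  by (auto simp: meq_def mm_def intro!: eqv_sum eqv_mult)

lemma meq_diff: "meq r c A A' \<Longrightarrow> meq r c B B' \<Longrightarrow> meq r c (\<lambda>i j. A i j - B i j) (\<lambda>i j. A' i j - B' i j)"
  by (auto simp: meq_def intro!: eqv_diff)

lemma meq_mid_left: "meq n c (mm n mid A) A"
  by (auto simp: meq_def mm_mid_left)

lemma meq_mid_right: "meq r n (mm n A mid) A"
  by (auto simp: meq_def mm_mid_right)

text \<open>If the idempotent \<open>e\<close> has image \<open>P\<close>, then \<open>\<phi>\<close> maps a free module onto \<open>P\<close> with section
  \<open>\<sigma>\<close>, and \<open>1 - \<sigma> \<phi>\<close> is an idempotent with image the kernel of \<open>\<phi>\<close>: this is a finite free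
  resolution of \<open>P\<close>.\<close>

inductive finite_free_res :: "nat \<Rightarrow> (nat \<Rightarrow> nat \<Rightarrow> 'p) \<Rightarrow> bool"
  where
    zero: "meq n n e (\<lambda>_ _. 0) \<Longrightarrow> finite_free_res n e"
  | step: "meq n n (mm t \<phi> \<sigma>) e \<Longrightarrow> meq n t (mm n e \<phi>) \<phi> \<Longrightarrow>
      finite_free_res t (\<lambda>i j. mid i j - mm n \<sigma> \<phi> i j) \<Longrightarrow> finite_free_res n e"

text \<open>\<open>\<sigma> \<phi>\<close> is idempotent because \<sigma> (\<phi> \<sigma>) \<phi> =
  \<sigma> e \<phi> = \<sigma> \<phi>, and \<open>f\<close> is its complement.\<close>

lemma kernel_idempotent:
  assumes e: "meq n n (mm t \<phi> \<sigma>) e" "meq n t (mm n e \<phi>) \<phi>"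
  defines "f \<equiv> \<lambda>i j. mid i j - mm n \<sigma> \<phi> i j"
  shows "meq t t (mm t f f) f"
proof -
  have 1: "meq t t (mm t (mm n \<sigma> \<phi>) (mm n \<sigma> \<phi>)) (mm n \<sigma> \<phi>)"
  proof -
    have "mm t (mm n \<sigma> \<phi>) (mm n \<sigma> \<phi>) = mm n \<sigma> (mm n (mm t \<phi> \<sigma>) \<phi>)" by (simp only: mm_assoc)
    moreover have "meq t t (mm n \<sigma> (mm n (mm t \<phi> \<sigma>) \<phi>)) (mm n \<sigma> (mm n e \<phi>))"
      by (intro meq_mm meq_refl e)
    moreover have "meq t t (mm n \<sigma> (mm n e \<phi>)) (mm n \<sigma> \<phi>)"
      by (intro meq_mm meq_refl e)
    ultimately show ?thesis by (metis meq_trans)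
  qed
  have "mm t f f i j = f i j - mm n \<sigma> \<phi> i j + mm t (mm n \<sigma> \<phi>) (mm n \<sigma> \<phi>) i j" if "i < t" "j < t" for i j
    unfolding f_def mm_diff_left mm_diff_right using that by (simp add: mm_mid_left mm_mid_right)
  moreover have "f i j - mm n \<sigma> \<phi> i j + mm t (mm n \<sigma> \<phi>) (mm n \<sigma> \<phi>) i j \<asymp> f i j - mm n \<sigma> \<phi> i j + mm n \<sigma> \<phi> i j"
    if "i < t" "j < t" for i j
    using 1 that by (intro eqv_add eqv_refl) (auto simp: meq_def)
  ultimately show ?thesis by (auto simp: meq_def)
qed

text \<open>Gaussian elimination for a matrix that is triangular modulo an ideal \<open>N\<close> contained in the
  Jacobson radical.\<close>

lemma solve_triangular:
  fixes H :: "'b \<Rightarrow> 'b \<Rightarrow> 'p"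
  assumes "finite B" and N: "cr_ideal N"
    and rad: "\<And>u x. inv_mod u \<Longrightarrow> x \<in> N \<Longrightarrow> inv_mod (u + x)"
    and lt: "asymp_on B lt" "transp_on B lt" "totalp_on B lt"
    and "\<And>b. b \<in> B \<Longrightarrow> inv_mod (H b b)"
    and "\<And>b b'. b \<in> B \<Longrightarrow> b' \<in> B \<Longrightarrow> lt b b' \<Longrightarrow> H b b' \<in> N"
  shows "\<exists>c. \<forall>b'\<in>B. (\<Sum>b\<in>B. c b * H b b') \<asymp> y b'"
  using assms(1) lt assms(7,8)
proof (induction B arbitrary: H y rule: finite_psubset_induct)
  case (psubset B)
  interpret N: cr_ideal N by fact
  show ?case
  proof (cases "B = {}")
    case False
    from Finite_Set.bex_max_element[OF psubset.hyps psubset.prems(1,2) False] psubset.prems(3)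
    obtain m where m: "m \<in> B" and max: "\<And>x. x \<in> B \<Longrightarrow> x \<noteq> m \<Longrightarrow> lt x m"
      by (auto simp: totalp_on_def)
    define B' where "B' = B - {m}"
    have B': "B' \<subset> B" "finite B'" "m \<notin> B'" "B = insert m B'"
      using m psubset.hyps by (auto simp: B'_def)
    obtain v where v: "H m m * v \<asymp> 1" using psubset.prems(4)[OF m] by (auto simp: inv_mod_def)
    \<comment> \<open>Schur complement of the pivot \<open>H m m\<close>. As \<open>m\<close> is the
      largest index, \<open>H b m\<close> lies in \<open>N\<close> for all other \<open>b\<close>,
      so the correction lies in \<open>N\<close> and the complement satisfies the same
      hypotheses.\<close>
    define H' where "H' b b' = H b b' - H b m * v * H m b'" for b b'
    have HN: "H b m * v * H m b' \<in> N" if "b \<in> B'" for b b'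
      using psubset.prems(5)[of b m] max[of b] m that B' by (auto intro: N.mult_mem_right)
    have "\<exists>c. \<forall>b'\<in>B'. (\<Sum>b\<in>B'. c b * H' b b') \<asymp> y b' - y m * v * H m b'"
    proof (rule psubset.IH[OF B'(1)])
      show "asymp_on B' lt" "transp_on B' lt" "totalp_on B' lt"
        using psubset.prems(1-3) B'(1) by (auto intro: asymp_on_subset transp_on_subset totalp_on_subset)
      show "inv_mod (H' b b)" if "b \<in> B'" for b
        using rad[OF psubset.prems(4) N.uminus_mem[OF HN[OF that]]] that B' by (auto simp: H'_def)
      show "H' b b' \<in> N" if "b \<in> B'" "b' \<in> B'" "lt b b'" for b b'
        using N.diff_mem[OF psubset.prems(5) HN[OF that(1)]] that B' by (auto simp: H'_def)
    qed
    then obtain c where c: "\<And>b'. b' \<in> B' \<Longrightarrow> (\<Sum>b\<in>B'. c b * H' b b') \<asymp> y b' - y m * v * H m b'" by blast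
    \<comment> \<open>Back substitution: \<open>v * w\<close> is the coefficient of the pivot row
      that makes column \<open>m\<close> correct.\<close>
    define w where "w = y m - (\<Sum>b\<in>B'. c b * H b m)"
    define d where "d = c(m := v * w)"
    have d: "(\<Sum>b\<in>B. d b * H b b') = v * w * H m b' + (\<Sum>b\<in>B'. c b * H b b')" for b'
    proof -
      have "(\<Sum>b\<in>B'. d b * H b b') = (\<Sum>b\<in>B'. c b * H b b')"
        by (rule sum.cong) (use B' in \<open>auto simp: d_def\<close>)
      then show ?thesis using B' by (simp add: d_def)
    qed
    have "(\<Sum>b\<in>B. d b * H b m) \<asymp> y m"
    proof -
      have "(\<Sum>b\<in>B. d b * H b m) = (H m m * v) * w + (\<Sum>b\<in>B'. c b * H b m)" by (simp add: d ac_simps)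
      also have "\<dots> \<asymp> 1 * w + (\<Sum>b\<in>B'. c b * H b m)" by (intro eqv_add eqv_mult v eqv_refl)
      also have "\<dots> = y m" by (simp add: w_def)
      finally show ?thesis .
    qed
    moreover have "(\<Sum>b\<in>B. d b * H b b') \<asymp> y b'" if b': "b' \<in> B'" for b'
    proof -
      have "(\<Sum>b\<in>B. d b * H b b') = (\<Sum>b\<in>B'. c b * H' b b') + y m * v * H m b'"
        by (simp add: d w_def H'_def algebra_simps sum_subtractf sum_distrib_left)
      also have "\<dots> \<asymp> (y b' - y m * v * H m b') + y m * v * H m b'"
        by (intro eqv_add c b' eqv_refl)
      finally show ?thesis by simp
    qed
    ultimately show ?thesis using B'(4) by blast
  qed simp
qed

text \<open>The diagonal entries are units and all others lie in \<open>N\<close>, so the matrix is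
  triangular modulo \<open>N\<close> for the usual order; each row of the inverse solves one linear
  system.\<close>

lemma left_inverse_near_identity:
  assumes N: "cr_ideal N" and rad: "\<And>u x. inv_mod u \<Longrightarrow> x \<in> N \<Longrightarrow> inv_mod (u + x)"
    and Q: "\<And>i j. i < n \<Longrightarrow> j < n \<Longrightarrow> Q i j \<in> N"
  shows "\<exists>Y. meq n n (mm n Y (\<lambda>i j. mid i j + Q i j)) mid"
proof -
  interpret N: cr_ideal N by fact
  let ?H = "\<lambda>i j. mid i j + Q i j"
  have 1: "inv_mod (?H b b)" if "b \<in> {..<n}" for b
  proof -
    have "inv_mod (1 * 1)" unfolding inv_mod_def by (rule exI[of _ 1]) simp
    then have "inv_mod (1 + Q b b)" using rad[of 1 "Q b b"] Q[of b b] that by simp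
    then show ?thesis by (simp add: mid_def)
  qed
  have 2: "?H b b' \<in> N" if "b \<in> {..<n}" "b' \<in> {..<n}" "b < b'" for b b'
    using Q[of b b'] that by (simp add: mid_def)
  have "\<exists>c. \<forall>i\<in>{..<n}. (\<Sum>k\<in>{..<n}. c k * ?H k i) \<asymp> mid l i" for l
  proof (rule solve_triangular[where lt = "(<)" and N = N and H = ?H])
    show "inv_mod (u + x)" if "inv_mod u" "x \<in> N" for u x using that by (rule rad)
    show "inv_mod (?H b b)" if "b \<in> {..<n}" for b using that by (rule 1)
    show "?H b b' \<in> N" if "b \<in> {..<n}" "b' \<in> {..<n}" "b < b'" for b b' using that by (rule 2)
  qed (simp_all add: N)
  then have "\<exists>Y. \<forall>l. \<forall>i\<in>{..<n}. (\<Sum>k<n. Y l k * ?H k i) \<asymp> mid l i"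
    by (intro choice) blast
  then obtain Y where Y: "\<And>l i. i < n \<Longrightarrow> (\<Sum>k<n. Y l k * ?H k i) \<asymp> mid l i" by auto
  show ?thesis by (rule exI[of _ Y]) (use Y in \<open>simp add: meq_def mm_def\<close>)
qed

text \<open>The left inverse of the transpose, transposed back.\<close>

lemma right_inverse_near_identity:
  assumes N: "cr_ideal N" and rad: "\<And>u x. inv_mod u \<Longrightarrow> x \<in> N \<Longrightarrow> inv_mod (u + x)"
    and Q: "\<And>i j. i < n \<Longrightarrow> j < n \<Longrightarrow> Q i j \<in> N"
  shows "\<exists>Y. meq n n (mm n (\<lambda>i j. mid i j + Q i j) Y) mid"
proof -
  have "\<exists>Y. meq n n (mm n Y (\<lambda>i j. mid i j + Q j i)) mid"
    by (rule left_inverse_near_identity[where Q = "\<lambda>i j. Q j i", OF N]) (simp_all add: rad Q)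
  then obtain Y where Y: "meq n n (mm n Y (\<lambda>i j. mid i j + Q j i)) mid" ..
  have "mm n (\<lambda>i j. mid i j + Q i j) (\<lambda>i j. Y j i) i j = mm n Y (\<lambda>i j. mid i j + Q j i) j i" for i j
    unfolding mm_def by (rule sum.cong) (auto simp: mid_def mult.commute)
  moreover have "mm n Y (\<lambda>i j. mid i j + Q j i) j i \<asymp> mid i j" if "i < n" "j < n" for i j
  proof -
    have "mm n Y (\<lambda>i j. mid i j + Q j i) j i \<asymp> mid j i" using Y that by (simp add: meq_def)
    also have "mid j i = (mid i j :: 'p)" by (simp add: mid_def)
    finally show ?thesis .
  qed
  ultimately show ?thesis unfolding meq_def by (intro exI[of _ "\<lambda>i j. Y j i"]) simp
qed

end

text \<open>Modulo \<open>I\<close> the product \<phi> \<sigma> is only e + Q with entries of Q in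
  \<open>J\<close>. Since e is idempotent modulo \<open>I\<close>, e \<phi> \<sigma> = e (1 + Q),
  and 1 + Q has a right inverse Y because \<open>J\<close> is nil modulo \<open>I\<close>. So e
  \<phi> and \<sigma> Y have product e modulo \<open>I\<close>, and they agree with \<phi> and
  \<sigma> modulo \<open>J\<close>.\<close>

lemma finite_free_res_nil_lift:
  assumes I: "cr_ideal I" and J: "cr_ideal J" and "I \<subseteq> J"
    and nil: "\<And>x. x \<in> J \<Longrightarrow> \<exists>k. x ^ k \<in> I"
    and "cr_ideal.finite_free_res J n e" "cr_ideal.meq I n n (mm n e e) e"
  shows "cr_ideal.finite_free_res I n e"
proof -
  interpret I: cr_ideal I by fact
  interpret J: cr_ideal J by fact
  have sub: "J.meq r c A B" if "I.meq r c A B" for r c A B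
    using that \<open>I \<subseteq> J\<close> by (auto simp: I.meq_def J.meq_def I.eqv_def J.eqv_def)
  \<comment> \<open>With \<open>v\<close> inverse to \<open>u\<close>, invert 1 + x v by the
    geometric series in - x v, which is finite modulo \<open>I\<close>.\<close>
  have rad: "I.inv_mod (u + x)" if u: "I.inv_mod u" and x: "x \<in> J" for u x
  proof -
    obtain v where v: "I.eqv (u * v) 1" using u by (auto simp: I.inv_mod_def)
    obtain k where k: "(- (x * v)) ^ k \<in> I"
      using nil[OF J.uminus_mem[OF J.mult_mem_right[OF x]]] by blast
    have "I.eqv ((u * v + x * v) * (\<Sum>i<k. (- (x * v)) ^ i)) ((1 + x * v) * (\<Sum>i<k. (- (x * v)) ^ i))"
      by (intro I.eqv_mult I.eqv_add v I.eqv_refl)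
    also have "(1 + x * v) * (\<Sum>i<k. (- (x * v)) ^ i) = 1 - (- (x * v)) ^ k"
      using one_diff_power_eq[of "- (x * v)" k] by simp
    also have "I.eqv \<dots> 1" using I.uminus_mem[OF k] by (simp add: I.eqv_def)
    finally show ?thesis unfolding I.inv_mod_def
      by (intro exI[of _ "v * (\<Sum>i<k. (- (x * v)) ^ i)"]) (simp add: algebra_simps)
  qed
  \<comment> \<open>The induction allows \<open>e\<close> to differ from the resolved matrix
    \<open>e'\<close> by entries in \<open>J\<close>, because lifting one step changes the next
    kernel idempotent by such a matrix.\<close>
  have "I.finite_free_res n e" if "J.finite_free_res n e'" "J.meq n n e' e" "I.meq n n (mm n e e) e" for n e e'
    using that
  proof (induction arbitrary: e rule: J.finite_free_res.induct)
    case (zero n e')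
    text \<open>An idempotent \<open>e\<close> with nilpotent entries vanishes, as \<open>1 - e\<close> is invertible.\<close>
    have e: "e i j \<in> J" if "i < n" "j < n" for i j
      using J.meq_trans[OF J.meq_sym[OF zero(2)] zero(1)] that by (simp add: J.meq_def J.eqv_def)
    let ?f = "\<lambda>i j. mid i j - e i j"
    have "\<exists>Y. I.meq n n (mm n Y (\<lambda>i j. mid i j + - e i j)) mid"
      by (rule I.left_inverse_near_identity[where Q = "\<lambda>i j. - e i j", OF J])
        (simp_all add: rad e J.uminus_mem)
    then obtain Y where Xf: "I.meq n n (mm n Y ?f) mid" by auto
    have "I.meq n n (mm n ?f e) (\<lambda>_ _. 0)"
      using I.meq_sym[OF zero(3)] by (simp add: I.meq_def mm_diff_left mm_mid_left I.eqv_def)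
    then have "I.meq n n (mm n Y (mm n ?f e)) (mm n Y (\<lambda>_ _. 0))"
      by (intro I.meq_mm I.meq_refl)
    then have 0: "I.meq n n (mm n (mm n Y ?f) e) (\<lambda>_ _. 0)"
      unfolding mm_assoc by (simp add: mm_def[of n Y "\<lambda>_ _. 0"] fun_eq_iff I.meq_def)
    have "I.meq n n (mm n (mm n Y ?f) e) (mm n mid e)" by (intro I.meq_mm Xf I.meq_refl)
    from I.meq_trans[OF I.meq_sym[OF this] 0] have "I.meq n n (mm n mid e) (\<lambda>_ _. 0)" .
    then have "I.meq n n e (\<lambda>_ _. 0)" by (rule I.meq_trans[OF I.meq_sym[OF I.meq_mid_left]])
    then show ?case by (rule I.finite_free_res.zero)
  next
    case (step n t \<phi> \<sigma> e')
    note st = J.meq_trans[OF step(1) step.prems(1)]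
      J.meq_trans[OF J.meq_mm[OF J.meq_sym[OF step.prems(1)] J.meq_refl] step(2)]
    define Q where "Q i j = mm t \<phi> \<sigma> i j - e i j" for i j
    have Q: "Q i j \<in> J" if "i < n" "j < n" for i j
      using st(1) that by (simp add: J.meq_def J.eqv_def Q_def)
    let ?H = "\<lambda>i j. mid i j + Q i j"
    have "\<exists>Y. I.meq n n (mm n ?H Y) mid"
      by (rule I.right_inverse_near_identity[where Q = Q, OF J]) (simp_all add: rad Q)
    then obtain Y where HX: "I.meq n n (mm n ?H Y) mid" ..
    \<comment> \<open>Multiplying by \<open>e\<close> makes the columns fixed by \<open>e\<close>
      exactly; multiplying by \<open>Y\<close> cancels the error factor 1 + Q.\<close>
    define \<phi>1 where "\<phi>1 = mm n e \<phi>"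
    define \<sigma>1 where "\<sigma>1 = mm n \<sigma> Y"
    have eH: "I.meq n n (mm n e (mm t \<phi> \<sigma>)) (mm n e ?H)"
    proof -
      have 1: "mm n e ?H i j = e i j + (mm n e (mm t \<phi> \<sigma>) i j - mm n e e i j)" if "j < n" for i j
      proof -
        have "mm n e ?H i j = mm n e mid i j + mm n e Q i j" by (simp add: mm_def algebra_simps sum.distrib)
        also have "mm n e mid i j = e i j" using that by (rule mm_mid_right)
        also have "mm n e Q i j = mm n e (mm t \<phi> \<sigma>) i j - mm n e e i j"
          unfolding Q_def[abs_def] by (rule mm_diff_right)
        finally show ?thesis .
      qed
      have "I.eqv (mm n e (mm t \<phi> \<sigma>) i j) (mm n e ?H i j)" if "i < n" "j < n" for i j
      proof -
        have "I.eqv (mm n e e i j + (mm n e (mm t \<phi> \<sigma>) i j - mm n e e i j)) (e i j + (mm n e (mm t \<phi> \<sigma>) i j - mm n e e i j))"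
          using step.prems(2) that by (intro I.eqv_add I.eqv_refl) (auto simp: I.meq_def)
        then show ?thesis unfolding 1[OF that(2)] by simp
      qed
      then show ?thesis by (simp add: I.meq_def)
    qed
    have 1: "I.meq n n (mm t \<phi>1 \<sigma>1) e"
    proof -
      have 1: "mm t \<phi>1 \<sigma>1 = mm n (mm n e (mm t \<phi> \<sigma>)) Y" by (simp only: \<phi>1_def \<sigma>1_def mm_assoc)
      have 2: "I.meq n n (mm n (mm n e (mm t \<phi> \<sigma>)) Y) (mm n (mm n e ?H) Y)"
        by (intro I.meq_mm I.meq_refl eH)
      have 3: "I.meq n n (mm n (mm n e ?H) Y) (mm n e mid)"
        unfolding mm_assoc by (intro I.meq_mm I.meq_refl HX)
      show ?thesis unfolding 1
        by (rule I.meq_trans[OF I.meq_trans[OF 2 3] I.meq_mid_right])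
    qed
    have 2: "I.meq n t (mm n e \<phi>1) \<phi>1"
      unfolding \<phi>1_def mm_assoc[symmetric] by (intro I.meq_mm I.meq_refl step.prems(2))
    have "J.meq n n mid Y"
    proof -
      have "J.meq n n ?H mid" using Q by (auto simp: J.meq_def J.eqv_def)
      then have "J.meq n n (mm n ?H Y) (mm n mid Y)" by (intro J.meq_mm J.meq_refl)
      then show ?thesis
        by (rule J.meq_trans[OF J.meq_sym[OF sub[OF HX]] J.meq_trans[OF _ J.meq_mid_left]])
    qed
    then have "J.meq t n (mm n \<sigma> mid) (mm n \<sigma> Y)" by (intro J.meq_mm J.meq_refl)
    then have "J.meq t n \<sigma> \<sigma>1" unfolding \<sigma>1_def
      by (rule J.meq_trans[OF J.meq_sym[OF J.meq_mid_right]])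
    moreover have "J.meq n t \<phi> \<phi>1" unfolding \<phi>1_def by (rule J.meq_sym[OF st(2)])
    ultimately have "J.meq t t (mm n \<sigma> \<phi>) (mm n \<sigma>1 \<phi>1)" by (intro J.meq_mm)
    then have 3: "J.meq t t (\<lambda>i j. mid i j - mm n \<sigma> \<phi> i j) (\<lambda>i j. mid i j - mm n \<sigma>1 \<phi>1 i j)"
      by (intro J.meq_diff J.meq_refl)
    show ?case
      by (rule I.finite_free_res.step[OF 1 2 step.IH[OF 3 I.kernel_idempotent[OF 1 2]]])
  qed
  from this[OF assms(5) J.meq_refl assms(6)] show ?thesis .
qed

section \<open>Dickson's lemma and polynomials over a chain ring\<close>

text \<open>Every sequence has a monotone subsequence, and a decreasing one in the naturals is
  constant once it has reached its least value.\<close>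

lemma monoseq_nat_incseq_subseq:
  fixes f :: "nat \<Rightarrow> nat"
  shows "\<exists>r. strict_mono r \<and> incseq (f \<circ> r)"
proof -
  obtain r where r: "strict_mono r" "monoseq (\<lambda>n. f (r n))" using seq_monosub[of f] by blast
  then consider "incseq (\<lambda>n. f (r n))" | "decseq (\<lambda>n. f (r n))" by (auto simp: monoseq_iff)
  then show ?thesis
  proof cases
    case 1
    with r show ?thesis by (auto simp: o_def)
  next
    case 2
    define N where "N = (LEAST v. v \<in> range (\<lambda>n. f (r n)))"
    have "N \<in> range (\<lambda>n. f (r n))" unfolding N_def by (rule LeastI) (rule rangeI)
    then obtain k where k: "N = f (r k)" by blast
    have "f (r (k + n)) = N" for n
    proof (rule antisym)
      show "f (r (k + n)) \<le> N" using 2 by (simp add: k decseq_def)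
      show "N \<le> f (r (k + n))" unfolding N_def by (rule Least_le) (rule rangeI)
    qed
    moreover have "strict_mono (\<lambda>n. r (k + n))" using r(1) by (auto simp: strict_mono_def)
    ultimately show ?thesis by (intro exI[of _ "\<lambda>n. r (k + n)"]) (simp add: incseq_def)
  qed
qed

lemma incseq_subseq_finite:
  fixes f :: "nat \<Rightarrow> 'b \<Rightarrow> nat"
  assumes "finite S"
  shows "\<exists>r. strict_mono r \<and> (\<forall>x\<in>S. incseq (\<lambda>n. f (r n) x))"
  using assms
proof induction
  case empty
  then show ?case by (auto intro!: exI[of _ id] simp: strict_mono_def)
next
  case (insert x S)
  then obtain r where r: "strict_mono r" "\<And>x. x \<in> S \<Longrightarrow> incseq (\<lambda>n. f (r n) x)" by blast
  obtain q where q: "strict_mono q" "incseq ((\<lambda>n. f (r n) x) \<circ> q)"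
    using monoseq_nat_incseq_subseq by blast
  have "strict_mono (r \<circ> q)" using r(1) q(1) by (rule strict_mono_o)
  moreover have "incseq (\<lambda>n. f ((r \<circ> q) n) y)" if "y \<in> S" for y
    using r(2)[OF that] strict_mono_leD[OF q(1)] by (simp add: incseq_def)
  ultimately show ?case using q(2) by (intro exI[of _ "r \<circ> q"]) (auto simp: o_def)
qed

text \<open>Dickson's lemma. Recording both the component \<open>i\<close> and \<open>n - i\<close> makes the components
  constant along a monotone subsequence.\<close>

lemma finite_antichain_monomials:
  fixes A :: "(nat multiset \<times> nat) set"
  assumes A: "A \<subseteq> {(u, i). i < n \<and> set_mset u \<subseteq> {..m}}"
    and anti: "\<And>u v i. (u, i) \<in> A \<Longrightarrow> (v, i) \<in> A \<Longrightarrow> u \<subseteq># v \<Longrightarrow> u = v"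
  shows "finite A"
proof (rule ccontr)
  assume "infinite A"
  then obtain f :: "nat \<Rightarrow> nat multiset \<times> nat" where f: "inj f" "range f \<subseteq> A"
    using infinite_countable_subset by blast
  define F where "F k x = (if x \<le> m then count (fst (f k)) x else if x = Suc m then snd (f k) else n - snd (f k))"
    for k x
  obtain r where r: "strict_mono r" "\<And>x. x \<in> {..Suc (Suc m)} \<Longrightarrow> incseq (\<lambda>k. F (r k) x)"
    using incseq_subseq_finite[of "{..Suc (Suc m)}" F] by blast
  obtain u i where u: "f (r 0) = (u, i)" by fastforce
  obtain v j where v: "f (r (Suc 0)) = (v, j)" by fastforce
  have uv: "(u, i) \<in> A" "(v, j) \<in> A" using f(2) u v by (metis rangeI subsetD)+
  have le: "F (r 0) x \<le> F (r (Suc 0)) x" if "x \<le> Suc (Suc m)" for x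
    using r(2)[of x] that by (auto simp: incseq_def)
  have "i = j" using le[of "Suc m"] le[of "Suc (Suc m)"] uv A by (auto simp: F_def u v)
  moreover have "u \<subseteq># v"
  proof (rule mset_subset_eqI)
    fix x
    show "count u x \<le> count v x"
    proof (cases "x \<le> m")
      case True
      then show ?thesis using le[of x] by (simp add: F_def u v)
    next
      case False
      then have "x \<notin># u" using uv A by auto
      then show ?thesis by (simp add: not_in_iff)
    qed
  qed
  ultimately have "f (r 0) = f (r (Suc 0))" using anti[of u i v] uv by (simp add: u v)
  then have "r 0 = r (Suc 0)" using f(1) by (simp add: inj_def)
  then show False using strict_monoD[OF r(1), of 0 "Suc 0"] by simp
qed

section \<open>Polynomials as finitely supported functions on multisets of variables\<close>

type_synonym 't mpoly = "nat multiset \<Rightarrow>\<^sub>0 't"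

lemma poly_mapping_sum_single:
  fixes p :: "'k \<Rightarrow>\<^sub>0 't::comm_monoid_add"
  assumes "finite S" "Poly_Mapping.keys p \<subseteq> S"
  shows "p = (\<Sum>\<alpha>\<in>S. Poly_Mapping.single \<alpha> (Poly_Mapping.lookup p \<alpha>))"
proof (rule poly_mapping_eqI)
  fix k
  have "(\<Sum>\<alpha>\<in>S. Poly_Mapping.lookup (Poly_Mapping.single \<alpha> (Poly_Mapping.lookup p \<alpha>)) k)
      = (\<Sum>\<alpha>\<in>S. if \<alpha> = k then Poly_Mapping.lookup p k else 0)"
    by (rule sum.cong) (auto simp: lookup_single when_def)
  also have "\<dots> = Poly_Mapping.lookup p k"
    using assms by (auto simp: in_keys_iff)
  finally show "Poly_Mapping.lookup p k
      = Poly_Mapping.lookup (\<Sum>\<alpha>\<in>S. Poly_Mapping.single \<alpha> (Poly_Mapping.lookup p \<alpha>)) k"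
    by (simp add: lookup_sum)
qed

lemma lookup_single_mult:
  fixes p :: "'t::comm_ring_1 mpoly"
  shows "Poly_Mapping.lookup (Poly_Mapping.single \<gamma> c * p) \<delta> =
    (if \<gamma> \<subseteq># \<delta> then c * Poly_Mapping.lookup p (\<delta> - \<gamma>) else 0)"
proof -
  have "Poly_Mapping.lookup (Poly_Mapping.single \<gamma> c * p) \<delta>
      = (\<Sum>q. c * Poly_Mapping.lookup p q when \<delta> = \<gamma> + q)"
    by (simp add: lookup_mult lookup_single when_mult Sum_any_right_distrib mult_when)
  also have "\<dots> = (if \<gamma> \<subseteq># \<delta> then c * Poly_Mapping.lookup p (\<delta> - \<gamma>) else 0)"
  proof (cases "\<gamma> \<subseteq># \<delta>")
    case True
    then have "(\<delta> = \<gamma> + q) = (q = \<delta> - \<gamma>)" for q by (auto simp: subset_mset.add_diff_inverse)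
    then show ?thesis using True by simp
  next
    case False
    then have "\<not> (\<delta> = \<gamma> + q)" for q by auto
    then show ?thesis using False by simp
  qed
  finally show ?thesis .
qed

definition coeffs_in :: "'t::comm_ring_1 set \<Rightarrow> 't mpoly set"
  where "coeffs_in J = {p. \<forall>\<alpha>. Poly_Mapping.lookup p \<alpha> \<in> J}"

context cr_ideal
begin

lemma cr_ideal_coeffs_in: "cr_ideal (coeffs_in K)"
proof
  fix x y :: "'p mpoly" assume x: "x \<in> coeffs_in K"
  show "y * x \<in> coeffs_in K"
  proof -
    have "Poly_Mapping.single \<gamma> c * x \<in> coeffs_in K" for \<gamma> c
      using x by (auto simp: coeffs_in_def lookup_single_mult zero_mem mult_mem)
    moreover have "y * x = (\<Sum>\<gamma>\<in>Poly_Mapping.keys y. Poly_Mapping.single \<gamma> (Poly_Mapping.lookup y \<gamma>) * x)"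
      by (subst poly_mapping_sum_single[of "Poly_Mapping.keys y" y]) (auto simp: sum_distrib_right)
    ultimately show ?thesis by (simp add: coeffs_in_def lookup_sum sum_mem)
  qed
qed (auto simp: coeffs_in_def lookup_add zero_mem add_mem)

end

text \<open>\<open>T/J\<close> is a valuation domain.\<close>

locale chain_prime = cr_ideal J for J :: "'t::comm_ring_1 set" +
  assumes prime: "x * y \<in> J \<Longrightarrow> x \<in> J \<or> y \<in> J"
    and one_notin: "1 \<notin> J"
    and chain: "\<exists>z. x - z * y \<in> J \<or> y - z * x \<in> J"
begin

notation eqv (infix \<open>\<asymp>\<close> 50)

text \<open>The preimage of the maximal ideal of the local ring T/J; \<open>inv_mod\<close> refers
  to invertibility modulo \<open>J\<close>.\<close>

definition nonunits :: "'t set" where "nonunits = {x. \<not> inv_mod x}"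

lemma inv_mod_cong: "inv_mod x \<Longrightarrow> x \<asymp> y \<Longrightarrow> inv_mod y"
  unfolding inv_mod_def using eqv_trans[OF eqv_mult[OF eqv_sym eqv_refl]] by blast

lemma inv_mod_multD: "inv_mod (y * x) \<Longrightarrow> inv_mod x"
  unfolding inv_mod_def by (metis mult.assoc mult.commute)

lemma inv_mod_mult:
  assumes "inv_mod x" "inv_mod y"
  shows "inv_mod (x * y)"
proof -
  from assms obtain v w where v: "x * v \<asymp> 1" and w: "y * w \<asymp> 1" by (auto simp: inv_mod_def)
  have "(x * y) * (v * w) \<asymp> 1" using eqv_mult[OF v w] by (simp add: ac_simps)
  then show ?thesis by (auto simp: inv_mod_def)
qed

lemma J_nonunits: "J \<subseteq> nonunits"
proof
  fix x assume x: "x \<in> J"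
  have "\<not> x * v \<asymp> 1" for v
  proof
    assume "x * v \<asymp> 1"
    then have "x * v - 1 \<in> J" by (simp add: eqv_def)
    from diff_mem[OF mult_mem_right[OF x, of v] this] show False using one_notin by simp
  qed
  then show "x \<in> nonunits" by (auto simp: nonunits_def inv_mod_def)
qed

lemma inv_mod_one: "inv_mod 1"
  unfolding inv_mod_def by (rule exI[of _ 1]) simp

text \<open>A valuation ring is local: if a = z b, then a + b = (z + 1) b is a multiple of b, so it
  is not a unit unless b is one.\<close>

lemma cr_ideal_nonunits: "cr_ideal nonunits"
proof
  show "0 \<in> nonunits" using J_nonunits zero_mem by blast
next
  fix x y :: 't assume "x \<in> nonunits"
  then show "y * x \<in> nonunits" using inv_mod_multD by (auto simp: nonunits_def)
next
  fix x y assume xy: "x \<in> nonunits" "y \<in> nonunits"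
  have *: "a + b \<in> nonunits" if b: "b \<in> nonunits" and z: "a - z * b \<in> J" for a b z
  proof -
    have "\<not> inv_mod (a + b)"
    proof
      assume "inv_mod (a + b)"
      moreover have "a + b \<asymp> (z + 1) * b" using z by (simp add: eqv_def algebra_simps)
      ultimately have "inv_mod b" using inv_mod_cong inv_mod_multD by blast
      with b show False by (simp add: nonunits_def)
    qed
    then show ?thesis by (simp add: nonunits_def)
  qed
  from chain[of x y] *[of y x] *[of x y] xy show "x + y \<in> nonunits" by (auto simp: add.commute)
qed

sublocale M: cr_ideal nonunits by (rule cr_ideal_nonunits)

sublocale JJ: cr_ideal "coeffs_in J" by (rule cr_ideal_coeffs_in)

lemma inv_mod_add: "inv_mod u \<Longrightarrow> x \<in> nonunits \<Longrightarrow> inv_mod (u + x)"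
  using M.diff_mem[of "u + x" x] by (auto simp: nonunits_def)

lemma mem_nonunits_iff: "x \<in> nonunits \<longleftrightarrow> \<not> inv_mod x" by (simp add: nonunits_def)

text \<open>The element \<open>f b0\<close> that divides all the others serves as the content of a
  vector with coefficients \<open>f\<close>.\<close>

lemma chain_finite:
  assumes "finite B" "\<exists>b\<in>B. f b \<notin> J"
  shows "\<exists>b0\<in>B. f b0 \<notin> J \<and> (\<forall>b\<in>B. \<exists>z. f b - z * f b0 \<in> J)"
  using assms
proof induction
  case (insert x B)
  show ?case
  proof (cases "\<exists>b\<in>B. f b \<notin> J")
    case False
    then have "f b - 0 * f x \<in> J" if "b \<in> B" for b using that by auto
    moreover have "f x - 1 * f x \<in> J" by (simp add: zero_mem)
    moreover have "f x \<notin> J" using False insert.prems by blast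
    ultimately show ?thesis by (metis insert_iff)
  next
    case True
    then obtain b0 where b0: "b0 \<in> B" "f b0 \<notin> J" and z: "\<And>b. b \<in> B \<Longrightarrow> \<exists>z. f b - z * f b0 \<in> J"
      using insert.IH by blast
    consider z where "f x - z * f b0 \<in> J" | z where "f b0 - z * f x \<in> J"
      using chain[of "f x" "f b0"] by blast
    then show ?thesis
    proof cases
      case 1
      with b0 z show ?thesis by (intro bexI[of _ b0]) auto
    next
      case (2 z0)
      have "f x \<notin> J"
      proof
        assume "f x \<in> J"
        from add_mem[OF 2 mult_mem[OF this, of z0]] b0 show False by simp
      qed
      moreover have "\<exists>z. f b - z * f x \<in> J" if "b \<in> B" for b
      proof -
        obtain z1 where "f b - z1 * f b0 \<in> J" using z[OF \<open>b \<in> B\<close>] by blast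
        from add_mem[OF this mult_mem[OF 2, of z1]] have "f b - (z1 * z0) * f x \<in> J"
          by (simp add: algebra_simps)
        then show ?thesis by blast
      qed
      moreover have "f x - 1 * f x \<in> J" by (simp add: zero_mem)
      ultimately show ?thesis by (metis insert_iff)
    qed
  qed
qed simp

end

section \<open>Leading terms of saturated modules of polynomial vectors\<close>

text \<open>A monomial of a free module is a pair: exponent and index of a basis vector. Vectors are
  functions on all of \<open>nat\<close>; the rank only enters through \<open>box\<close>.\<close>

definition cf :: "(nat \<Rightarrow> 't::comm_ring_1 mpoly) \<Rightarrow> nat multiset \<times> nat \<Rightarrow> 't"
  where "cf f b = Poly_Mapping.lookup (f (snd b)) (fst b)"

definition sh :: "nat multiset \<Rightarrow> (nat \<Rightarrow> 't::comm_ring_1 mpoly) \<Rightarrow> nat \<Rightarrow> 't mpoly"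
  where "sh v f = (\<lambda>i. Poly_Mapping.single v 1 * f i)"

definition mkv :: "(nat multiset \<times> nat) set \<Rightarrow> (nat multiset \<times> nat \<Rightarrow> 't::comm_ring_1) \<Rightarrow> nat \<Rightarrow> 't mpoly"
  where "mkv B z = (\<lambda>i. \<Sum>b\<in>B. if snd b = i then Poly_Mapping.single (fst b) (z b) else 0)"

text \<open>\<open>\<delta> i\<close> is the degree given to the basis vector \<open>i\<close>, like
  the shifts in a graded free module. The finiteness of boxes reduces everything to linear
  algebra.\<close>

definition box :: "nat \<Rightarrow> nat \<Rightarrow> (nat \<Rightarrow> nat) \<Rightarrow> nat \<Rightarrow> (nat multiset \<times> nat) set"
  where "box m n \<delta> d = {(\<alpha>, i). i < n \<and> set_mset \<alpha> \<subseteq> {..<m} \<and> size \<alpha> + \<delta> i \<le> d}"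

definition vecs_le :: "nat \<Rightarrow> nat \<Rightarrow> (nat \<Rightarrow> nat) \<Rightarrow> nat \<Rightarrow> (nat \<Rightarrow> 't::comm_ring_1 mpoly) set"
  where "vecs_le m n \<delta> d = {f. \<forall>b. cf f b \<noteq> 0 \<longrightarrow> b \<in> box m n \<delta> d}"

lemma cf_diff: "cf (\<lambda>i. f i - g i) b = cf f b - cf g b"
  by (simp add: cf_def lookup_minus)

lemma cf_sum: "cf (\<lambda>i. \<Sum>x\<in>S. f x i) b = (\<Sum>x\<in>S. cf (f x) b)"
  by (simp add: cf_def lookup_sum)

lemma cf_scale: "cf (\<lambda>i. Poly_Mapping.single {#} c * f i) b = c * cf f b"
  by (simp add: cf_def lookup_single_mult)

lemma cf_sh: "cf (sh v f) b = (if v \<subseteq># fst b then cf f (fst b - v, snd b) else 0)"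
  by (simp add: cf_def sh_def lookup_single_mult)

lemma cf_mkv: "finite B \<Longrightarrow> cf (mkv B z) b = (if b \<in> B then z b else 0)"
proof -
  assume B: "finite B"
  have "cf (mkv B z) b = (\<Sum>x\<in>B. if x = b then z b else 0)"
    unfolding cf_def mkv_def lookup_sum
    by (rule sum.cong) (auto simp: lookup_single when_def prod_eq_iff)
  then show ?thesis using B by simp
qed

lemma cf_eqI: "(\<And>b. cf f b = cf g b) \<Longrightarrow> f = g"
  by (intro ext poly_mapping_eqI) (simp add: cf_def split_paired_all)

lemma finite_box: "finite (box m n \<delta> d)"
proof -
  have "finite (mset ` {xs. set xs \<subseteq> {..<m} \<and> length xs \<le> d} \<times> {..<n})"
    by (intro finite_cartesian_product finite_imageI finite_lists_length_le) auto
  moreover have "box m n \<delta> d \<subseteq> mset ` {xs. set xs \<subseteq> {..<m} \<and> length xs \<le> d} \<times> {..<n}"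
  proof
    fix b assume b: "b \<in> box m n \<delta> d"
    obtain \<alpha> i where [simp]: "b = (\<alpha>, i)" by fastforce
    obtain xs where "mset xs = \<alpha>" using ex_mset by blast
    with b show "b \<in> mset ` {xs. set xs \<subseteq> {..<m} \<and> length xs \<le> d} \<times> {..<n}"
      by (auto simp: box_def)
  qed
  ultimately show ?thesis by (rule finite_subset[rotated])
qed

lemma vecs_le_box: "f \<in> vecs_le m n \<delta> d \<Longrightarrow> b \<notin> box m n \<delta> d \<Longrightarrow> cf f b = 0"
  unfolding vecs_le_def by blast

lemma vecs_le_eq_mkv: "f \<in> vecs_le m n \<delta> d \<Longrightarrow> f = mkv (box m n \<delta> d) (cf f)"
  by (intro cf_eqI) (auto simp: cf_mkv finite_box vecs_le_box)

lemma mkv_vecs_le: "B \<subseteq> box m n \<delta> d \<Longrightarrow> mkv B z \<in> vecs_le m n \<delta> d"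
  using finite_subset[OF _ finite_box] by (auto simp: vecs_le_def cf_mkv split: if_splits)

lemma vecs_le_diff: "f \<in> vecs_le m n \<delta> d \<Longrightarrow> g \<in> vecs_le m n \<delta> d \<Longrightarrow> (\<lambda>i. f i - g i) \<in> vecs_le m n \<delta> d"
  by (auto simp: vecs_le_def cf_diff) (metis diff_0_right)

lemma vecs_le_combination:
  "(\<And>x. x \<in> S \<Longrightarrow> f x \<in> vecs_le m n \<delta> d) \<Longrightarrow>
    (\<lambda>i. \<Sum>x\<in>S. Poly_Mapping.single {#} (c x) * f x i) \<in> vecs_le m n \<delta> d"
proof -
  assume f: "\<And>x. x \<in> S \<Longrightarrow> f x \<in> vecs_le m n \<delta> d"
  have "cf (\<lambda>i. \<Sum>x\<in>S. Poly_Mapping.single {#} (c x) * f x i) b = 0" if "b \<notin> box m n \<delta> d" for b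
    unfolding cf_sum[where f = "\<lambda>x i. Poly_Mapping.single {#} (c x) * f x i"] cf_scale
    using vecs_le_box[OF f that] by simp
  then show ?thesis by (auto simp: vecs_le_def)
qed

lemma sh_vecs_le:
  assumes "f \<in> vecs_le m n \<delta> d'" "set_mset v \<subseteq> {..<m}" "size v + d' \<le> d"
  shows "sh v f \<in> vecs_le m n \<delta> d"
proof -
  have "(\<alpha>, i) \<in> box m n \<delta> d" if "cf (sh v f) (\<alpha>, i) \<noteq> 0" for \<alpha> i
  proof -
    from that have v: "v \<subseteq># \<alpha>" and "cf f (\<alpha> - v, i) \<noteq> 0" by (auto simp: cf_sh split: if_splits)
    with assms(1) have b: "(\<alpha> - v, i) \<in> box m n \<delta> d'" by (simp add: vecs_le_def)
    have \<alpha>: "\<alpha> = (\<alpha> - v) + v" using v by simp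
    have "size \<alpha> = size (\<alpha> - v) + size v" by (subst \<alpha>) (rule size_union)
    moreover have "set_mset \<alpha> = set_mset (\<alpha> - v) \<union> set_mset v" by (subst \<alpha>) (rule set_mset_union)
    ultimately show ?thesis using b assms(2,3) by (auto simp: box_def)
  qed
  then show ?thesis by (auto simp: vecs_le_def)
qed

text \<open>Maxima are only taken in finite boxes, so compatibility and totality suffice. Totality
  is asked for indices below \<open>n\<close>, where the vectors live.\<close>

definition mon_order :: "nat \<Rightarrow> (nat multiset \<times> nat \<Rightarrow> nat multiset \<times> nat \<Rightarrow> bool) \<Rightarrow> bool"
  where "mon_order n lt \<longleftrightarrow> (\<forall>a. \<not> lt a a) \<and> (\<forall>a b c. lt a b \<longrightarrow> lt b c \<longrightarrow> lt a c) \<and>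
    (\<forall>a b. snd a < n \<longrightarrow> snd b < n \<longrightarrow> a \<noteq> b \<longrightarrow> lt a b \<or> lt b a) \<and>
    (\<forall>\<alpha> i \<beta> j \<gamma>. lt (\<alpha>, i) (\<beta>, j) \<longrightarrow> lt (\<alpha> + \<gamma>, i) (\<beta> + \<gamma>, j))"

lemma mon_order_asymp: "mon_order n lt \<Longrightarrow> asymp_on S lt"
  unfolding mon_order_def asymp_on_def by blast

lemma mon_order_transp: "mon_order n lt \<Longrightarrow> transp_on S lt"
  unfolding mon_order_def transp_on_def by blast

text \<open>A monomial in the variables \<open>0, \<dots>, m\<close> is a monomial in \<open>0, \<dots>, m - 1\<close> together with an
  upper bound on the degree: the variable \<open>m\<close> homogenizes.\<close>

definition dehom :: "nat \<Rightarrow> nat multiset \<Rightarrow> nat multiset"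
  where "dehom m u = filter_mset (\<lambda>x. x < m) u"

definition hom_mon :: "nat \<Rightarrow> nat \<Rightarrow> nat multiset \<Rightarrow> nat multiset"
  where "hom_mon m k \<alpha> = \<alpha> + replicate_mset k m"

lemma dehom_add: "dehom m (u + v) = dehom m u + dehom m v"
  by (simp add: dehom_def)

lemma dehom_vars: "set_mset (dehom m u) \<subseteq> {..<m}"
  by (auto simp: dehom_def)

lemma size_dehom: "size (dehom m u) \<le> size u"
  by (simp add: dehom_def size_filter_mset_lesseq)

lemma dehom_hom_mon: "set_mset \<alpha> \<subseteq> {..<m} \<Longrightarrow> dehom m (hom_mon m k \<alpha>) = \<alpha>"
proof -
  assume "set_mset \<alpha> \<subseteq> {..<m}"
  then have "filter_mset (\<lambda>x. x < m) \<alpha> = \<alpha>" by (auto simp: filter_mset_eq_conv)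
  moreover have "filter_mset (\<lambda>x. x < m) (replicate_mset k m) = {#}" by (induction k) auto
  ultimately show ?thesis by (simp add: dehom_def hom_mon_def)
qed

lemma size_hom_mon: "size (hom_mon m k \<alpha>) = size \<alpha> + k"
  by (simp add: hom_mon_def)

lemma hom_mon_vars: "set_mset \<alpha> \<subseteq> {..<m} \<Longrightarrow> set_mset (hom_mon m k \<alpha>) \<subseteq> {..m}"
  by (auto simp: hom_mon_def)

text \<open>The exponent of the homogenizing variable \<open>m\<close> is the total degree minus the
  degree in the other variables.\<close>

lemma hom_monomial_eqI:
  assumes u: "set_mset u \<subseteq> {..m}" and v: "set_mset v \<subseteq> {..m}"
    and eq: "dehom m u = dehom m v" "size u = size v"
  shows "u = v"
proof -
  have *: "w = hom_mon m (count w m) (dehom m w)" if "set_mset w \<subseteq> {..m}" for w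
  proof -
    have "w = filter_mset (\<lambda>x. x < m) w + filter_mset (\<lambda>x. \<not> x < m) w" by (rule multiset_partition)
    also have "filter_mset (\<lambda>x. \<not> x < m) w = filter_mset (\<lambda>x. x = m) w"
      by (rule filter_mset_cong) (use that in force)+
    also have "\<dots> = replicate_mset (count w m) m" by (rule filter_eq_replicate_mset)
    finally show ?thesis by (simp add: hom_mon_def dehom_def)
  qed
  have "size u = size (dehom m u) + count u m" "size v = size (dehom m v) + count v m"
    using *[OF u] *[OF v] size_hom_mon by metis+
  with eq have "count u m = count v m" by simp
  then show ?thesis using *[OF u] *[OF v] eq(1) by metis
qed

text \<open>\<open>P_null\<close> makes \<open>P\<close> the full preimage of a submodule over V[x].
  \<open>P_sat\<close> says that the quotient by this submodule has no V-torsion, as is the case for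
  kernels and direct summands.\<close>

locale saturated_module = chain_prime J for J :: "'t::comm_ring_1 set" +
  fixes P :: "(nat \<Rightarrow> 't mpoly) set"
  assumes P_add: "f \<in> P \<Longrightarrow> g \<in> P \<Longrightarrow> (\<lambda>i. f i + g i) \<in> P"
    and P_mult: "f \<in> P \<Longrightarrow> (\<lambda>i. p * f i) \<in> P"
    and P_sat: "c \<notin> J \<Longrightarrow> (\<lambda>i. Poly_Mapping.single {#} c * f i) \<in> P \<Longrightarrow> f \<in> P"
    and P_null: "(\<And>b. cf f b \<in> J) \<Longrightarrow> f \<in> P"
begin

lemma P_diff: "f \<in> P \<Longrightarrow> g \<in> P \<Longrightarrow> (\<lambda>i. f i - g i) \<in> P"
  using P_add[of f "\<lambda>i. (- 1) * g i"] P_mult[of g "- 1"] by simp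

lemma P_sum: "(\<And>x. x \<in> S \<Longrightarrow> f x \<in> P) \<Longrightarrow> (\<lambda>i. \<Sum>x\<in>S. f x i) \<in> P"
proof (induction S rule: infinite_finite_induct)
  case (insert x S)
  then show ?case using P_add[of "f x" "\<lambda>i. \<Sum>x\<in>S. f x i"] by simp
qed (auto intro!: P_null simp: cf_def zero_mem)

lemma P_cong: "f \<in> P \<Longrightarrow> (\<And>b. cf f b - cf g b \<in> J) \<Longrightarrow> g \<in> P"
  using P_diff[of f "\<lambda>i. f i - g i"] P_null[of "\<lambda>i. f i - g i"] by (simp add: cf_diff)

end

locale filtered_module = saturated_module J P for J :: "'t::comm_ring_1 set" and P +
  fixes m n :: nat and \<delta> :: "nat \<Rightarrow> nat" and lt
  assumes order: "mon_order n lt"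
begin

text \<open>This is the leading monomial of the reduction of \<open>f\<close> to the residue field
  of V.\<close>

definition lead :: "(nat \<Rightarrow> 't mpoly) \<Rightarrow> nat multiset \<times> nat \<Rightarrow> bool"
  where "lead f b \<longleftrightarrow> cf f b \<notin> nonunits \<and> (\<forall>b'. lt b b' \<longrightarrow> cf f b' \<in> nonunits)"

lemma leadD: "lead f b \<Longrightarrow> cf f b \<notin> nonunits" "lead f b \<Longrightarrow> lt b b' \<Longrightarrow> cf f b' \<in> nonunits"
  unfolding lead_def by blast+

abbreviation "V \<equiv> vecs_le m n \<delta>"

definition leads :: "nat \<Rightarrow> (nat multiset \<times> nat) set"
  where "leads d = {b. \<exists>f\<in>P \<inter> V d. lead f b}"

text \<open>If c is a nonzero non-unit, the vector c x + 1 of degree 1 has lead 1, although its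
  multiples include no nonzero constant. So a lead is recorded together with a degree bound: the
  exponent of \<open>m\<close> in \<open>u\<close> is the slack between the two.\<close>

definition hom_leads :: "(nat multiset \<times> nat) set"
  where "hom_leads = {(u, i). i < n \<and> set_mset u \<subseteq> {..m} \<and> (dehom m u, i) \<in> leads (size u + \<delta> i)}"

lemma lt_irrefl: "\<not> lt a a"
  and lt_trans: "lt a b \<Longrightarrow> lt b c \<Longrightarrow> lt a c"
  and lt_total: "snd a < n \<Longrightarrow> snd b < n \<Longrightarrow> a \<noteq> b \<Longrightarrow> lt a b \<or> lt b a"
  and lt_add: "lt (\<alpha>, i) (\<beta>, j) \<Longrightarrow> lt (\<alpha> + \<gamma>, i) (\<beta> + \<gamma>, j)"
  using order unfolding mon_order_def by blast+

lemma zero_nonunit: "0 \<in> nonunits" by (rule M.zero_mem)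

lemma lead_in_box: "f \<in> V d \<Longrightarrow> lead f b \<Longrightarrow> b \<in> box m n \<delta> d"
  using vecs_le_box[of f m n \<delta> d b] zero_nonunit leadD(1)[of f b] by metis

lemma leads_box: "leads d \<subseteq> box m n \<delta> d"
  using lead_in_box by (auto simp: leads_def)

lemma finite_leads: "finite (leads d)"
  by (rule finite_subset[OF leads_box finite_box])

lemma lead_exists:
  assumes "f \<in> V d" "cf f b \<notin> nonunits"
  shows "\<exists>b. lead f b"
proof -
  define S where "S = {b. cf f b \<notin> nonunits}"
  have "S \<subseteq> box m n \<delta> d"
    using vecs_le_box[OF assms(1)] zero_nonunit unfolding S_def by fastforce
  then have "finite S" by (rule finite_subset) (rule finite_box)
  then obtain b0 where b0: "b0 \<in> S" "\<And>x. x \<in> S \<Longrightarrow> x \<noteq> b0 \<Longrightarrow> \<not> lt b0 x"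
    using Finite_Set.bex_max_element[OF _ mon_order_asymp[OF order] mon_order_transp[OF order], of S] assms(2)
    unfolding S_def by blast
  have "cf f b' \<in> nonunits" if "lt b0 b'" for b'
    using b0(2)[of b'] that lt_irrefl[of b0] by (cases "b' = b0") (auto simp: S_def)
  with b0(1) show ?thesis unfolding lead_def S_def by blast
qed

text \<open>Divide \<open>f\<close> by a coefficient that divides all the others. The quotient
  \<open>r\<close> remains in \<open>P\<close> by saturation, and its coefficient 1 at the position
  \<open>b0\<close> of the divisor is the unit that is claimed.\<close>

lemma primitive_part:
  assumes f: "f \<in> P" "f \<in> V d" and "cf f b \<notin> J"
  obtains c r where "c \<notin> J" "r \<in> P" "r \<in> V d" "\<And>b. cf f b - c * cf r b \<in> J" "\<exists>b. cf r b \<notin> nonunits"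
proof -
  have "b \<in> box m n \<delta> d" using vecs_le_box[OF f(2), of b] assms(3) zero_mem by metis
  with chain_finite[OF finite_box, of m n \<delta> d "cf f"] assms(3) obtain b0
    where b0: "b0 \<in> box m n \<delta> d" "cf f b0 \<notin> J" and "\<forall>b\<in>box m n \<delta> d. \<exists>z. cf f b - z * cf f b0 \<in> J"
    by blast
  then obtain z where z: "\<And>b. b \<in> box m n \<delta> d \<Longrightarrow> cf f b - z b * cf f b0 \<in> J" by metis
  define r where "r = mkv (box m n \<delta> d) (z(b0 := 1))"
  have cr: "cf r b = (if b \<in> box m n \<delta> d then (z(b0 := 1)) b else 0)" for b
    by (simp add: r_def cf_mkv finite_box)
  have fr: "cf f b - cf f b0 * cf r b \<in> J" for b
    using z[of b] vecs_le_box[OF f(2), of b] by (auto simp: cr mult.commute zero_mem)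
  have "(\<lambda>i. Poly_Mapping.single {#} (cf f b0) * r i) \<in> P"
    by (rule P_cong[OF f(1)]) (simp add: cf_scale fr)
  then have "r \<in> P" by (rule P_sat[OF b0(2)])
  moreover have "cf r b0 \<notin> nonunits" using b0(1) inv_mod_one by (simp add: cr mem_nonunits_iff)
  moreover have "r \<in> V d" unfolding r_def by (rule mkv_vecs_le) simp
  ultimately show thesis using that[of "cf f b0" r] b0(2) fr by blast
qed

lemma lead_sh:
  assumes "f \<in> V d" "lead f (\<alpha>, i)"
  shows "lead (sh v f) (\<alpha> + v, i)"
proof -
  have i: "i < n" using lead_in_box[OF assms] by (simp add: box_def)
  have "cf (sh v f) (\<beta>, j) \<in> nonunits" if lt: "lt (\<alpha> + v, i) (\<beta>, j)" for \<beta> j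
  proof (cases "v \<subseteq># \<beta> \<and> j < n")
    case True
    then have \<beta>: "\<beta> = (\<beta> - v) + v" by simp
    \<comment> \<open>\<open>mon_order\<close> only allows multiplying by \<open>v\<close>; by
      totality it can also be cancelled.\<close>
    have "lt (\<alpha>, i) (\<beta> - v, j)"
    proof (rule ccontr)
      assume "\<not> lt (\<alpha>, i) (\<beta> - v, j)"
      then have "(\<alpha>, i) = (\<beta> - v, j) \<or> lt (\<beta> - v, j) (\<alpha>, i)"
        using lt_total[of "(\<alpha>, i)" "(\<beta> - v, j)"] i True by auto
      then show False
      proof
        assume "(\<alpha>, i) = (\<beta> - v, j)"
        then show False using lt \<beta> lt_irrefl by auto
      next
        assume "lt (\<beta> - v, j) (\<alpha>, i)"
        from lt_trans[OF lt_add[OF this, of v]] lt \<beta> lt_irrefl show False by metis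
      qed
    qed
    then show ?thesis using assms(2) True by (simp add: cf_sh lead_def)
  next
    case False
    then have "cf (sh v f) (\<beta>, j) = 0"
      using vecs_le_box[OF assms(1), of "(\<beta> - v, j)"] by (auto simp: cf_sh box_def)
    then show ?thesis using zero_nonunit by simp
  qed
  then show ?thesis using assms(2) by (auto simp: lead_def cf_sh)
qed

lemma sum_unit:
  assumes "finite B" "x0 \<in> B" "f x0 \<notin> nonunits" "\<And>x. x \<in> B \<Longrightarrow> x \<noteq> x0 \<Longrightarrow> f x \<in> nonunits"
  shows "sum f B \<notin> nonunits"
proof
  assume s: "sum f B \<in> nonunits"
  have "sum f (B - {x0}) \<in> nonunits" using assms(4) by (intro M.sum_mem) auto
  from M.diff_mem[OF s this] show False using assms by (simp add: sum.remove)
qed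

lemma unit_mult: "x \<notin> nonunits \<Longrightarrow> y \<notin> nonunits \<Longrightarrow> x * y \<notin> nonunits"
  using inv_mod_mult by (simp add: mem_nonunits_iff)

text \<open>The coefficients of the \<open>h b\<close> at the leads form a matrix that is triangular
  modulo the non-units, so some combination agrees with \<open>f\<close> at every lead. The
  difference lies in \<open>P\<close> within the same degree. If it were nonzero, its primitive part
  would have a lead in \<open>leads d\<close>, where the difference vanishes: a nonzero constant
  times a unit would be zero in the domain V.\<close>

lemma span_leads:
  assumes h: "\<And>b. b \<in> leads d \<Longrightarrow> h b \<in> P" "\<And>b. b \<in> leads d \<Longrightarrow> h b \<in> V d"
      "\<And>b. b \<in> leads d \<Longrightarrow> lead (h b) b"
    and f: "f \<in> P" "f \<in> V d"
  shows "\<exists>c. \<forall>b'. cf f b' - (\<Sum>b\<in>leads d. c b * cf (h b) b') \<in> J"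
proof -
  have "\<exists>c. \<forall>b'\<in>leads d. eqv (\<Sum>b\<in>leads d. c b * cf (h b) b') (cf f b')"
  proof (rule solve_triangular[OF finite_leads cr_ideal_nonunits, where lt = lt])
    show "inv_mod (u + x)" if "inv_mod u" "x \<in> nonunits" for u x using that by (rule inv_mod_add)
    show "asymp_on (leads d) lt" "transp_on (leads d) lt"
      by (rule mon_order_asymp[OF order] mon_order_transp[OF order])+
    show "totalp_on (leads d) lt"
    proof (rule totalp_onI)
      fix x y assume "x \<in> leads d" "y \<in> leads d" "x \<noteq> y"
      moreover have "snd b < n" if "b \<in> leads d" for b using leads_box that by (force simp: box_def)
      ultimately show "lt x y \<or> lt y x" using lt_total by blast
    qed
    show "inv_mod (cf (h b) b)" if "b \<in> leads d" for b
      using h(3)[OF that] by (simp add: lead_def mem_nonunits_iff)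
    show "cf (h b) b' \<in> nonunits" if "b \<in> leads d" "b' \<in> leads d" "lt b b'" for b b'
      using leadD(2)[OF h(3)[OF that(1)] that(3)] .
  qed
  then obtain c where c: "\<And>b'. b' \<in> leads d \<Longrightarrow> eqv (\<Sum>b\<in>leads d. c b * cf (h b) b') (cf f b')" by blast
  define s where "s = (\<lambda>i. \<Sum>b\<in>leads d. Poly_Mapping.single {#} (c b) * h b i)"
  have cs: "cf s b' = (\<Sum>b\<in>leads d. c b * cf (h b) b')" for b'
    unfolding s_def cf_sum[where f = "\<lambda>b i. Poly_Mapping.single {#} (c b) * h b i"] cf_scale ..
  define r where "r = (\<lambda>i. f i - s i)"
  have "s \<in> P" unfolding s_def by (intro P_sum P_mult h)
  then have rP: "r \<in> P" unfolding r_def by (intro P_diff f)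
  have "s \<in> V d" unfolding s_def by (intro vecs_le_combination h)
  then have rV: "r \<in> V d" unfolding r_def by (intro vecs_le_diff f)
  have "cf r b \<in> J" for b
  proof (rule ccontr)
    assume "cf r b \<notin> J"
    from primitive_part[OF rP rV this] obtain k q where q: "k \<notin> J" "q \<in> P" "q \<in> V d"
      "\<And>b. cf r b - k * cf q b \<in> J" "\<exists>b. cf q b \<notin> nonunits" by blast
    then obtain b1 where b1: "lead q b1" using lead_exists by blast
    then have "b1 \<in> leads d" using q by (auto simp: leads_def)
    from eqv_sym[OF c[OF this]] have "cf r b1 \<in> J" by (simp add: r_def cf_diff cs eqv_def)
    from diff_mem[OF this q(4)[of b1]] have "k * cf q b1 \<in> J" by simp
    then show False using prime q(1) b1 J_nonunits by (auto simp: lead_def)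
  qed
  then show ?thesis by (auto simp: r_def cf_diff cs)
qed

end

section \<open>Syzygies\<close>

definition mv :: "nat \<Rightarrow> (nat \<Rightarrow> nat \<Rightarrow> 'p::comm_ring_1) \<Rightarrow> (nat \<Rightarrow> 'p) \<Rightarrow> nat \<Rightarrow> 'p"
  where "mv n A v i = (\<Sum>j<n. A i j * v j)"

lemma mv_add: "mv n A (\<lambda>j. v j + w j) i = mv n A v i + mv n A w i"
  by (simp add: mv_def distrib_left sum.distrib)

lemma mv_diff: "mv n A (\<lambda>j. v j - w j) i = mv n A v i - mv n A w i"
  by (simp add: mv_def right_diff_distrib sum_subtractf)

lemma mv_scale: "mv n A (\<lambda>j. p * v j) i = p * mv n A v i"
  by (simp add: mv_def sum_distrib_left ac_simps)

context chain_prime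
begin

lemma scale_sat:
  assumes "c \<notin> J" "Poly_Mapping.single {#} c * p \<in> coeffs_in J"
  shows "p \<in> coeffs_in J"
  using assms prime by (auto simp: coeffs_in_def lookup_single_mult)

definition kernel :: "nat \<Rightarrow> (nat \<Rightarrow> nat \<Rightarrow> 't mpoly) \<Rightarrow> (nat \<Rightarrow> 't mpoly) set"
  where "kernel t G = {a. \<forall>i. mv t G a i \<in> coeffs_in J}"

text \<open>Saturation is inherited from polynomials over the domain V, which have no
  V-torsion.\<close>

lemma saturated_kernel: "saturated_module J (kernel t G)"
proof unfold_locales
  fix f g assume "f \<in> kernel t G" "g \<in> kernel t G"
  then show "(\<lambda>i. f i + g i) \<in> kernel t G" by (auto simp: kernel_def mv_add JJ.add_mem)
next
  fix f p assume "f \<in> kernel t G"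
  then show "(\<lambda>i. p * f i) \<in> kernel t G" by (auto simp: kernel_def mv_scale JJ.mult_mem)
next
  fix c f assume "c \<notin> J" "(\<lambda>i. Poly_Mapping.single {#} c * f i) \<in> kernel t G"
  then show "f \<in> kernel t G" using scale_sat by (auto simp: kernel_def mv_scale)
next
  fix f :: "nat \<Rightarrow> 't mpoly" assume f: "\<And>b. cf f b \<in> J"
  have "f j \<in> coeffs_in J" for j
    unfolding coeffs_in_def using f[of "(_, j)"] by (simp add: cf_def)
  then show "f \<in> kernel t G" by (auto simp: kernel_def mv_def intro!: JJ.sum_mem JJ.mult_mem)
qed

end

text \<open>\<open>W j\<close> and \<open>k j\<close> are exponent and component of the homogenized
  lead of the generator \<open>g j\<close>. By \<open>cover\<close> these monomials generate all
  homogenized leads under divisibility.\<close>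

locale generated_module = filtered_module J P m n \<delta> lt
  for J :: "'t::comm_ring_1 set" and P m n \<delta> lt +
  fixes t :: nat and W :: "nat \<Rightarrow> nat multiset" and k :: "nat \<Rightarrow> nat" and g :: "nat \<Rightarrow> nat \<Rightarrow> 't mpoly"
  assumes W: "j < t \<Longrightarrow> k j < n" "j < t \<Longrightarrow> set_mset (W j) \<subseteq> {..m}"
    and g: "j < t \<Longrightarrow> g j \<in> P" "j < t \<Longrightarrow> g j \<in> vecs_le m n \<delta> (size (W j) + \<delta> (k j))"
      "j < t \<Longrightarrow> lead (g j) (dehom m (W j), k j)"
    and cover: "(u, i) \<in> hom_leads \<Longrightarrow> \<exists>j<t. k j = i \<and> W j \<subseteq># u"
begin

definition "w j = dehom m (W j)"
text \<open>The new basis vector \<open>j\<close> gets the degree bound of \<open>g j\<close>, so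
  the map with matrix \<open>G\<close> respects the filtrations by degree.\<close>

definition "\<delta>' j = size (W j) + \<delta> (k j)"
definition "G i j = g j i"

text \<open>Schreyer's order.\<close>

definition lt' :: "nat multiset \<times> nat \<Rightarrow> nat multiset \<times> nat \<Rightarrow> bool"
  where "lt' a b \<longleftrightarrow> lt (fst a + w (snd a), k (snd a)) (fst b + w (snd b), k (snd b)) \<or>
    (fst a + w (snd a), k (snd a)) = (fst b + w (snd b), k (snd b)) \<and> snd a < snd b"

lemma mon_order_lt': "mon_order t lt'"
  unfolding mon_order_def
proof (intro conjI allI impI)
  fix a show "\<not> lt' a a" using lt_irrefl by (simp add: lt'_def)
next
  fix a b c assume 1: "lt' a b" and 2: "lt' b c"
  define key where "key x = (fst x + w (snd x), k (snd x))" for x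
  have "lt (key a) (key b) \<or> key a = key b \<and> snd a < snd b" using 1 unfolding lt'_def key_def .
  moreover have "lt (key b) (key c) \<or> key b = key c \<and> snd b < snd c" using 2 unfolding lt'_def key_def .
  ultimately have "lt (key a) (key c) \<or> key a = key c \<and> snd a < snd c"
    using lt_trans[of "key a" "key b" "key c"] by auto
  then show "lt' a c" unfolding lt'_def key_def .
next
  fix a b :: "nat multiset \<times> nat" assume ab: "snd a < t" "snd b < t" "a \<noteq> b"
  show "lt' a b \<or> lt' b a"
  proof (cases "(fst a + w (snd a), k (snd a)) = (fst b + w (snd b), k (snd b))")
    case True
    then have "snd a \<noteq> snd b" using ab(3) by (auto simp: prod_eq_iff)
    with True show ?thesis by (auto simp: lt'_def)
  next
    case False
    then show ?thesis
      using lt_total[of "(fst a + w (snd a), k (snd a))" "(fst b + w (snd b), k (snd b))"] W(1) ab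
      unfolding lt'_def by auto
  qed
next
  fix \<alpha> i \<beta> j \<gamma> assume "lt' (\<alpha>, i) (\<beta>, j)"
  then show "lt' (\<alpha> + \<gamma>, i) (\<beta> + \<gamma>, j)"
    using lt_add[of "\<alpha> + w i" "k i" "\<beta> + w j" "k j" \<gamma>] by (auto simp: lt'_def ac_simps)
qed

sublocale K: filtered_module J "kernel t G" m t \<delta>' lt'
  by (intro filtered_module.intro saturated_kernel filtered_module_axioms.intro mon_order_lt')

lemma mv_mkv:
  assumes "finite B" "\<And>x. x \<in> B \<Longrightarrow> snd x < t"
  shows "mv t G (mkv B z) i = (\<Sum>x\<in>B. Poly_Mapping.single {#} (z x) * sh (fst x) (g (snd x)) i)"
proof -
  have "mv t G (mkv B z) i = (\<Sum>x\<in>B. \<Sum>j<t. if snd x = j then g j i * Poly_Mapping.single (fst x) (z x) else 0)"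
    unfolding mv_def mkv_def sum_distrib_left G_def
    by (subst sum.swap) (intro sum.cong refl, auto)
  also have "\<dots> = (\<Sum>x\<in>B. g (snd x) i * Poly_Mapping.single (fst x) (z x))"
    by (rule sum.cong) (use assms in auto)
  also have "\<dots> = (\<Sum>x\<in>B. Poly_Mapping.single {#} (z x) * sh (fst x) (g (snd x)) i)"
  proof (rule sum.cong[OF refl])
    fix x
    have 1: "Poly_Mapping.single {#} (z x) * Poly_Mapping.single (fst x) 1 = Poly_Mapping.single (fst x) (z x)"
      by (simp add: mult_single)
    have "Poly_Mapping.single {#} (z x) * sh (fst x) (g (snd x)) i
        = (Poly_Mapping.single {#} (z x) * Poly_Mapping.single (fst x) 1) * g (snd x) i"
      unfolding sh_def by (rule mult.assoc[symmetric])
    also have "\<dots> = g (snd x) i * Poly_Mapping.single (fst x) (z x)"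
      unfolding 1 by (rule mult.commute)
    finally show "g (snd x) i * Poly_Mapping.single (fst x) (z x)
        = Poly_Mapping.single {#} (z x) * sh (fst x) (g (snd x)) i" ..
  qed
  finally show ?thesis .
qed

lemma cf_mv_mkv:
  assumes "finite B" "\<And>x. x \<in> B \<Longrightarrow> snd x < t"
  shows "cf (mv t G (mkv B z)) b = (\<Sum>x\<in>B. z x * cf (sh (fst x) (g (snd x))) b)"
proof -
  have "mv t G (mkv B z) = (\<lambda>i. \<Sum>x\<in>B. Poly_Mapping.single {#} (z x) * sh (fst x) (g (snd x)) i)"
    using mv_mkv[OF assms] by blast
  then show ?thesis
    by (simp only: cf_sum[where f = "\<lambda>x i. Poly_Mapping.single {#} (z x) * sh (fst x) (g (snd x)) i"] cf_scale)
qed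

lemma kernel_cf: "a \<in> kernel t G \<Longrightarrow> cf (mv t G a) b \<in> J"
  by (simp add: kernel_def cf_def coeffs_in_def)

lemma box_t: "x \<in> box m t \<delta>' d \<Longrightarrow> snd x < t"
  by (auto simp: box_def)

lemma shifted_generator:
  assumes "(v, j) \<in> box m t \<delta>' d"
  shows "sh v (g j) \<in> P" "sh v (g j) \<in> V d" "lead (sh v (g j)) (v + w j, k j)"
proof -
  have j: "j < t" and v: "set_mset v \<subseteq> {..<m}" "size v + \<delta>' j \<le> d" using assms by (auto simp: box_def)
  show "sh v (g j) \<in> P" unfolding sh_def by (rule P_mult[OF g(1)[OF j]])
  show "sh v (g j) \<in> V d" using sh_vecs_le[OF g(2)[OF j] v(1)] v(2) by (simp add: \<delta>'_def)
  show "lead (sh v (g j)) (v + w j, k j)"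
    using lead_sh[OF g(2)[OF j] g(3)[OF j], of v] by (simp add: w_def add.commute)
qed

text \<open>Some monomial multiple of the generator \<open>j\<close> has lead \<open>b\<close> and
  stays within degree \<open>d\<close>.\<close>

definition rep_ok :: "nat \<Rightarrow> nat multiset \<times> nat \<Rightarrow> nat \<Rightarrow> bool"
  where "rep_ok d b j \<longleftrightarrow> k j = snd b \<and> w j \<subseteq># fst b \<and> (fst b - w j, j) \<in> box m t \<delta>' d"

text \<open>Divisibility in the variables up to \<open>m\<close> expresses two things at once:
  divisibility of the dehomogenized monomials and enough room below the degree bound.\<close>

lemma rep_okI:
  assumes U: "set_mset U \<subseteq> {..m}" "size U + \<delta> i \<le> d" and j: "j < t" "k j = i" "W j \<subseteq># U"
  shows "rep_ok d (dehom m U, i) j"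
proof -
  have U': "U = (U - W j) + W j" using j(3) by simp
  have d: "dehom m U = dehom m (U - W j) + w j" unfolding w_def by (subst U') (rule dehom_add)
  have "size U = size (U - W j) + size (W j)" by (subst U') (rule size_union)
  then have "size (dehom m (U - W j)) + \<delta>' j \<le> d"
    using size_dehom[of m "U - W j"] U(2) j(2) by (simp add: \<delta>'_def)
  with d j dehom_vars show ?thesis by (simp add: rep_ok_def box_def)
qed

lemma rep_ok_exists:
  assumes "b \<in> leads d"
  shows "\<exists>j. rep_ok d b j"
proof -
  obtain \<alpha> i where b: "b = (\<alpha>, i)" by fastforce
  have bx: "i < n" "set_mset \<alpha> \<subseteq> {..<m}" "size \<alpha> + \<delta> i \<le> d"
    using leads_box assms b by (auto simp: box_def)
  define U where "U = hom_mon m (d - size \<alpha> - \<delta> i) \<alpha>"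
  have U: "set_mset U \<subseteq> {..m}" "dehom m U = \<alpha>" "size U + \<delta> i = d"
    using bx by (simp_all add: U_def hom_mon_vars dehom_hom_mon size_hom_mon)
  then have "(U, i) \<in> hom_leads" using assms b bx by (simp add: hom_leads_def)
  then obtain j where "j < t" "k j = i" "W j \<subseteq># U" using cover by blast
  from rep_okI[OF U(1) _ this] U have "rep_ok d b j" by (simp add: b)
  then show ?thesis ..
qed

text \<open>The choice of the least generator matters for syzygies: a multiple of \<open>g i\<close>
  is rewritten through earlier generators whenever one of them reaches the same lead in the same
  degree.\<close>

definition rep :: "nat \<Rightarrow> nat multiset \<times> nat \<Rightarrow> nat multiset \<times> nat"
  where "rep d b = (let j = (LEAST j. rep_ok d b j) in (fst b - w j, j))"

lemma rep:
  assumes "b \<in> leads d"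
  shows "rep d b \<in> box m t \<delta>' d" "(fst (rep d b) + w (snd (rep d b)), k (snd (rep d b))) = b"
proof -
  obtain j0 where "rep_ok d b j0" using rep_ok_exists[OF assms] by blast
  then have "rep_ok d b (LEAST j. rep_ok d b j)" by (rule LeastI)
  then show "rep d b \<in> box m t \<delta>' d" "(fst (rep d b) + w (snd (rep d b)), k (snd (rep d b))) = b"
    by (auto simp: rep_def Let_def rep_ok_def prod_eq_iff)
qed

lemma rep_least: "rep_ok d b j \<Longrightarrow> snd (rep d b) \<le> j"
  by (simp add: rep_def Let_def Least_le)

definition basis_vec :: "nat \<Rightarrow> nat multiset \<times> nat \<Rightarrow> nat \<Rightarrow> 't mpoly"
  where "basis_vec d b = sh (fst (rep d b)) (g (snd (rep d b)))"

lemma basis_vec: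
  assumes "b \<in> leads d"
  shows "basis_vec d b \<in> P" "basis_vec d b \<in> V d" "lead (basis_vec d b) b"
  using shifted_generator[of "fst (rep d b)" "snd (rep d b)" d] rep[OF assms]
  by (simp_all add: basis_vec_def)

text \<open>\<open>span_leads\<close> applied to the multiples of generators chosen by
  \<open>rep\<close>. It yields both the section of the map \<open>G\<close> and the syzygies.
  Different leads have different representatives, so \<open>a\<close> has just the coefficients
  \<open>c\<close>.\<close>

lemma lift_through_generators:
  assumes "f \<in> P" "f \<in> V d"
  obtains c a where "\<And>b'. cf f b' - (\<Sum>b\<in>leads d. c b * cf (basis_vec d b) b') \<in> J"
    "a \<in> vecs_le m t \<delta>' d" "\<And>b. cf (mv t G a) b = (\<Sum>b'\<in>leads d. c b' * cf (basis_vec d b') b)"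
    "\<And>b. b \<in> leads d \<Longrightarrow> cf a (rep d b) = c b" "\<And>x. x \<notin> rep d ` leads d \<Longrightarrow> cf a x = 0"
proof -
  obtain c where c: "\<And>b'. cf f b' - (\<Sum>b\<in>leads d. c b * cf (basis_vec d b) b') \<in> J"
    using span_leads[OF basis_vec assms] by blast
  \<comment> \<open>The argument of \<open>c\<close> is the lead of the multiple of a generator
    encoded by \<open>x\<close>, so that \<open>z\<close> undoes \<open>rep d\<close>.\<close>
  define z where "z x = c (fst x + w (snd x), k (snd x))" for x
  define a where "a = mkv (rep d ` leads d) z"
  have fin: "finite (rep d ` leads d)" by (rule finite_imageI[OF finite_leads])
  have bx: "rep d ` leads d \<subseteq> box m t \<delta>' d" using rep(1) by blast
  have inj: "inj_on (rep d) (leads d)" by (rule inj_onI) (metis rep(2))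
  have z: "z (rep d b) = c b" if "b \<in> leads d" for b using rep(2)[OF that] by (simp add: z_def)
  have "cf (mv t G a) b = (\<Sum>b'\<in>leads d. c b' * cf (basis_vec d b') b)" for b
  proof -
    have "cf (mv t G a) b = (\<Sum>x\<in>rep d ` leads d. z x * cf (sh (fst x) (g (snd x))) b)"
      unfolding a_def by (rule cf_mv_mkv[OF fin]) (use bx box_t in blast)
    also have "\<dots> = (\<Sum>b'\<in>leads d. z (rep d b') * cf (sh (fst (rep d b')) (g (snd (rep d b')))) b)"
      by (rule sum.reindex_cong[OF inj refl refl])
    also have "\<dots> = (\<Sum>b'\<in>leads d. c b' * cf (basis_vec d b') b)"
      by (rule sum.cong) (simp_all add: z basis_vec_def)
    finally show ?thesis .
  qed
  moreover have "a \<in> vecs_le m t \<delta>' d" unfolding a_def by (rule mkv_vecs_le[OF bx])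
  moreover have "cf a (rep d b) = c b" if "b \<in> leads d" for b
    using that by (simp add: a_def cf_mkv[OF fin] z)
  moreover have "cf a x = 0" if "x \<notin> rep d ` leads d" for x
    using that by (simp add: a_def cf_mkv[OF fin])
  ultimately show thesis using that c by blast
qed

text \<open>Otherwise take the largest \<beta> above \<open>b\<close> with \<open>c \<beta>\<close>
  a unit. At \<beta> the basis vectors with smaller lead have non-unit coefficients and those with
  larger lead are multiplied by non-units, so only the term of \<beta> is a unit. Then
  \<open>f\<close> would have a unit coefficient above its lead.\<close>

lemma coefficient_above_lead:
  assumes f: "lead f b" and b': "b' \<in> leads d" "lt b b'"
    and c: "\<And>b'. cf f b' - (\<Sum>b\<in>leads d. c b * cf (basis_vec d b) b') \<in> J"
  shows "c b' \<in> nonunits"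
proof (rule ccontr)
  assume no: "c b' \<notin> nonunits"
  define S where "S = {x \<in> leads d. lt b x \<and> c x \<notin> nonunits}"
  have "finite S" "b' \<in> S" using finite_leads no b' by (auto simp: S_def)
  then obtain \<beta> where \<beta>: "\<beta> \<in> S" "\<And>x. x \<in> S \<Longrightarrow> x \<noteq> \<beta> \<Longrightarrow> \<not> lt \<beta> x"
    using Finite_Set.bex_max_element[OF _ mon_order_asymp[OF order] mon_order_transp[OF order], of S]
    by blast
  have \<beta>l: "\<beta> \<in> leads d" "lt b \<beta>" "c \<beta> \<notin> nonunits" using \<beta>(1) by (auto simp: S_def)
  have "(\<Sum>x\<in>leads d. c x * cf (basis_vec d x) \<beta>) \<notin> nonunits"
  proof (rule sum_unit[OF finite_leads \<beta>l(1)])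
    show "c \<beta> * cf (basis_vec d \<beta>) \<beta> \<notin> nonunits"
      by (intro unit_mult \<beta>l leadD(1) basis_vec)
    fix x assume x: "x \<in> leads d" "x \<noteq> \<beta>"
    have "snd x < n" "snd \<beta> < n" using leads_box x \<beta>l(1) by (force simp: box_def)+
    then consider "lt x \<beta>" | "lt \<beta> x" using lt_total x(2) by blast
    then show "c x * cf (basis_vec d x) \<beta> \<in> nonunits"
    proof cases
      case 1
      then show ?thesis by (intro M.mult_mem leadD(2)[OF basis_vec(3)[OF x(1)]])
    next
      case 2
      then have "x \<notin> S" using \<beta>(2) x(2) by blast
      then have "c x \<in> nonunits" using x(1) lt_trans[OF \<beta>l(2) 2] by (auto simp: S_def)
      then show ?thesis by (rule M.mult_mem_right)
    qed
  qed
  moreover have "cf f \<beta> \<in> nonunits" using leadD(2)[OF f \<beta>l(2)] .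
  moreover have "cf f \<beta> - (cf f \<beta> - (\<Sum>x\<in>leads d. c x * cf (basis_vec d x) \<beta>)) \<in> nonunits"
    by (rule M.diff_mem[OF calculation(2) subsetD[OF J_nonunits c]])
  ultimately show False by simp
qed

text \<open>Of two generators whose multiples share a lead, the later one is larger in Schreyer's
  order. So a syzygy has its lead at \<open>i\<close> exactly when an earlier generator in the same
  component can cancel the lead of that multiple of \<open>g i\<close>, in the same degree.\<close>

lemma hom_leads_kernel:
  "(U, i) \<in> K.hom_leads \<longleftrightarrow>
    i < t \<and> set_mset U \<subseteq> {..m} \<and> (\<exists>j<i. k j = k i \<and> W j \<subseteq># U + W i)"
  (is "_ \<longleftrightarrow> ?R")
proof
  assume L: "(U, i) \<in> K.hom_leads"
  define D where "D = size U + \<delta>' i"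
  from L have i: "i < t" and U: "set_mset U \<subseteq> {..m}" by (auto simp: K.hom_leads_def)
  from L obtain a where a: "a \<in> kernel t G" "a \<in> vecs_le m t \<delta>' D" "K.lead a (dehom m U, i)"
    by (auto simp: K.hom_leads_def K.leads_def D_def)
  \<comment> \<open>The lead of the multiple of \<open>g i\<close> at which the syzygy
    \<open>a\<close> has its own lead. In the coefficient of G a at \<open>b\<close> this term
    contributes a unit, which the other terms must cancel.\<close>
  define b where "b = (dehom m U + w i, k i)"
  have x0: "(dehom m U, i) \<in> box m t \<delta>' D" by (rule K.lead_in_box[OF a(2,3)])
  have cfa: "cf (mv t G a) b = (\<Sum>x\<in>box m t \<delta>' D. cf a x * cf (sh (fst x) (g (snd x))) b)"
    by (subst vecs_le_eq_mkv[OF a(2)]) (rule cf_mv_mkv[OF finite_box box_t])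
  have "\<exists>j<i. k j = k i \<and> W j \<subseteq># U + W i"
  proof (rule ccontr)
    assume no: "\<not> (\<exists>j<i. k j = k i \<and> W j \<subseteq># U + W i)"
    have "(\<Sum>x\<in>box m t \<delta>' D. cf a x * cf (sh (fst x) (g (snd x))) b) \<notin> nonunits"
    proof (rule sum_unit[OF finite_box x0])
      show "cf a (dehom m U, i) * cf (sh (fst (dehom m U, i)) (g (snd (dehom m U, i)))) b \<notin> nonunits"
        using leadD(1)[OF shifted_generator(3)[OF x0]] K.leadD(1)[OF a(3)] by (simp add: unit_mult b_def)
      fix x assume x: "x \<in> box m t \<delta>' D" "x \<noteq> (dehom m U, i)"
      obtain v j where vj: "x = (v, j)" by fastforce
      have j: "j < t" "set_mset v \<subseteq> {..<m}" "size v + \<delta>' j \<le> D" using x(1) by (auto simp: vj box_def)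
      have "lt' (dehom m U, i) (v, j) \<or> lt' (v, j) (dehom m U, i)"
        using K.lt_total[of "(dehom m U, i)" "(v, j)"] i j x(2) vj by auto
      then consider "lt' (dehom m U, i) (v, j)" | "lt (v + w j, k j) b" | "(v + w j, k j) = b" "j < i"
        by (auto simp: lt'_def b_def)
      then show "cf a x * cf (sh (fst x) (g (snd x))) b \<in> nonunits"
      proof cases
        case 1
        then show ?thesis using K.leadD(2)[OF a(3)] by (simp add: vj M.mult_mem_right)
      next
        case 2
        then show ?thesis
          using leadD(2)[OF shifted_generator(3)[OF x(1)[unfolded vj]]] by (simp add: vj M.mult_mem)
      next
        case 3
        \<comment> \<open>The only possible cancellation is a tie with an earlier generator. Padding
          \<open>v\<close> with \<open>m\<close> to the full degree \<open>D\<close> turns it into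
          the equation Y W_j = U W_i, which exhibits the divisibility.\<close>
        define Y where "Y = hom_mon m (D - size v - \<delta>' j) v"
        have kk: "k j = k i" "v + w j = dehom m U + w i" using 3 by (auto simp: b_def)
        have "Y + W j = U + W i"
        proof (rule hom_monomial_eqI)
          show "set_mset (Y + W j) \<subseteq> {..m}" "set_mset (U + W i) \<subseteq> {..m}"
            using hom_mon_vars[OF j(2)] W(2) i j(1) U by (auto simp: Y_def)
          show "dehom m (Y + W j) = dehom m (U + W i)"
            using kk by (simp add: Y_def dehom_add dehom_hom_mon j(2) w_def)
          show "size (Y + W j) = size (U + W i)"
            using j(3) kk by (simp add: Y_def size_hom_mon D_def \<delta>'_def)
        qed
        then have "W j \<subseteq># U + W i" by (metis mset_subset_eq_add_right)
        then show ?thesis using no 3(2) kk(1) by blast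
      qed
    qed
    then show False using kernel_cf[OF a(1), of b] J_nonunits by (auto simp: cfa)
  qed
  then show ?R using i U by blast
next
  assume ?R
  then obtain j where i: "i < t" and U: "set_mset U \<subseteq> {..m}" and j: "j < i" "k j = k i" "W j \<subseteq># U + W i"
    by blast
  define D where "D = size U + \<delta>' i"
  define u where "u = dehom m U"
  define b where "b = (u + w i, k i)"
  have x0: "(u, i) \<in> box m t \<delta>' D"
    using i size_dehom[of m U] dehom_vars by (auto simp: u_def D_def box_def)
  define f where "f = sh u (g i)"
  note f = shifted_generator[OF x0, folded f_def b_def]
  from lift_through_generators[OF f(1,2)] obtain c a where
      c: "\<And>b'. cf f b' - (\<Sum>b\<in>leads D. c b * cf (basis_vec D b) b') \<in> J"
      and a: "a \<in> vecs_le m t \<delta>' D" "\<And>b. cf (mv t G a) b = (\<Sum>b'\<in>leads D. c b' * cf (basis_vec D b') b)"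
      and ca: "\<And>b. b \<in> leads D \<Longrightarrow> cf a (rep D b) = c b" "\<And>x. x \<notin> rep D ` leads D \<Longrightarrow> cf a x = 0"
    by blast
  define e where "e = mkv {(u, i)} (\<lambda>_. 1 :: 't)"
  \<comment> \<open>The syzygy saying that \<open>u\<close> times \<open>g i\<close> equals its
    expression through the representatives.\<close>
  define s where "s = (\<lambda>l. e l - a l)"
  have ce: "cf e x = (if x = (u, i) then 1 else 0)" for x by (simp add: e_def cf_mkv)
  have cme: "cf (mv t G e) x = cf f x" for x
    unfolding e_def using i by (subst cf_mv_mkv) (simp_all add: f_def)
  have "s \<in> kernel t G"
  proof -
    have "mv t G s l = mv t G e l - mv t G a l" for l unfolding s_def by (rule mv_diff)
    then have "cf (mv t G s) x = cf (mv t G e) x - cf (mv t G a) x" for x by (simp add: cf_def lookup_minus)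
    then have "cf (mv t G s) x \<in> J" for x using c by (simp add: cme a(2))
    from this[of "(_, _)"] show ?thesis by (simp add: kernel_def coeffs_in_def cf_def)
  qed
  moreover have "s \<in> vecs_le m t \<delta>' D"
    unfolding s_def e_def using x0 a(1) by (intro vecs_le_diff mkv_vecs_le) auto
  moreover have "K.lead s (u, i)"
  proof -
    \<comment> \<open>At the lead \<open>b\<close> the representative has index below
      \<open>i\<close>. So the expansion \<open>a\<close> does not involve \<open>(u, i)\<close>,
      where \<open>s\<close> has coefficient 1, and its term at \<open>b\<close> precedes
      \<open>(u, i)\<close> in Schreyer's order.\<close>
    have rj: "snd (rep D b) < i"
    proof -
      have "rep_ok D (dehom m (U + W i), k i) j"
        by (rule rep_okI) (use i U W(2) j in \<open>auto simp: D_def \<delta>'_def\<close>)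
      then have "rep_ok D b j" by (simp add: b_def u_def dehom_add w_def)
      with rep_least j(1) show ?thesis by fastforce
    qed
    have b_lead: "b \<in> leads D" using f by (auto simp: leads_def)
    have "cf a (u, i) = 0"
    proof (rule ca(2))
      show "(u, i) \<notin> rep D ` leads D"
      proof
        assume "(u, i) \<in> rep D ` leads D"
        then obtain b' where b': "b' \<in> leads D" "rep D b' = (u, i)" by auto
        from rep(2)[OF b'(1)] b'(2) have "b' = b" by (simp add: b_def)
        with rj b' show False by simp
      qed
    qed
    then have 1: "cf s (u, i) \<notin> nonunits"
      using inv_mod_one by (simp add: s_def cf_diff ce mem_nonunits_iff)
    have "cf s x \<in> nonunits" if x: "lt' (u, i) x" for x
    proof -
      have "x \<noteq> (u, i)" using x K.lt_irrefl by blast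
      then have sx: "cf s x = - cf a x" by (simp add: s_def cf_diff ce)
      show ?thesis
      proof (cases "x \<in> rep D ` leads D")
        case False
        then show ?thesis using ca(2) zero_nonunit by (simp add: sx)
      next
        case True
        then obtain b' where b': "b' \<in> leads D" "x = rep D b'" by blast
        have "lt b b' \<or> b = b' \<and> i < snd x"
          using x rep(2)[OF b'(1)] by (auto simp: lt'_def b_def b'(2))
        then have "lt b b'" using rj b' by auto
        have "c b' \<in> nonunits" by (rule coefficient_above_lead[OF f(3) b'(1) \<open>lt b b'\<close> c])
        then show ?thesis using M.uminus_mem sx ca(1)[OF b'(1)] b'(2) by simp
      qed
    qed
    with 1 show ?thesis unfolding K.lead_def by blast
  qed
  ultimately show "(U, i) \<in> K.hom_leads"
    using i U by (auto simp: K.hom_leads_def K.leads_def D_def u_def)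
qed

end

section \<open>Projective modules over polynomial rings over a valuation domain\<close>

definition vars_lt :: "nat \<Rightarrow> 't::comm_ring_1 mpoly set"
  where "vars_lt m = {p. \<forall>\<alpha>\<in>Poly_Mapping.keys p. set_mset \<alpha> \<subseteq> {..<m}}"

lemma vars_lt_zero: "0 \<in> vars_lt m"
  by (simp add: vars_lt_def)

lemma vars_lt_one: "1 \<in> vars_lt m"
  using keys_one by (auto simp: vars_lt_def split: if_splits)

lemma vars_lt_single: "set_mset \<alpha> \<subseteq> {..<m} \<Longrightarrow> Poly_Mapping.single \<alpha> c \<in> vars_lt m"
  by (simp add: vars_lt_def)

lemma vars_lt_add: "p \<in> vars_lt m \<Longrightarrow> q \<in> vars_lt m \<Longrightarrow> p + q \<in> vars_lt m"
  using Poly_Mapping.keys_add[of p q] unfolding vars_lt_def by blast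

lemma vars_lt_diff:
  assumes "p \<in> vars_lt m" "q \<in> vars_lt m"
  shows "p - q \<in> vars_lt m"
proof -
  have "\<alpha> \<in> Poly_Mapping.keys p \<or> \<alpha> \<in> Poly_Mapping.keys q" if "\<alpha> \<in> Poly_Mapping.keys (p - q)" for \<alpha>
    using that by (auto simp: in_keys_iff lookup_minus)
  then show ?thesis using assms unfolding vars_lt_def by blast
qed

lemma vars_lt_mult:
  assumes "p \<in> vars_lt m" "q \<in> vars_lt m"
  shows "p * q \<in> vars_lt m"
proof -
  have "set_mset \<alpha> \<subseteq> {..<m}" if "\<alpha> \<in> Poly_Mapping.keys (p * q)" for \<alpha>
  proof -
    from subsetD[OF keys_mult that] obtain a b
      where "\<alpha> = a + b" "a \<in> Poly_Mapping.keys p" "b \<in> Poly_Mapping.keys q" by blast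
    then show ?thesis using assms by (auto simp: vars_lt_def)
  qed
  then show ?thesis by (simp add: vars_lt_def)
qed

lemma vars_lt_sum: "(\<And>i. i \<in> S \<Longrightarrow> f i \<in> vars_lt m) \<Longrightarrow> sum f S \<in> vars_lt m"
  by (induction S rule: infinite_finite_induct) (auto simp: vars_lt_zero vars_lt_add)

lemma vecs_le_vars: "f \<in> vecs_le m n \<delta> d \<Longrightarrow> f i \<in> vars_lt m"
  unfolding vars_lt_def
proof (rule CollectI, rule ballI)
  fix \<alpha> assume f: "f \<in> vecs_le m n \<delta> d" and "\<alpha> \<in> Poly_Mapping.keys (f i)"
  then have "cf f (\<alpha>, i) \<noteq> 0" by (simp add: cf_def in_keys_iff)
  with f have "(\<alpha>, i) \<in> box m n \<delta> d" unfolding vecs_le_def by blast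
  then show "set_mset \<alpha> \<subseteq> {..<m}" by (simp add: box_def)
qed

lemma vecs_le_beyond: "f \<in> vecs_le m n \<delta> d \<Longrightarrow> i \<ge> n \<Longrightarrow> f i = 0"
proof (rule poly_mapping_eqI)
  fix \<alpha> assume "f \<in> vecs_le m n \<delta> d" "i \<ge> n"
  then show "Poly_Mapping.lookup (f i) \<alpha> = Poly_Mapping.lookup 0 \<alpha>"
    using vecs_le_box[of f m n \<delta> d "(\<alpha>, i)"] by (simp add: box_def cf_def)
qed

lemma vecs_le_exists:
  assumes "\<And>i. i < n \<Longrightarrow> f i \<in> vars_lt m" "\<And>i. i \<ge> n \<Longrightarrow> f i = 0"
  shows "\<exists>d. f \<in> vecs_le m n \<delta> d"
proof -
  define S where "S = (\<lambda>(i, \<alpha>). size \<alpha> + \<delta> i) ` (SIGMA i:{..<n}. Poly_Mapping.keys (f i))"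
  have "finite S" by (auto simp: S_def)
  then obtain d where d: "\<And>x. x \<in> S \<Longrightarrow> x \<le> d" by (meson finite_nat_set_iff_bounded_le)
  have "(\<alpha>, i) \<in> box m n \<delta> d" if "cf f (\<alpha>, i) \<noteq> 0" for \<alpha> i
  proof -
    from that have \<alpha>: "\<alpha> \<in> Poly_Mapping.keys (f i)" by (simp add: cf_def in_keys_iff)
    then have i: "i < n" using assms(2)[of i] by (cases "i < n") auto
    have "size \<alpha> + \<delta> i \<in> S" using i \<alpha> by (force simp: S_def)
    with i \<alpha> assms(1)[OF i] d show ?thesis by (auto simp: box_def vars_lt_def)
  qed
  then show ?thesis by (auto simp: vecs_le_def)
qed

lemma mv_mm: "mv k (mm l A B) v = mv l A (mv k B v)"
proof (rule ext)
  fix i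
  show "mv k (mm l A B) v i = mv l A (mv k B v) i"
    using fun_cong[OF fun_cong[OF mm_assoc[of k l A B "\<lambda>j _. v j"], of i], of 0] by (simp add: mm_def mv_def)
qed

lemma mv_mid: "i < n \<Longrightarrow> mv n mid v i = v i"
  by (simp add: mv_def mid_def if_distrib[of "\<lambda>x. x * _"] cong: if_cong)

lemma mv_diff_left: "mv n (\<lambda>i j. A i j - B i j) v i = mv n A v i - mv n B v i"
  by (simp add: mv_def left_diff_distrib sum_subtractf)

lemma mv_col: "mm n A B i j = mv n A (\<lambda>l. B l j) i"
  by (simp add: mm_def mv_def)

context filtered_module
begin

text \<open>A vector that is nonzero over V has a primitive part, and this has a lead.\<close>

lemma hom_leads_empty:
  assumes "hom_leads = {}" "f \<in> P" "f \<in> V d"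
  shows "cf f b \<in> J"
proof (rule ccontr)
  assume "cf f b \<notin> J"
  from primitive_part[OF assms(2,3) this] obtain c r where r: "c \<notin> J" "r \<in> P" "r \<in> V d"
    "\<And>b. cf f b - c * cf r b \<in> J" "\<exists>b. cf r b \<notin> nonunits" by blast
  then obtain b where "lead r b" using lead_exists by blast
  then have b: "b \<in> leads d" using r by (auto simp: leads_def)
  obtain \<alpha> i where [simp]: "b = (\<alpha>, i)" by fastforce
  have bx: "i < n" "set_mset \<alpha> \<subseteq> {..<m}" "size \<alpha> + \<delta> i \<le> d"
    using leads_box b by (auto simp: box_def)
  then have "(hom_mon m (d - size \<alpha> - \<delta> i) \<alpha>, i) \<in> hom_leads"
    using b by (simp add: hom_leads_def hom_mon_vars dehom_hom_mon size_hom_mon)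
  with assms(1) show False by simp
qed

text \<open>Take the leads that are minimal under divisibility, finitely many by Dickson's lemma,
  sorted by the exponent of \<open>s\<close>. By hypothesis removing the variables below
  \<open>s\<close> from a lead gives a lead that divides it, so a minimal one has none of
  them.\<close>

lemma generators_exist:
  assumes s: "\<And>u i. (u, i) \<in> hom_leads \<Longrightarrow> (filter_mset (\<lambda>x. s \<le> x) u, i) \<in> hom_leads"
  obtains t W k g where "generated_module J P m n \<delta> lt t W k g"
    "\<And>i j. i < j \<Longrightarrow> j < t \<Longrightarrow> count (W i) s \<le> count (W j) s"
    "\<And>j. j < t \<Longrightarrow> filter_mset (\<lambda>x. s \<le> x) (W j) = W j"
    "\<And>i j. i < t \<Longrightarrow> j < t \<Longrightarrow> W i = W j \<Longrightarrow> k i = k j \<Longrightarrow> i = j"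
proof -
  define A where "A = {(u, i). (u, i) \<in> hom_leads \<and> (\<forall>v. (v, i) \<in> hom_leads \<longrightarrow> v \<subseteq># u \<longrightarrow> v = u)}"
  have "finite A"
    by (rule finite_antichain_monomials[of _ n m]) (auto simp: A_def hom_leads_def)
  then obtain ys where ys: "set ys = A" "distinct ys" using finite_distinct_list by blast
  define xs where "xs = sort_key (\<lambda>x. count (fst x) s) ys"
  have xs: "set xs = A" "distinct xs" "sorted (map (\<lambda>x. count (fst x) s) xs)"
    using ys by (simp_all add: xs_def)
  have below: "\<exists>v. (v, i) \<in> A \<and> v \<subseteq># u" if "(u, i) \<in> hom_leads" for u i
    using that
  proof (induction "size u" arbitrary: u rule: less_induct)
    case less
    show ?case
    proof (cases "(u, i) \<in> A")
      case False
      then obtain v where v: "(v, i) \<in> hom_leads" "v \<subset># u"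
        using less.prems by (auto simp: A_def subset_mset.less_le)
      from less.hyps[OF mset_subset_size[OF v(2)] v(1)] obtain v' where "(v', i) \<in> A" "v' \<subseteq># v" by blast
      with v(2) show ?thesis by (meson subset_mset.less_imp_le subset_mset.order_trans)
    qed auto
  qed
  have "\<forall>x\<in>A. \<exists>f. f \<in> P \<and> f \<in> V (size (fst x) + \<delta> (snd x)) \<and> lead f (dehom m (fst x), snd x)"
    by (auto simp: A_def hom_leads_def leads_def)
  then obtain h where h: "\<And>x. x \<in> A \<Longrightarrow> h x \<in> P \<and> h x \<in> V (size (fst x) + \<delta> (snd x)) \<and>
      lead (h x) (dehom m (fst x), snd x)"
    by metis
  define t where "t = length xs"
  have mem: "xs ! j \<in> A" if "j < t" for j using that xs(1) nth_mem by (auto simp: t_def)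
  have memL: "(fst (xs ! j), snd (xs ! j)) \<in> hom_leads" if "j < t" for j
    using mem[OF that] by (auto simp: A_def)
  have memW: "snd (xs ! j) < n" "set_mset (fst (xs ! j)) \<subseteq> {..m}" if "j < t" for j
    using memL[OF that] by (auto simp: hom_leads_def)
  show thesis
  proof (rule that[of t "\<lambda>j. fst (xs ! j)" "\<lambda>j. snd (xs ! j)" "\<lambda>j. h (xs ! j)"])
    show "generated_module J P m n \<delta> lt t (\<lambda>j. fst (xs ! j)) (\<lambda>j. snd (xs ! j)) (\<lambda>j. h (xs ! j))"
    proof (intro generated_module.intro filtered_module_axioms generated_module_axioms.intro)
      fix u i assume "(u, i) \<in> hom_leads"
      then obtain v where v: "(v, i) \<in> A" "v \<subseteq># u" using below by blast
      then obtain j where "j < t" "xs ! j = (v, i)" using xs(1) by (metis in_set_conv_nth t_def)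
      with v show "\<exists>j<t. snd (xs ! j) = i \<and> fst (xs ! j) \<subseteq># u" by auto
    qed (use h mem memW in blast)+
    show "count (fst (xs ! i)) s \<le> count (fst (xs ! j)) s" if "i < j" "j < t" for i j
      using sorted_nth_mono[OF xs(3), of i j] that by (simp add: t_def)
    show "filter_mset (\<lambda>x. s \<le> x) (fst (xs ! j)) = fst (xs ! j)" if "j < t" for j
      using mem[OF that] s[OF memL[OF that]] by (auto simp: A_def)
    show "i = j" if "i < t" "j < t" "fst (xs ! i) = fst (xs ! j)" "snd (xs ! i) = snd (xs ! j)" for i j
    proof -
      have "xs ! i = xs ! j" using that(3,4) by (rule prod_eqI)
      then show ?thesis using nth_eq_iff_index_eq[OF xs(2)] that(1,2) by (simp add: t_def)
    qed
  qed
qed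

end

context generated_module
begin

text \<open>If \<open>W j\<close> divides U W_i with j < i, then \<open>W j\<close> has no variable
  below \<open>s\<close>, and its exponent of \<open>s\<close> is at most that of \<open>W i\<close>
  by the sorting. So the part of \<open>U\<close> in the variables beyond \<open>s\<close> already
  suffices.\<close>

lemma hom_leads_kernel_vars:
  assumes sorted: "\<And>i j. i < j \<Longrightarrow> j < t \<Longrightarrow> count (W i) s \<le> count (W j) s"
    and free: "\<And>j. j < t \<Longrightarrow> filter_mset (\<lambda>x. s \<le> x) (W j) = W j"
    and U: "(U, i) \<in> K.hom_leads"
  shows "(filter_mset (\<lambda>x. Suc s \<le> x) U, i) \<in> K.hom_leads"
proof -
  from U obtain j where i: "i < t" "set_mset U \<subseteq> {..m}" and j: "j < i" "k j = k i" "W j \<subseteq># U + W i"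
    by (auto simp: hom_leads_kernel)
  have "count (W j) x \<le> count (filter_mset (\<lambda>x. Suc s \<le> x) U + W i) x" for x
  proof -
    consider "x < s" | "x = s" | "x > s" by linarith
    then show ?thesis
    proof cases
      case 1
      then have "count (filter_mset (\<lambda>x. s \<le> x) (W j)) x = 0" by simp
      then show ?thesis using free[of j] i(1) j(1) by simp
    next
      case 2
      then show ?thesis using sorted[OF j(1) i(1)] by simp
    next
      case 3
      then show ?thesis using mset_subset_eq_count[OF j(3), of x] by simp
    qed
  qed
  then have "W j \<subseteq># filter_mset (\<lambda>x. Suc s \<le> x) U + W i" by (rule mset_subset_eqI)
  with i j show ?thesis by (auto simp: hom_leads_kernel)
qed

text \<open>With no variables left, every \<open>W j\<close> is 1, so different generators have
  leads in different components and cannot produce a syzygy.\<close>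

lemma hom_leads_kernel_empty:
  assumes free: "\<And>j. j < t \<Longrightarrow> filter_mset (\<lambda>x. Suc m \<le> x) (W j) = W j"
    and dist: "\<And>i j. i < t \<Longrightarrow> j < t \<Longrightarrow> W i = W j \<Longrightarrow> k i = k j \<Longrightarrow> i = j"
  shows "K.hom_leads = {}"
proof (rule equals0I, clarify)
  fix U i assume "(U, i) \<in> K.hom_leads"
  then obtain j where j: "i < t" "j < i" "k j = k i" by (auto simp: hom_leads_kernel)
  have "W l = {#}" if "l < t" for l
  proof -
    have "x \<notin># filter_mset (\<lambda>x. Suc m \<le> x) (W l)" for x using W(2)[OF that] by auto
    then show ?thesis unfolding free[OF that] by (simp add: multiset_eqI not_in_iff)
  qed
  with dist[of j i] j show False by simp
qed

end

section \<open>Resolution of the image of an idempotent by descent on the variables\<close>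

context chain_prime
begin

definition fixed_vecs :: "nat \<Rightarrow> (nat \<Rightarrow> nat \<Rightarrow> 't mpoly) \<Rightarrow> (nat \<Rightarrow> 't mpoly) set"
  where "fixed_vecs n e = {f. \<forall>i<n. mv n e f i - f i \<in> coeffs_in J}"

lemma saturated_fixed_vecs: "saturated_module J (fixed_vecs n e)"
proof -
  \<comment> \<open>The kernel of e - 1; rows from \<open>n\<close> on are zero because
    \<open>fixed_vecs\<close> leaves those components free.\<close>
  have eq: "fixed_vecs n e = kernel n (\<lambda>i j. if i < n then e i j - mid i j else 0)"
  proof -
    have "mv n (\<lambda>i j. if i < n then e i j - mid i j else 0) f i = (if i < n then mv n e f i - f i else 0)" for f i
      using mv_diff_left[of n e mid f i] mv_mid[of i n f] by (auto simp: mv_def)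
    then show ?thesis by (auto simp: fixed_vecs_def kernel_def JJ.zero_mem)
  qed
  show ?thesis unfolding eq by (rule saturated_kernel)
qed

text \<open>Induction on the number of variables from \<open>s\<close> to \<open>m\<close>, the only
  ones needed to generate the homogenized leads. The kernel of the map onto the image of
  \<open>e\<close> is again the image of an idempotent with entries in the first \<open>m\<close>
  variables. Rank, shifts and order are arbitrary because they change with each kernel.\<close>

lemma finite_free_res_of_hom_leads:
  assumes "mon_order n lt" "\<And>i j. i < n \<Longrightarrow> j < n \<Longrightarrow> e i j \<in> vars_lt m" "JJ.meq n n (mm n e e) e"
    and "\<And>u i. (u, i) \<in> filtered_module.hom_leads J (fixed_vecs n e) m n \<delta> lt \<Longrightarrow>
      (filter_mset (\<lambda>x. s \<le> x) u, i) \<in> filtered_module.hom_leads J (fixed_vecs n e) m n \<delta> lt"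
    and "s \<le> Suc m"
  shows "JJ.finite_free_res n e"
  using assms
proof (induction "Suc m - s" arbitrary: n e \<delta> lt s rule: less_induct)
  case less
  interpret F: filtered_module J "fixed_vecs n e" m n \<delta> lt
    by (intro filtered_module.intro saturated_fixed_vecs filtered_module_axioms.intro less.prems(1))
  obtain t W k g where gen: "generated_module J (fixed_vecs n e) m n \<delta> lt t W k g"
    and sorted: "\<And>i j. i < j \<Longrightarrow> j < t \<Longrightarrow> count (W i) s \<le> count (W j) s"
    and free: "\<And>j. j < t \<Longrightarrow> filter_mset (\<lambda>x. s \<le> x) (W j) = W j"
    and dist: "\<And>i j. i < t \<Longrightarrow> j < t \<Longrightarrow> W i = W j \<Longrightarrow> k i = k j \<Longrightarrow> i = j"
    using F.generators_exist[OF less.prems(4)] by blast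
  interpret H: generated_module J "fixed_vecs n e" m n \<delta> lt t W k g by fact
  \<comment> \<open>\<open>kernel\<close> tests all components while \<open>fixed_vecs\<close> tests
    only the first \<open>n\<close>; this bridges the gap.\<close>
  have G0: "H.G i j = 0" if "i \<ge> n" "j < t" for i j
    using vecs_le_beyond[OF H.g(2)[OF that(2)] that(1)] by (simp add: H.G_def)
  have GV: "H.G i j \<in> vars_lt m" if "j < t" for i j
    using vecs_le_vars[OF H.g(2)[OF that]] by (simp add: H.G_def)
  have eG: "JJ.meq n t (mm n e H.G) H.G"
    using H.g(1) unfolding JJ.meq_def JJ.eqv_def mv_col by (auto simp: fixed_vecs_def H.G_def)
  \<comment> \<open>The columns of \<open>e\<close> belong to its image, so they lift through the
    generators; the lifts form the section \<open>\<sigma>\<close>.\<close>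
  have "\<exists>a. (\<forall>i. a i \<in> vars_lt m) \<and> (\<forall>i<n. JJ.eqv (mv t H.G a i) (e i j))" if j: "j < n" for j
  proof -
    define f where "f i = (if i < n then e i j else 0)" for i
    have "mv n e f i - f i \<in> coeffs_in J" if "i < n" for i
    proof -
      have "mv n e f i = mm n e e i j" by (simp add: mv_def mm_def f_def)
      then show ?thesis using less.prems(3) that j by (simp add: f_def JJ.meq_def JJ.eqv_def)
    qed
    then have fP: "f \<in> fixed_vecs n e" by (simp add: fixed_vecs_def)
    obtain d where fV: "f \<in> vecs_le m n \<delta> d"
      using vecs_le_exists[of n f m \<delta>] less.prems(2) j by (auto simp: f_def)
    from H.lift_through_generators[OF fP fV] obtain c a
      where c: "\<And>b'. cf f b' - (\<Sum>b\<in>F.leads d. c b * cf (H.basis_vec d b) b') \<in> J"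
        and a: "a \<in> vecs_le m t H.\<delta>' d"
        and ca: "\<And>b. cf (mv t H.G a) b = (\<Sum>b'\<in>F.leads d. c b' * cf (H.basis_vec d b') b)"
        and "\<And>b. b \<in> F.leads d \<Longrightarrow> cf a (H.rep d b) = c b" "\<And>x. x \<notin> H.rep d ` F.leads d \<Longrightarrow> cf a x = 0"
      by blast
    have "cf f (\<alpha>, i) - cf (mv t H.G a) (\<alpha>, i) \<in> J" for \<alpha> i using c by (simp add: ca)
    then have fa: "JJ.eqv (f i) (mv t H.G a i)" for i
      unfolding JJ.eqv_def by (simp add: coeffs_in_def cf_def lookup_minus)
    have "JJ.eqv (mv t H.G a i) (e i j)" if "i < n" for i
    proof -
      have "f i = e i j" using that by (simp add: f_def)
      with JJ.eqv_sym[OF fa[of i]] show ?thesis by simp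
    qed
    with vecs_le_vars[OF a] show ?thesis by blast
  qed
  then have "\<forall>j\<in>{..<n}. \<exists>a. (\<forall>i. a i \<in> vars_lt m) \<and> (\<forall>i<n. JJ.eqv (mv t H.G a i) (e i j))"
    by blast
  from bchoice[OF this] obtain a where
    "\<forall>j\<in>{..<n}. (\<forall>i. a j i \<in> vars_lt m) \<and> (\<forall>i<n. JJ.eqv (mv t H.G (a j) i) (e i j))" ..
  then have aV: "\<And>i j. j < n \<Longrightarrow> a j i \<in> vars_lt m"
    and a: "\<And>i j. i < n \<Longrightarrow> j < n \<Longrightarrow> JJ.eqv (mv t H.G (a j) i) (e i j)"
    by blast+
  define \<sigma> where "\<sigma> i j = a j i" for i j
  have 1: "JJ.meq n n (mm t H.G \<sigma>) e"
    unfolding JJ.meq_def mv_col \<sigma>_def using a by simp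
  define e' where "e' = (\<lambda>i j. mid i j - mm n \<sigma> H.G i j)"
  have e'V: "e' i j \<in> vars_lt m" if "i < t" "j < t" for i j
  proof -
    have "mm n \<sigma> H.G i j \<in> vars_lt m"
      unfolding mm_def \<sigma>_def using that by (auto intro!: vars_lt_sum vars_lt_mult aV GV)
    moreover have "(mid i j :: 't mpoly) \<in> vars_lt m" by (simp add: mid_def vars_lt_one vars_lt_zero)
    ultimately show ?thesis unfolding e'_def by (intro vars_lt_diff)
  qed
  have idem: "JJ.meq t t (mm t e' e') e'"
    unfolding e'_def by (rule JJ.kernel_idempotent[OF 1 eG])
  \<comment> \<open>Vectors fixed by \<open>e'\<close> are those killed by \<sigma> G, and these are
    killed by G since G = e G = G \<sigma> G.\<close>
  have ker: "kernel t H.G = fixed_vecs t e'"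
  proof (rule Set.set_eqI)
    fix f
    have e'f: "mv t e' f i - f i = - mv n \<sigma> (mv t H.G f) i" if "i < t" for i
      unfolding e'_def mv_diff_left using that by (simp add: mv_mid mv_mm)
    show "f \<in> kernel t H.G \<longleftrightarrow> f \<in> fixed_vecs t e'"
    proof
      assume "f \<in> kernel t H.G"
      then show "f \<in> fixed_vecs t e'"
        unfolding fixed_vecs_def kernel_def
        by (auto simp: e'f mv_def[of n \<sigma>] intro!: JJ.uminus_mem JJ.sum_mem JJ.mult_mem)
    next
      assume f: "f \<in> fixed_vecs t e'"
      have \<sigma>f: "mv n \<sigma> (mv t H.G f) i \<in> coeffs_in J" if "i < t" for i
      proof -
        have "- mv n \<sigma> (mv t H.G f) i \<in> coeffs_in J" using f that e'f by (simp add: fixed_vecs_def)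
        from JJ.uminus_mem[OF this] show ?thesis by simp
      qed
      have "mv t H.G f i \<in> coeffs_in J" for i
      proof (cases "i < n")
        case False
        then have "mv t H.G f i = 0" using G0 by (simp add: mv_def)
        then show ?thesis by (simp add: JJ.zero_mem)
      next
        case True
        have "JJ.eqv (mv t H.G f i) (mv t (mm n e H.G) f i)"
          unfolding mv_def using True eG[THEN JJ.meq_sym]
          by (auto simp: JJ.meq_def intro!: JJ.eqv_sum JJ.eqv_mult)
        also have "mv t (mm n e H.G) f = mv n e (mv t H.G f)" by (rule mv_mm)
        also have "JJ.eqv (mv n e (mv t H.G f) i) (mv n (mm t H.G \<sigma>) (mv t H.G f) i)"
          unfolding mv_def[of n] using True 1[THEN JJ.meq_sym]
          by (auto simp: JJ.meq_def intro!: JJ.eqv_sum JJ.eqv_mult)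
        also have "mv n (mm t H.G \<sigma>) (mv t H.G f) = mv t H.G (mv n \<sigma> (mv t H.G f))" by (rule mv_mm)
        also have "JJ.eqv (mv t H.G (mv n \<sigma> (mv t H.G f)) i) 0"
          unfolding JJ.eqv_zero_iff mv_def[of t H.G "mv n \<sigma> (mv t H.G f)"]
          by (intro JJ.sum_mem JJ.mult_mem \<sigma>f) simp
        finally show ?thesis by (simp add: JJ.eqv_zero_iff)
      qed
      then show "f \<in> kernel t H.G" by (simp add: kernel_def)
    qed
  qed
  have "JJ.finite_free_res t e'"
  proof (cases "s = Suc m")
    case True
    \<comment> \<open>All \<open>m + 1\<close> variables are used up: the kernel is zero over V, and
      so are the columns of \<open>e'\<close>, which lie in it.\<close>
    have empty: "H.K.hom_leads = {}"
      by (rule H.hom_leads_kernel_empty) (use free True in simp, fact dist)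
    have "e' i j \<in> coeffs_in J" if ij: "i < t" "j < t" for i j
    proof -
      define f where "f l = (if l < t then e' l j else 0)" for l
      have "mv t e' f l - f l \<in> coeffs_in J" if "l < t" for l
      proof -
        have "mv t e' f l = mm t e' e' l j" by (simp add: mv_def mm_def f_def)
        then show ?thesis using idem that ij by (simp add: f_def JJ.meq_def JJ.eqv_def)
      qed
      then have fP: "f \<in> kernel t H.G" by (simp add: ker fixed_vecs_def)
      obtain d where fV: "f \<in> vecs_le m t H.\<delta>' d"
        using vecs_le_exists[of t f m H.\<delta>'] e'V ij by (auto simp: f_def)
      from H.K.hom_leads_empty[OF empty fP fV] have "cf f (\<alpha>, i) \<in> J" for \<alpha> .
      then show ?thesis using ij by (simp add: cf_def f_def coeffs_in_def)
    qed
    then show ?thesis by (intro JJ.finite_free_res.zero) (simp add: JJ.meq_def JJ.eqv_def)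
  next
    case False
    have "JJ.finite_free_res t e'"
    proof (rule less.hyps[of "Suc s" t H.lt' e' H.\<delta>'])
      show "Suc m - Suc s < Suc m - s" "Suc s \<le> Suc m" using False less.prems(5) by auto
      show "(filter_mset (\<lambda>x. Suc s \<le> x) u, i) \<in> filtered_module.hom_leads J (fixed_vecs t e') m t H.\<delta>' H.lt'"
        if "(u, i) \<in> filtered_module.hom_leads J (fixed_vecs t e') m t H.\<delta>' H.lt'" for u i
      proof -
        have U: "(u, i) \<in> H.K.hom_leads" using that unfolding ker .
        have "(filter_mset (\<lambda>x. Suc s \<le> x) u, i) \<in> H.K.hom_leads"
          by (rule H.hom_leads_kernel_vars[OF _ _ U]) (fact sorted, fact free)
        then show ?thesis unfolding ker .
      qed
      show "mon_order t H.lt'" by (rule H.mon_order_lt')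
      show "JJ.meq t t (mm t e' e') e'" by (rule idem)
      show "e' i j \<in> vars_lt m" if "i < t" "j < t" for i j using that by (rule e'V)
    qed
    then show ?thesis .
  qed
  then show ?case unfolding e'_def by (rule JJ.finite_free_res.step[OF 1 eG])
qed

theorem finite_free_res_polynomials:
  assumes "\<And>i j. i < n \<Longrightarrow> j < n \<Longrightarrow> e i j \<in> vars_lt m" "JJ.meq n n (mm n e e) e"
  shows "JJ.finite_free_res n e"
proof -
  \<comment> \<open>Any monomial order would serve: the multiset order on exponents, ties broken by
    index. For \<open>s = 0\<close> the filter condition holds trivially.\<close>
  define lt :: "nat multiset \<times> nat \<Rightarrow> nat multiset \<times> nat \<Rightarrow> bool"
    where "lt a b \<longleftrightarrow> fst a < fst b \<or> fst a = fst b \<and> snd a < snd b" for a b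
  have ord: "mon_order n lt"
    unfolding mon_order_def lt_def by (auto simp: prod_eq_iff)
  show ?thesis
    by (rule finite_free_res_of_hom_leads[OF ord assms, where s = 0 and \<delta> = "\<lambda>_. 0"]) simp_all
qed

end

section \<open>Projective modules as images of idempotent matrices\<close>

lemma (in abelian_monoid) finsum_swap:
  assumes "finite A" "finite B" "\<And>i j. i \<in> A \<Longrightarrow> j \<in> B \<Longrightarrow> f i j \<in> carrier G"
  shows "finsum G (\<lambda>i. finsum G (f i) B) A = finsum G (\<lambda>j. finsum G (\<lambda>i. f i j) A) B"
  using assms
proof (induction A rule: finite_induct)
  case empty
  then show ?case by simp
next
  case (insert x A)
  have "finsum G (\<lambda>i. finsum G (f i) B) (insert x A)
      = finsum G (f x) B \<oplus> finsum G (\<lambda>i. finsum G (f i) B) A"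
    by (rule finsum_insert) (use insert in auto)
  also have "\<dots> = finsum G (f x) B \<oplus> finsum G (\<lambda>j. finsum G (\<lambda>i. f i j) A) B"
    using insert by simp
  also have "\<dots> = finsum G (\<lambda>j. f x j \<oplus> finsum G (\<lambda>i. f i j) A) B"
    by (rule finsum_addf[symmetric]) (use insert in auto)
  also have "\<dots> = finsum G (\<lambda>j. finsum G (\<lambda>i. f i j) (insert x A)) B"
    by (rule finsum_cong') (use insert in auto)
  finally show ?case .
qed

text \<open>Padding by zero makes equality of vectors plain equality of functions and places R^n in
  the type from which all modules are drawn.\<close>

definition vecs :: "('a, 'r) ring_scheme \<Rightarrow> nat \<Rightarrow> (nat \<Rightarrow> 'a) set"
  where "vecs R n = {v. (\<forall>i<n. v i \<in> carrier R) \<and> (\<forall>i\<ge>n. v i = \<zero>\<^bsub>R\<^esub>)}"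

definition is_mat :: "('a, 'r) ring_scheme \<Rightarrow> nat \<Rightarrow> nat \<Rightarrow> (nat \<Rightarrow> nat \<Rightarrow> 'a) \<Rightarrow> bool"
  where "is_mat R n k e \<longleftrightarrow> (\<forall>i<n. \<forall>j<k. e i j \<in> carrier R)"

definition matvec :: "('a, 'r) ring_scheme \<Rightarrow> nat \<Rightarrow> nat \<Rightarrow> (nat \<Rightarrow> nat \<Rightarrow> 'a) \<Rightarrow> (nat \<Rightarrow> 'a) \<Rightarrow> nat \<Rightarrow> 'a"
  where "matvec R n k e v =
    (\<lambda>i. if i < n then finsum R (\<lambda>j. e i j \<otimes>\<^bsub>R\<^esub> v j) {..<k} else \<zero>\<^bsub>R\<^esub>)"

definition matmul :: "('a, 'r) ring_scheme \<Rightarrow> nat \<Rightarrow> (nat \<Rightarrow> nat \<Rightarrow> 'a) \<Rightarrow> (nat \<Rightarrow> nat \<Rightarrow> 'a) \<Rightarrow> nat \<Rightarrow> nat \<Rightarrow> 'a"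
  where "matmul R k p s = (\<lambda>i j. finsum R (\<lambda>l. p i l \<otimes>\<^bsub>R\<^esub> s l j) {..<k})"

definition idmat :: "('a, 'r) ring_scheme \<Rightarrow> nat \<Rightarrow> nat \<Rightarrow> 'a"
  where "idmat R i j = (if i = j then \<one>\<^bsub>R\<^esub> else \<zero>\<^bsub>R\<^esub>)"

definition idem_mat :: "('a, 'r) ring_scheme \<Rightarrow> nat \<Rightarrow> (nat \<Rightarrow> nat \<Rightarrow> 'a) \<Rightarrow> bool"
  where "idem_mat R n e \<longleftrightarrow> is_mat R n n e \<and> (\<forall>i<n. \<forall>j<n. matmul R n e e i j = e i j)"

text \<open>For an idempotent matrix this is its image. The fields
  \<^const>\<open>monoid.mult\<close> and \<^const>\<open>monoid.one\<close> of a module record are irrelevant.\<close>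

definition fixmod :: "('a, 'r) ring_scheme \<Rightarrow> nat \<Rightarrow> (nat \<Rightarrow> nat \<Rightarrow> 'a) \<Rightarrow> ('a, nat \<Rightarrow> 'a) module"
  where "fixmod R n e =
    \<lparr>carrier = {v \<in> vecs R n. matvec R n n e v = v}, monoid.mult = (\<lambda>u v. u), one = (\<lambda>_. \<zero>\<^bsub>R\<^esub>),
     ring.zero = (\<lambda>_. \<zero>\<^bsub>R\<^esub>), ring.add = (\<lambda>u v i. u i \<oplus>\<^bsub>R\<^esub> v i),
     module.smult = (\<lambda>a v i. a \<otimes>\<^bsub>R\<^esub> v i)\<rparr>"

definition column :: "('a, 'r) ring_scheme \<Rightarrow> nat \<Rightarrow> (nat \<Rightarrow> nat \<Rightarrow> 'a) \<Rightarrow> nat \<Rightarrow> nat \<Rightarrow> 'a"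
  where "column R n e j = (\<lambda>i. if i < n then e i j else \<zero>\<^bsub>R\<^esub>)"

lemma fixmod_simps:
  "carrier (fixmod R n e) = {v \<in> vecs R n. matvec R n n e v = v}"
  "\<zero>\<^bsub>fixmod R n e\<^esub> = (\<lambda>_. \<zero>\<^bsub>R\<^esub>)"
  "u \<oplus>\<^bsub>fixmod R n e\<^esub> v = (\<lambda>i. u i \<oplus>\<^bsub>R\<^esub> v i)"
  "a \<odot>\<^bsub>fixmod R n e\<^esub> v = (\<lambda>i. a \<otimes>\<^bsub>R\<^esub> v i)"
  by (simp_all add: fixmod_def)

lemma semilinear_maps_comp:
  assumes "f \<in> semilinear_maps R \<phi> M N" "g \<in> semilinear_maps S \<psi> N P" "\<phi> \<in> carrier R \<rightarrow> carrier S"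
  shows "(\<lambda>x. g (f x)) \<in> semilinear_maps R (\<lambda>a. \<psi> (\<phi> a)) M P"
  using assms unfolding semilinear_maps_def by (auto simp: Pi_iff)

lemma linear_maps_comp:
  assumes "f \<in> semilinear_maps R \<phi> M N" "g \<in> linear_maps S N P" "\<phi> \<in> carrier R \<rightarrow> carrier S"
  shows "(\<lambda>x. g (f x)) \<in> semilinear_maps R \<phi> M P"
  using semilinear_maps_comp[OF assms] by simp

lemma linear_maps_precomp:
  assumes "f \<in> linear_maps R M N" "g \<in> semilinear_maps R \<phi> N P"
  shows "(\<lambda>x. g (f x)) \<in> semilinear_maps R \<phi> M P"
  using semilinear_maps_comp[OF assms] by simp

lemma semilinear_closed: "f \<in> semilinear_maps R \<phi> M N \<Longrightarrow> x \<in> carrier M \<Longrightarrow> f x \<in> carrier N"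
  and semilinear_add: "f \<in> semilinear_maps R \<phi> M N \<Longrightarrow> x \<in> carrier M \<Longrightarrow> y \<in> carrier M \<Longrightarrow>
    f (x \<oplus>\<^bsub>M\<^esub> y) = f x \<oplus>\<^bsub>N\<^esub> f y"
  and semilinear_smult: "f \<in> semilinear_maps R \<phi> M N \<Longrightarrow> a \<in> carrier R \<Longrightarrow> x \<in> carrier M \<Longrightarrow>
    f (a \<odot>\<^bsub>M\<^esub> x) = \<phi> a \<odot>\<^bsub>N\<^esub> f x"
  unfolding semilinear_maps_def by auto

lemma semilinear_zero:
  assumes "module R M" "module S N" "f \<in> semilinear_maps R \<phi> M N"
  shows "f \<zero>\<^bsub>M\<^esub> = \<zero>\<^bsub>N\<^esub>"
proof -
  interpret M: module R M by fact
  interpret N: module S N by fact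
  have 1: "f \<zero>\<^bsub>M\<^esub> \<in> carrier N" by (rule semilinear_closed[OF assms(3)]) simp
  have "f \<zero>\<^bsub>M\<^esub> \<oplus>\<^bsub>N\<^esub> f \<zero>\<^bsub>M\<^esub> = f \<zero>\<^bsub>M\<^esub>"
    using semilinear_add[OF assms(3), of "\<zero>\<^bsub>M\<^esub>" "\<zero>\<^bsub>M\<^esub>"] by simp
  then show ?thesis using 1 by (metis N.M.add.r_cancel_one)
qed

lemma semilinear_finsum:
  assumes "module R M" "module S N" "f \<in> semilinear_maps R \<phi> M N" "finite A" "\<And>x. x \<in> A \<Longrightarrow> g x \<in> carrier M"
  shows "f (finsum M g A) = finsum N (\<lambda>x. f (g x)) A"
proof -
  interpret M: module R M by fact
  interpret N: module S N by fact
  show ?thesis using assms(4,5)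
  proof (induction A rule: finite_induct)
    case empty
    then show ?case using semilinear_zero[OF assms(1-3)] by simp
  next
    case (insert x A)
    then show ?case
      using semilinear_add[OF assms(3), of "g x" "finsum M g A"] semilinear_closed[OF assms(3)]
      by (simp add: Pi_iff)
  qed
qed

lemma (in module) lincomb_closed:
  "(\<And>j. j < n \<Longrightarrow> v j \<in> carrier R) \<Longrightarrow> (\<And>j. j < n \<Longrightarrow> y j \<in> carrier M) \<Longrightarrow>
    finsum M (\<lambda>j. v j \<odot>\<^bsub>M\<^esub> y j) {..<n} \<in> carrier M"
  by (intro M.finsum_closed) auto

lemma lincomb_linear:
  assumes "module R N" "\<And>j. j < n \<Longrightarrow> y j \<in> carrier N"
  shows "(\<lambda>v. finsum N (\<lambda>j. v j \<odot>\<^bsub>N\<^esub> y j) {..<n}) \<in> linear_maps R (fixmod R n e) N"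
proof -
  interpret N: module R N by fact
  have v: "v j \<in> carrier R" if "v \<in> carrier (fixmod R n e)" "j < n" for v j
    using that by (simp add: fixmod_simps vecs_def)
  show ?thesis unfolding semilinear_maps_def
  proof (intro CollectI conjI ballI Pi_I)
    fix u assume "u \<in> carrier (fixmod R n e)"
    then show "finsum N (\<lambda>j. u j \<odot>\<^bsub>N\<^esub> y j) {..<n} \<in> carrier N"
      using v assms(2) by (intro N.lincomb_closed) auto
  next
    fix u w assume uw: "u \<in> carrier (fixmod R n e)" "w \<in> carrier (fixmod R n e)"
    have "finsum N (\<lambda>j. (u \<oplus>\<^bsub>fixmod R n e\<^esub> w) j \<odot>\<^bsub>N\<^esub> y j) {..<n}
        = finsum N (\<lambda>j. u j \<odot>\<^bsub>N\<^esub> y j \<oplus>\<^bsub>N\<^esub> w j \<odot>\<^bsub>N\<^esub> y j) {..<n}"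
      using v[OF uw(1)] v[OF uw(2)] assms(2)
      by (intro N.M.finsum_cong') (auto simp: fixmod_simps N.smult_l_distr)
    also have "\<dots> = finsum N (\<lambda>j. u j \<odot>\<^bsub>N\<^esub> y j) {..<n} \<oplus>\<^bsub>N\<^esub> finsum N (\<lambda>j. w j \<odot>\<^bsub>N\<^esub> y j) {..<n}"
      using v[OF uw(1)] v[OF uw(2)] assms(2) by (intro N.M.finsum_addf) auto
    finally show "finsum N (\<lambda>j. (u \<oplus>\<^bsub>fixmod R n e\<^esub> w) j \<odot>\<^bsub>N\<^esub> y j) {..<n} = \<dots>" .
  next
    fix a u assume au: "a \<in> carrier R" "u \<in> carrier (fixmod R n e)"
    have "id a \<odot>\<^bsub>N\<^esub> finsum N (\<lambda>j. u j \<odot>\<^bsub>N\<^esub> y j) {..<n} = finsum N (\<lambda>j. a \<odot>\<^bsub>N\<^esub> (u j \<odot>\<^bsub>N\<^esub> y j)) {..<n}"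
      using v[OF au(2)] assms(2) au(1) by (subst N.finsum_smult_ldistr) auto
    also have "\<dots> = finsum N (\<lambda>j. (a \<odot>\<^bsub>fixmod R n e\<^esub> u) j \<odot>\<^bsub>N\<^esub> y j) {..<n}"
      using v[OF au(2)] assms(2) au(1)
      by (intro N.M.finsum_cong') (auto simp: fixmod_simps N.smult_assoc1)
    finally show "finsum N (\<lambda>j. (a \<odot>\<^bsub>fixmod R n e\<^esub> u) j \<odot>\<^bsub>N\<^esub> y j) {..<n}
        = id a \<odot>\<^bsub>N\<^esub> finsum N (\<lambda>j. u j \<odot>\<^bsub>N\<^esub> y j) {..<n}" ..
  qed
qed

section \<open>Matrix calculus in a carrier-based ring\<close>

context cring
begin

lemma vecs_closed: "v \<in> vecs R n \<Longrightarrow> v i \<in> carrier R"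
  by (cases "i < n") (auto simp: vecs_def)

lemma matvec_closed: "is_mat R n k e \<Longrightarrow> v \<in> vecs R k \<Longrightarrow> matvec R n k e v \<in> vecs R n"
  using vecs_closed[of v k] by (auto simp: vecs_def matvec_def is_mat_def intro!: finsum_closed)

lemma matmul_closed: "is_mat R n l p \<Longrightarrow> is_mat R l k s \<Longrightarrow> is_mat R n k (matmul R l p s)"
  by (auto simp: matmul_def is_mat_def intro!: finsum_closed)

lemma is_mat_idmat: "is_mat R n k (idmat R)"
  by (simp add: is_mat_def idmat_def)

lemma matvec_idmat: "v \<in> vecs R n \<Longrightarrow> matvec R n n (idmat R) v = v"
proof (rule ext)
  fix i assume v: "v \<in> vecs R n"
  show "matvec R n n (idmat R) v i = v i"
  proof (cases "i < n")
    case True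
    have "finsum R (\<lambda>j. idmat R i j \<otimes> v j) {..<n} = finsum R (\<lambda>j. if i = j then v j else \<zero>) {..<n}"
      using vecs_closed[OF v] by (intro finsum_cong') (auto simp: idmat_def)
    also have "\<dots> = v i"
      using finsum_singleton[of i "{..<n}" v] True vecs_closed[OF v] by auto
    finally show ?thesis using True by (simp add: matvec_def)
  qed (use v in \<open>simp add: matvec_def vecs_def\<close>)
qed

lemma matvec_add:
  assumes "is_mat R n k e" "u \<in> vecs R k" "v \<in> vecs R k"
  shows "matvec R n k e (\<lambda>i. u i \<oplus> v i) = (\<lambda>i. matvec R n k e u i \<oplus> matvec R n k e v i)"
proof (rule ext)
  fix i
  show "matvec R n k e (\<lambda>i. u i \<oplus> v i) i = matvec R n k e u i \<oplus> matvec R n k e v i"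
  proof (cases "i < n")
    case True
    note c = vecs_closed[OF assms(2)] vecs_closed[OF assms(3)]
    have e: "e i j \<in> carrier R" if "j < k" for j using assms(1) True that by (simp add: is_mat_def)
    have "finsum R (\<lambda>j. e i j \<otimes> (u j \<oplus> v j)) {..<k} = finsum R (\<lambda>j. e i j \<otimes> u j \<oplus> e i j \<otimes> v j) {..<k}"
      using c e by (intro finsum_cong') (auto simp: r_distr)
    also have "\<dots> = finsum R (\<lambda>j. e i j \<otimes> u j) {..<k} \<oplus> finsum R (\<lambda>j. e i j \<otimes> v j) {..<k}"
      using c e by (intro finsum_addf) auto
    finally show ?thesis using True by (simp add: matvec_def)
  qed (simp add: matvec_def)
qed

lemma matvec_smult:
  assumes "is_mat R n k e" "v \<in> vecs R k" "a \<in> carrier R"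
  shows "matvec R n k e (\<lambda>i. a \<otimes> v i) = (\<lambda>i. a \<otimes> matvec R n k e v i)"
proof (rule ext)
  fix i
  show "matvec R n k e (\<lambda>i. a \<otimes> v i) i = a \<otimes> matvec R n k e v i"
  proof (cases "i < n")
    case True
    note c = vecs_closed[OF assms(2)]
    have e: "e i j \<in> carrier R" if "j < k" for j using assms(1) True that by (simp add: is_mat_def)
    have "a \<otimes> finsum R (\<lambda>j. e i j \<otimes> v j) {..<k} = finsum R (\<lambda>j. a \<otimes> (e i j \<otimes> v j)) {..<k}"
      using c e assms(3) by (intro finsum_rdistr) auto
    also have "\<dots> = finsum R (\<lambda>j. e i j \<otimes> (a \<otimes> v j)) {..<k}"
      using c e assms(3) by (intro finsum_cong') (auto simp: m_ac)
    finally show ?thesis using True by (simp add: matvec_def)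
  qed (use assms(3) in \<open>simp add: matvec_def\<close>)
qed

lemma matvec_matmul:
  assumes p: "is_mat R n l p" and s: "is_mat R l k s" and v: "v \<in> vecs R k"
  shows "matvec R n k (matmul R l p s) v = matvec R n l p (matvec R l k s v)"
proof (rule ext)
  fix i
  show "matvec R n k (matmul R l p s) v i = matvec R n l p (matvec R l k s v) i"
  proof (cases "i < n")
    case True
    note c = vecs_closed[OF v]
    have pc: "p i x \<in> carrier R" if "x < l" for x using p True that by (simp add: is_mat_def)
    have sc: "s x j \<in> carrier R" if "x < l" "j < k" for x j using s that by (simp add: is_mat_def)
    have "finsum R (\<lambda>j. matmul R l p s i j \<otimes> v j) {..<k}
        = finsum R (\<lambda>j. finsum R (\<lambda>x. p i x \<otimes> (s x j \<otimes> v j)) {..<l}) {..<k}"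
    proof (rule finsum_cong')
      fix j assume j: "j \<in> {..<k}"
      have "matmul R l p s i j \<otimes> v j = finsum R (\<lambda>x. p i x \<otimes> s x j \<otimes> v j) {..<l}"
        unfolding matmul_def using c pc sc j by (intro finsum_ldistr) auto
      also have "\<dots> = finsum R (\<lambda>x. p i x \<otimes> (s x j \<otimes> v j)) {..<l}"
        using c pc sc j by (intro finsum_cong') (auto simp: m_assoc)
      finally show "matmul R l p s i j \<otimes> v j = \<dots>" .
    qed (use c pc sc in \<open>auto intro!: finsum_closed\<close>)
    also have "\<dots> = finsum R (\<lambda>x. finsum R (\<lambda>j. p i x \<otimes> (s x j \<otimes> v j)) {..<k}) {..<l}"
      using c pc sc by (intro finsum_swap) auto
    also have "\<dots> = finsum R (\<lambda>x. p i x \<otimes> matvec R l k s v x) {..<l}"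
    proof (rule finsum_cong')
      fix x assume x: "x \<in> {..<l}"
      have "p i x \<otimes> finsum R (\<lambda>j. s x j \<otimes> v j) {..<k} = finsum R (\<lambda>j. p i x \<otimes> (s x j \<otimes> v j)) {..<k}"
        using c pc sc x by (intro finsum_rdistr) auto
      then show "finsum R (\<lambda>j. p i x \<otimes> (s x j \<otimes> v j)) {..<k} = p i x \<otimes> matvec R l k s v x"
        using x by (simp add: matvec_def)
    qed (use vecs_closed[OF matvec_closed[OF s v]] pc in auto)
    finally show ?thesis using True by (simp add: matvec_def)
  qed (simp add: matvec_def)
qed

lemma matvec_column:
  assumes "is_mat R n l p" "is_mat R l k s" "j < k"
  shows "matvec R n l p (column R l s j) = column R n (matmul R l p s) j"
proof (rule ext)
  fix i
  have "finsum R (\<lambda>x. p i x \<otimes> column R l s j x) {..<l} = finsum R (\<lambda>x. p i x \<otimes> s x j) {..<l}" if "i < n"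
    using assms that by (intro finsum_cong') (auto simp: column_def is_mat_def)
  then show "matvec R n l p (column R l s j) i = column R n (matmul R l p s) j i"
    by (simp add: matvec_def column_def matmul_def)
qed

lemma matvec_cong:
  "(\<And>i j. i < n \<Longrightarrow> j < k \<Longrightarrow> e i j = e' i j) \<Longrightarrow> is_mat R n k e' \<Longrightarrow> v \<in> vecs R k \<Longrightarrow>
    matvec R n k e v = matvec R n k e' v"
  using vecs_closed[of v k]
  by (auto simp: matvec_def fun_eq_iff is_mat_def intro!: finsum_cong')

lemma fixmod_cong:
  assumes "\<And>i j. i < n \<Longrightarrow> j < n \<Longrightarrow> e i j = e' i j" "is_mat R n n e'"
  shows "fixmod R n e = fixmod R n e'"
  unfolding fixmod_def using matvec_cong[OF assms(1) assms(2)] by auto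

lemma module_fixmod:
  assumes e: "is_mat R n n e"
  shows "module R (fixmod R n e)"
proof (rule moduleI)
  have c: "v i \<in> carrier R" if "v \<in> carrier (fixmod R n e)" for v i
    using that vecs_closed by (auto simp: fixmod_simps)
  have sm: "(\<lambda>i. a \<otimes> v i) \<in> carrier (fixmod R n e)" if "a \<in> carrier R" "v \<in> carrier (fixmod R n e)" for a v
    using that matvec_smult[OF e _ that(1), of v] by (auto simp: fixmod_simps vecs_def)
  show "abelian_group (fixmod R n e)"
  proof (rule abelian_groupI)
    fix u v assume uv: "u \<in> carrier (fixmod R n e)" "v \<in> carrier (fixmod R n e)"
    then show "u \<oplus>\<^bsub>fixmod R n e\<^esub> v \<in> carrier (fixmod R n e)"
      using matvec_add[OF e, of u v] by (auto simp: fixmod_simps vecs_def)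
    show "u \<oplus>\<^bsub>fixmod R n e\<^esub> v = v \<oplus>\<^bsub>fixmod R n e\<^esub> u"
      using c uv by (auto simp: fixmod_simps(3) a_comm)
    fix w assume "w \<in> carrier (fixmod R n e)"
    then show "u \<oplus>\<^bsub>fixmod R n e\<^esub> v \<oplus>\<^bsub>fixmod R n e\<^esub> w = u \<oplus>\<^bsub>fixmod R n e\<^esub> (v \<oplus>\<^bsub>fixmod R n e\<^esub> w)"
      using c uv by (auto simp: fixmod_simps(3) a_assoc)
  next
    have "finsum R (\<lambda>j. e i j \<otimes> \<zero>) {..<n} = \<zero>" if "i < n" for i
      using e that by (intro add.finprod_one_eqI) (auto simp: is_mat_def)
    then show "\<zero>\<^bsub>fixmod R n e\<^esub> \<in> carrier (fixmod R n e)"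
      by (auto simp: fixmod_simps vecs_def matvec_def)
  next
    fix v assume v: "v \<in> carrier (fixmod R n e)"
    show "\<zero>\<^bsub>fixmod R n e\<^esub> \<oplus>\<^bsub>fixmod R n e\<^esub> v = v"
      using c[OF v] by (auto simp: fixmod_simps(2,3))
    show "\<exists>y\<in>carrier (fixmod R n e). y \<oplus>\<^bsub>fixmod R n e\<^esub> v = \<zero>\<^bsub>fixmod R n e\<^esub>"
      using c[OF v] sm[OF _ v, of "\<ominus> \<one>"]
      by (intro bexI[of _ "\<lambda>i. \<ominus> \<one> \<otimes> v i"]) (auto simp: fixmod_simps(2,3) l_minus l_neg)
  qed
  show "cring R" by (rule cring_axioms)
  show "\<And>a u. a \<in> carrier R \<Longrightarrow> u \<in> carrier (fixmod R n e) \<Longrightarrow> a \<odot>\<^bsub>fixmod R n e\<^esub> u \<in> carrier (fixmod R n e)"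
    using sm by (simp add: fixmod_simps(4))
  fix u assume u: "u \<in> carrier (fixmod R n e)"
  show "\<one> \<odot>\<^bsub>fixmod R n e\<^esub> u = u" using c[OF u] by (auto simp: fixmod_simps(4))
  fix a assume a: "a \<in> carrier R"
  show "a \<odot>\<^bsub>fixmod R n e\<^esub> (u \<oplus>\<^bsub>fixmod R n e\<^esub> v) = a \<odot>\<^bsub>fixmod R n e\<^esub> u \<oplus>\<^bsub>fixmod R n e\<^esub> a \<odot>\<^bsub>fixmod R n e\<^esub> v"
    if v: "v \<in> carrier (fixmod R n e)" for v
    using c[OF u] c[OF v] a by (auto simp: fixmod_simps(3,4) r_distr)
  fix b assume b: "b \<in> carrier R"
  show "(a \<oplus> b) \<odot>\<^bsub>fixmod R n e\<^esub> u = a \<odot>\<^bsub>fixmod R n e\<^esub> u \<oplus>\<^bsub>fixmod R n e\<^esub> b \<odot>\<^bsub>fixmod R n e\<^esub> u"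
    "a \<otimes> b \<odot>\<^bsub>fixmod R n e\<^esub> u = a \<odot>\<^bsub>fixmod R n e\<^esub> (b \<odot>\<^bsub>fixmod R n e\<^esub> u)"
    using c[OF u] a b by (auto simp: fixmod_simps(3,4) l_distr m_assoc)
qed

lemma finsum_fixmod:
  assumes e: "is_mat R n n e" and "finite A" "\<And>x. x \<in> A \<Longrightarrow> f x \<in> carrier (fixmod R n e)"
  shows "finsum (fixmod R n e) f A = (\<lambda>i. finsum R (\<lambda>x. f x i) A)"
proof -
  interpret M: module R "fixmod R n e" by (rule module_fixmod[OF e])
  have c: "v i \<in> carrier R" if "v \<in> carrier (fixmod R n e)" for v i
    using that vecs_closed by (auto simp: fixmod_simps)
  show ?thesis using assms(2,3)
  proof (induction A rule: finite_induct)
    case empty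
    then show ?case by (simp add: fixmod_simps)
  next
    case (insert x A)
    then have "finsum (fixmod R n e) f (insert x A) = f x \<oplus>\<^bsub>fixmod R n e\<^esub> finsum (fixmod R n e) f A"
      by (intro M.M.finsum_insert) auto
    also have "\<dots> = (\<lambda>i. f x i \<oplus> finsum R (\<lambda>x. f x i) A)" using insert by (simp add: fixmod_simps(3))
    also have "\<dots> = (\<lambda>i. finsum R (\<lambda>x. f x i) (insert x A))"
      using insert c by (intro ext finsum_insert[symmetric]) auto
    finally show ?case .
  qed
qed

lemma column_fixmod:
  assumes "idem_mat R n e" "j < n"
  shows "column R n e j \<in> carrier (fixmod R n e)"
proof -
  have "matvec R n n e (column R n e j) = column R n (matmul R n e e) j"
    by (rule matvec_column[OF _ _ assms(2)]) (use assms(1) in \<open>auto simp: idem_mat_def\<close>)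
  also have "\<dots> = column R n e j" using assms by (auto simp: column_def idem_mat_def)
  finally show ?thesis using assms by (auto simp: fixmod_simps vecs_def column_def idem_mat_def is_mat_def)
qed

text \<open>The equation e v = v, read column by column: the columns and the coordinate functions
  form a dual basis of the image.\<close>

lemma fixmod_expand:
  assumes e: "idem_mat R n e" and v: "v \<in> carrier (fixmod R n e)"
  shows "finsum (fixmod R n e) (\<lambda>j. v j \<odot>\<^bsub>fixmod R n e\<^esub> column R n e j) {..<n} = v"
proof -
  have em: "is_mat R n n e" using e by (simp add: idem_mat_def)
  interpret M: module R "fixmod R n e" by (rule module_fixmod[OF em])
  have vc: "v i \<in> carrier R" for i using v vecs_closed by (auto simp: fixmod_simps)
  have "finsum (fixmod R n e) (\<lambda>j. v j \<odot>\<^bsub>fixmod R n e\<^esub> column R n e j) {..<n}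
      = (\<lambda>i. finsum R (\<lambda>j. (v j \<odot>\<^bsub>fixmod R n e\<^esub> column R n e j) i) {..<n})"
    by (rule finsum_fixmod[OF em]) (use column_fixmod[OF e] vc in auto)
  also have "\<dots> = matvec R n n e v"
  proof (rule ext)
    fix i
    show "finsum R (\<lambda>j. (v j \<odot>\<^bsub>fixmod R n e\<^esub> column R n e j) i) {..<n} = matvec R n n e v i"
    proof (cases "i < n")
      case True
      have "finsum R (\<lambda>j. (v j \<odot>\<^bsub>fixmod R n e\<^esub> column R n e j) i) {..<n} = finsum R (\<lambda>j. e i j \<otimes> v j) {..<n}"
        using vc em True by (intro finsum_cong') (auto simp: fixmod_simps column_def is_mat_def m_comm)
      then show ?thesis using True by (simp add: matvec_def)
    next
      case False
      then show ?thesis using vc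
        by (auto simp: fixmod_simps(4) column_def matvec_def intro!: add.finprod_one_eqI)
    qed
  qed
  also have "\<dots> = v" using v by (simp add: fixmod_simps)
  finally show ?thesis .
qed

end

lemma submodule_finsum:
  assumes "module R M" "submodule H R M" "finite A" "\<And>x. x \<in> A \<Longrightarrow> g x \<in> H"
  shows "finsum M g A \<in> H"
proof -
  interpret M: module R M by fact
  have H: "H \<subseteq> carrier M" by (rule M.submoduleE(1)[OF assms(2)])
  have z: "\<zero>\<^bsub>M\<^esub> \<in> H"
    using subgroup.one_closed[OF submodule.axioms(1)[OF assms(2)]] by simp
  show ?thesis using assms(3,4)
  proof (induction A rule: finite_induct)
    case (insert x A)
    then have "finsum M g (insert x A) = g x \<oplus>\<^bsub>M\<^esub> finsum M g A"
      using H by (intro M.M.finsum_insert) auto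
    then show ?case using insert M.submoduleE(5)[OF assms(2)] by simp
  qed (simp add: z)
qed

text \<open>By \<open>fixmod_expand\<close> the columns generate. A map to \<open>P\<close> lifts by
  choosing preimages of the values on the columns and combining them with the coordinates of
  \<open>v\<close>.\<close>

lemma (in cring) fixmod_fgp:
  assumes e: "idem_mat R n e"
  shows "fixmod R n e \<in> fgp_modules R"
proof -
  have em: "is_mat R n n e" using e by (simp add: idem_mat_def)
  let ?M = "fixmod R n e"
  note mod = module_fixmod[OF em]
  interpret M: module R ?M by (rule mod)
  note col = column_fixmod[OF e]
  have vc: "v i \<in> carrier R" if "v \<in> carrier ?M" for v i using that vecs_closed by (auto simp: fixmod_simps)
  have "fin_gen_module R ?M"
    unfolding fin_gen_module_def
  proof (intro exI[of _ "column R n e ` {..<n}"] conjI allI impI)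
    fix H assume H: "submodule H R ?M \<and> column R n e ` {..<n} \<subseteq> H"
    have "v \<in> H" if v: "v \<in> carrier ?M" for v
    proof -
      have "finsum ?M (\<lambda>j. v j \<odot>\<^bsub>?M\<^esub> column R n e j) {..<n} \<in> H"
        by (rule submodule_finsum[OF mod]) (use H M.submoduleE(4) vc[OF v] in auto)
      then show ?thesis by (simp add: fixmod_expand[OF e v])
    qed
    then show "H = carrier ?M" using M.submoduleE(1) H by blast
  qed (use col in auto)
  moreover have "projective_module R ?M"
    unfolding projective_module_def
  proof (intro allI impI ballI)
    fix N P :: "('a, nat \<Rightarrow> 'a) module" and g f
    assume NP: "module R N \<and> module R P" and g: "g \<in> linear_maps R N P" and f: "f \<in> linear_maps R ?M P"
      and surj: "g ` carrier N = carrier P"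
    interpret N: module R N using NP by simp
    interpret P: module R P using NP by simp
    have "\<exists>y\<in>carrier N. g y = f (column R n e j)" if "j < n" for j
      using surj semilinear_closed[OF f col[OF that]] by (metis imageE)
    then obtain y where y: "\<And>j. j < n \<Longrightarrow> y j \<in> carrier N" "\<And>j. j < n \<Longrightarrow> g (y j) = f (column R n e j)"
      by metis
    define h where "h v = finsum N (\<lambda>j. v j \<odot>\<^bsub>N\<^esub> y j) {..<n}" for v
    have "h \<in> linear_maps R ?M N"
      unfolding h_def[abs_def] by (rule lincomb_linear) (use NP y in auto)
    moreover have "g (h v) = f v" if v: "v \<in> carrier ?M" for v
    proof -
      have "g (h v) = finsum P (\<lambda>j. g (v j \<odot>\<^bsub>N\<^esub> y j)) {..<n}"
        unfolding h_def by (rule semilinear_finsum[OF _ _ g]) (use NP y vc[OF v] in auto)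
      also have "\<dots> = finsum P (\<lambda>j. f (v j \<odot>\<^bsub>?M\<^esub> column R n e j)) {..<n}"
        using y vc[OF v] semilinear_smult[OF g] semilinear_smult[OF f] col semilinear_closed[OF f]
        by (intro P.M.finsum_cong') auto
      also have "\<dots> = f (finsum ?M (\<lambda>j. v j \<odot>\<^bsub>?M\<^esub> column R n e j) {..<n})"
        by (rule semilinear_finsum[OF mod _ f, symmetric]) (use NP col vc[OF v] in auto)
      finally show ?thesis by (simp add: fixmod_expand[OF e v])
    qed
    ultimately show "\<exists>h\<in>linear_maps R ?M N. \<forall>x\<in>carrier ?M. g (h x) = f x" by blast
  qed
  ultimately show ?thesis using mod by (simp add: fgp_modules_def)
qed

text \<open>Finitely many generators give a surjection \<open>g\<close> from R^n, projectivity gives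
  a section \<open>h\<close>, and \<open>e\<close> is the matrix of the idempotent h g, whose image
  is isomorphic to \<open>M\<close> through \<open>h\<close>.\<close>

lemma (in cring) fgp_iso_fixmod:
  assumes "M \<in> fgp_modules R"
  shows "\<exists>n e f. idem_mat R n e \<and> f \<in> linear_maps R M (fixmod R n e) \<and>
    bij_betw f (carrier M) (carrier (fixmod R n e))"
proof -
  have mod: "module R M" and proj: "projective_module R M" using assms by (auto simp: fgp_modules_def)
  interpret M: module R M by fact
  obtain A where A: "A \<subseteq> carrier M" "finite A" "\<And>H. submodule H R M \<Longrightarrow> A \<subseteq> H \<Longrightarrow> H = carrier M"
    using assms by (auto simp: fgp_modules_def fin_gen_module_def)
  obtain a and n :: nat where aA: "A = a ` {i. i < n}"
    using finite_imp_nat_seg_image_inj_on[OF A(2)] by blast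
  have a: "a j \<in> carrier M" if "j < n" for j using aA A(1) that by blast
  \<comment> \<open>The free module R^n in the type of test modules, so that projectivity applies to
    it.\<close>
  define F where "F = fixmod R n (idmat R)"
  have Fmod: "module R F" unfolding F_def by (rule module_fixmod[OF is_mat_idmat])
  interpret F: module R F by fact
  have Fc: "carrier F = vecs R n" using matvec_idmat by (auto simp: F_def fixmod_simps)
  define g where "g v = finsum M (\<lambda>j. v j \<odot>\<^bsub>M\<^esub> a j) {..<n}" for v
  have g: "g \<in> linear_maps R F M"
    unfolding g_def[abs_def] F_def by (rule lincomb_linear[OF mod a])
  have "g ` carrier F = carrier M"
  proof (rule A(3))
    show "submodule (g ` carrier F) R M"
    proof (rule M.submoduleI)
      show "g ` carrier F \<subseteq> carrier M" using semilinear_closed[OF g] by blast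
      show "\<zero>\<^bsub>M\<^esub> \<in> g ` carrier F" using semilinear_zero[OF Fmod mod g] F.M.zero_closed by (metis imageI)
      show sm: "c \<odot>\<^bsub>M\<^esub> x \<in> g ` carrier F" if "c \<in> carrier R" "x \<in> g ` carrier F" for c x
      proof -
        from that(2) obtain v where v: "v \<in> carrier F" "x = g v" by blast
        then have "c \<odot>\<^bsub>M\<^esub> x = g (c \<odot>\<^bsub>F\<^esub> v)" using semilinear_smult[OF g that(1)] by simp
        moreover have "c \<odot>\<^bsub>F\<^esub> v \<in> carrier F" using that(1) v(1) by (rule F.smult_closed)
        ultimately show ?thesis by blast
      qed
      show "\<ominus>\<^bsub>M\<^esub> x \<in> g ` carrier F" if "x \<in> g ` carrier F" for x
      proof -
        have "x \<in> carrier M" using that semilinear_closed[OF g] by blast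
        then have "\<ominus>\<^bsub>M\<^esub> x = (\<ominus> \<one>) \<odot>\<^bsub>M\<^esub> x" by (simp add: M.smult_l_minus)
        then show ?thesis using sm[OF _ that] by simp
      qed
      show "x \<oplus>\<^bsub>M\<^esub> y \<in> g ` carrier F" if "x \<in> g ` carrier F" "y \<in> g ` carrier F" for x y
      proof -
        from that obtain v w where vw: "v \<in> carrier F" "x = g v" "w \<in> carrier F" "y = g w" by blast
        then have "x \<oplus>\<^bsub>M\<^esub> y = g (v \<oplus>\<^bsub>F\<^esub> w)" using semilinear_add[OF g] by simp
        moreover have "v \<oplus>\<^bsub>F\<^esub> w \<in> carrier F" using vw(1,3) by (rule F.M.a_closed)
        ultimately show ?thesis by blast
      qed
    qed
    show "A \<subseteq> g ` carrier F"
    proof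
      fix x assume "x \<in> A"
      then obtain j where j: "j < n" "x = a j" using aA by blast
      have "g (column R n (idmat R) j) = finsum M (\<lambda>l. if j = l then a l else \<zero>\<^bsub>M\<^esub>) {..<n}"
        unfolding g_def using a by (intro M.M.finsum_cong') (auto simp: column_def idmat_def)
      also have "\<dots> = a j" using M.M.finsum_singleton[of j "{..<n}" a] j a by auto
      finally have "x = g (column R n (idmat R) j)" using j by simp
      moreover have "column R n (idmat R) j \<in> carrier F" by (auto simp: Fc vecs_def column_def idmat_def)
      ultimately show "x \<in> g ` carrier F" by blast
    qed
  qed
  moreover have "(\<lambda>x. x) \<in> linear_maps R M M" by (auto simp: semilinear_maps_def)
  ultimately obtain h where h: "h \<in> linear_maps R M F" and gh: "\<And>x. x \<in> carrier M \<Longrightarrow> g (h x) = x"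
    using proj Fmod mod g unfolding projective_module_def by meson
  define e where "e i j = h (a j) i" for i j
  have hc: "h x \<in> vecs R n" if "x \<in> carrier M" for x using semilinear_closed[OF h that] by (simp add: Fc)
  have em: "is_mat R n n e" using vecs_closed[OF hc[OF a]] by (auto simp: is_mat_def e_def)
  have gc: "g v \<in> carrier M" if "v \<in> vecs R n" for v using semilinear_closed[OF g] that by (simp add: Fc)
  have ev: "matvec R n n e v = h (g v)" if v: "v \<in> vecs R n" for v
  proof -
    note vc = vecs_closed[OF v]
    have "h (g v) = finsum F (\<lambda>j. h (v j \<odot>\<^bsub>M\<^esub> a j)) {..<n}"
      unfolding g_def by (rule semilinear_finsum[OF mod Fmod h]) (use vc a in auto)
    also have "\<dots> = (\<lambda>i. finsum R (\<lambda>j. h (v j \<odot>\<^bsub>M\<^esub> a j) i) {..<n})"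
      unfolding F_def by (rule finsum_fixmod[OF is_mat_idmat])
        (use semilinear_closed[OF h] vc a in \<open>auto simp: F_def\<close>)
    also have "\<dots> = matvec R n n e v"
    proof (rule ext)
      fix i
      have hi: "h (v j \<odot>\<^bsub>M\<^esub> a j) i = v j \<otimes> e i j" if "j < n" for j
        using semilinear_smult[OF h vc a[OF that]] by (simp add: F_def fixmod_simps e_def)
      show "finsum R (\<lambda>j. h (v j \<odot>\<^bsub>M\<^esub> a j) i) {..<n} = matvec R n n e v i"
      proof (cases "i < n")
        case True
        have "finsum R (\<lambda>j. h (v j \<odot>\<^bsub>M\<^esub> a j) i) {..<n} = finsum R (\<lambda>j. e i j \<otimes> v j) {..<n}"
          using hi vc em True by (intro finsum_cong') (auto simp: is_mat_def m_comm)
        then show ?thesis using True by (simp add: matvec_def)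
      next
        case False
        have "e i j = \<zero>" if "j < n" for j using hc[OF a[OF that]] False by (simp add: vecs_def e_def)
        then show ?thesis using False hi vc
          by (auto simp: matvec_def intro!: add.finprod_one_eqI)
      qed
    qed
    finally show ?thesis ..
  qed
  have idem: "idem_mat R n e"
  proof -
    have "matmul R n e e i k = e i k" if "i < n" "k < n" for i k
    proof -
      have "matmul R n e e i k = matvec R n n e (h (a k)) i" using that by (simp add: matmul_def matvec_def e_def)
      also have "\<dots> = h (a k) i" using ev[OF hc[OF a[OF that(2)]]] gh[OF a[OF that(2)]] by simp
      finally show ?thesis by (simp add: e_def)
    qed
    then show ?thesis using em by (simp add: idem_mat_def)
  qed
  have fixc: "carrier (fixmod R n e) = h ` carrier M"
  proof (rule Set.set_eqI)
    fix v
    show "v \<in> carrier (fixmod R n e) \<longleftrightarrow> v \<in> h ` carrier M"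
    proof
      assume "v \<in> carrier (fixmod R n e)"
      then have "v = h (g v)" "v \<in> vecs R n" using ev by (auto simp: fixmod_simps)
      then show "v \<in> h ` carrier M" using gc by blast
    next
      assume "v \<in> h ` carrier M"
      then show "v \<in> carrier (fixmod R n e)" using ev hc gh by (auto simp: fixmod_simps)
    qed
  qed
  have "h \<in> linear_maps R M (fixmod R n e)"
    using h fixc by (auto simp: semilinear_maps_def F_def fixmod_simps(3,4))
  moreover have "bij_betw h (carrier M) (carrier (fixmod R n e))"
    unfolding bij_betw_def fixc by (metis gh inj_onI)
  ultimately show ?thesis using idem by blast
qed

section \<open>Extension of scalars\<close>

lemma restrict_linear:
  assumes "module S N" "a \<in> linear_maps S N P"
  shows "restrict a (carrier N) \<in> linear_maps S N P"
proof -
  interpret N: module S N by fact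
  show ?thesis using assms(2) by (auto simp: semilinear_maps_def Pi_iff)
qed

lemma linear_maps_sum:
  assumes "module S N" "module S P" "a \<in> linear_maps S N P" "b \<in> linear_maps S N P"
  shows "(\<lambda>y. a y \<oplus>\<^bsub>P\<^esub> b y) \<in> linear_maps S N P"
proof -
  interpret N: module S N by fact
  interpret P: module S P by fact
  note c = semilinear_closed[OF assms(3)] semilinear_closed[OF assms(4)]
  show ?thesis unfolding semilinear_maps_def
  proof (intro CollectI conjI ballI Pi_I)
    fix x y assume "x \<in> carrier N" "y \<in> carrier N"
    then show "a (x \<oplus>\<^bsub>N\<^esub> y) \<oplus>\<^bsub>P\<^esub> b (x \<oplus>\<^bsub>N\<^esub> y) = a x \<oplus>\<^bsub>P\<^esub> b x \<oplus>\<^bsub>P\<^esub> (a y \<oplus>\<^bsub>P\<^esub> b y)"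
      using c semilinear_add[OF assms(3)] semilinear_add[OF assms(4)] by (simp add: P.M.a_ac)
  next
    fix r x assume "r \<in> carrier S" "x \<in> carrier N"
    then show "a (r \<odot>\<^bsub>N\<^esub> x) \<oplus>\<^bsub>P\<^esub> b (r \<odot>\<^bsub>N\<^esub> x) = id r \<odot>\<^bsub>P\<^esub> (a x \<oplus>\<^bsub>P\<^esub> b x)"
      using c semilinear_smult[OF assms(3)] semilinear_smult[OF assms(4)] by (simp add: P.smult_r_distr)
  qed (use c in auto)
qed

lemma zero_linear:
  assumes "module S P"
  shows "(\<lambda>_. \<zero>\<^bsub>P\<^esub>) \<in> linear_maps S N P"
proof -
  interpret P: module S P by fact
  show ?thesis by (auto simp: semilinear_maps_def)
qed

lemma id_linear: "(\<lambda>y. y) \<in> linear_maps S N N"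
  by (auto simp: semilinear_maps_def)

lemma inv_linear:
  assumes "module R M" "f \<in> linear_maps R M Q" "bij_betw f (carrier M) (carrier Q)"
  shows "inv_into (carrier M) f \<in> linear_maps R Q M"
proof -
  interpret M: module R M by fact
  let ?g = "inv_into (carrier M) f"
  have g: "?g y \<in> carrier M" "f (?g y) = y" if "y \<in> carrier Q" for y
    using that assms(3) by (metis bij_betw_def inv_into_into, metis bij_betw_inv_into_right)
  have inj: "x = y" if "f x = f y" "x \<in> carrier M" "y \<in> carrier M" for x y
    using that assms(3) by (meson bij_betw_def inj_onD)
  have gf: "?g (f x) = x" if "x \<in> carrier M" for x
    using that assms(3) by (metis bij_betw_inv_into_left)
  show ?thesis unfolding semilinear_maps_def
  proof (intro CollectI conjI ballI Pi_I)
    fix x y assume xy: "x \<in> carrier Q" "y \<in> carrier Q"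
    have "x \<oplus>\<^bsub>Q\<^esub> y = f (?g x \<oplus>\<^bsub>M\<^esub> ?g y)"
      using semilinear_add[OF assms(2) g(1)[OF xy(1)] g(1)[OF xy(2)]] g(2) xy by simp
    then show "?g (x \<oplus>\<^bsub>Q\<^esub> y) = ?g x \<oplus>\<^bsub>M\<^esub> ?g y" using gf g(1) xy by simp
  next
    fix r x assume rx: "r \<in> carrier R" "x \<in> carrier Q"
    have "r \<odot>\<^bsub>Q\<^esub> x = f (r \<odot>\<^bsub>M\<^esub> ?g x)"
      using semilinear_smult[OF assms(2) rx(1) g(1)[OF rx(2)]] g(2) rx by simp
    then show "?g (r \<odot>\<^bsub>Q\<^esub> x) = id r \<odot>\<^bsub>M\<^esub> ?g x" using gf g(1) rx by simp
  qed (use g in auto)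
qed

lemma module_isoI:
  assumes "f \<in> linear_maps R M N" "\<And>y. y \<in> carrier N \<Longrightarrow> g y \<in> carrier M"
    "\<And>x. x \<in> carrier M \<Longrightarrow> g (f x) = x" "\<And>y. y \<in> carrier N \<Longrightarrow> f (g y) = y"
  shows "module_iso R M N"
  unfolding module_iso_def
proof (rule bexI[OF _ assms(1)])
  show "bij_betw f (carrier M) (carrier N)"
    by (rule bij_betw_byWitness[where f' = g]) (use assms semilinear_closed[OF assms(1)] in auto)
qed

lemma scalar_extension_ex1:
  fixes P :: "('b, nat \<Rightarrow> 'b) module" and S :: "('b, 's) ring_scheme"
  assumes "scalar_extension R S \<phi> M N \<iota>" "module S P" "f \<in> semilinear_maps R \<phi> M P"
  shows "\<exists>!g. g \<in> linear_maps S N P \<and> g \<in> extensional (carrier N) \<and> (\<forall>x\<in>carrier M. g (\<iota> x) = f x)"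
  using assms unfolding scalar_extension_def by blast

lemma scalar_extension_lift:
  fixes P :: "('b, nat \<Rightarrow> 'b) module" and S :: "('b, 's) ring_scheme"
  assumes "scalar_extension R S \<phi> M N \<iota>" "module S P" "f \<in> semilinear_maps R \<phi> M P"
  obtains g where "g \<in> linear_maps S N P" "\<And>x. x \<in> carrier M \<Longrightarrow> g (\<iota> x) = f x"
  using ex1_implies_ex[OF scalar_extension_ex1[OF assms]] by blast

text \<open>The universal property has uniqueness among extensional maps only, hence the restriction
  to the carrier.\<close>

lemma scalar_extension_unique:
  fixes P :: "('b, nat \<Rightarrow> 'b) module" and S :: "('b, 's) ring_scheme"
  assumes se: "scalar_extension R S \<phi> M N \<iota>" and P: "module S P" and \<phi>: "\<phi> \<in> carrier R \<rightarrow> carrier S"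
    and a: "a \<in> linear_maps S N P" and b: "b \<in> linear_maps S N P"
    and ab: "\<And>x. x \<in> carrier M \<Longrightarrow> a (\<iota> x) = b (\<iota> x)" and y: "y \<in> carrier N"
  shows "a y = b y"
proof -
  have N: "module S N" and \<iota>: "\<iota> \<in> semilinear_maps R \<phi> M N" using se by (auto simp: scalar_extension_def)
  have "(\<lambda>x. a (\<iota> x)) \<in> semilinear_maps R \<phi> M P" by (rule linear_maps_comp[OF \<iota> a \<phi>])
  note ex1 = scalar_extension_ex1[OF se P this]
  have \<iota>c: "\<iota> x \<in> carrier N" if "x \<in> carrier M" for x by (rule semilinear_closed[OF \<iota> that])
  obtain h where h: "\<And>g. g \<in> linear_maps S N P \<Longrightarrow> g \<in> extensional (carrier N) \<Longrightarrow>
      \<forall>x\<in>carrier M. g (\<iota> x) = a (\<iota> x) \<Longrightarrow> g = h"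
    using ex1 by (elim ex1E) blast
  have "restrict a (carrier N) = h" by (rule h[OF restrict_linear[OF N a]]) (use \<iota>c in auto)
  moreover have "restrict b (carrier N) = h" by (rule h[OF restrict_linear[OF N b]]) (use \<iota>c ab in auto)
  ultimately have "restrict a (carrier N) = restrict b (carrier N)" by simp
  then show ?thesis using y by (metis restrict_apply')
qed

text \<open>A direct sum has pairs as elements and so is not among the test modules of the universal
  property. Therefore projections and injections are transported separately to the extensions, and
  the biproduct identities follow from uniqueness.\<close>

lemma scalar_extension_direct_sum:
  assumes M: "module R M" and M1: "module R M1" and M2: "module R M2"
    and \<phi>: "\<phi> \<in> carrier R \<rightarrow> carrier S"
    and se: "scalar_extension R S \<phi> M N \<iota>"
    and se1: "scalar_extension R S \<phi> M1 N1 \<iota>1" and se2: "scalar_extension R S \<phi> M2 N2 \<iota>2"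
    and iso: "module_iso R M (direct_sum M1 M2)"
  shows "module_iso S N (direct_sum N1 N2)"
proof -
  interpret M1: module R M1 by fact
  interpret M2: module R M2 by fact
  interpret M: module R M by fact
  interpret N: module S N using se by (simp add: scalar_extension_def)
  interpret N1: module S N1 using se1 by (simp add: scalar_extension_def)
  interpret N2: module S N2 using se2 by (simp add: scalar_extension_def)
  note mods = N.module_axioms N1.module_axioms N2.module_axioms
  have \<iota>: "\<iota> \<in> semilinear_maps R \<phi> M N" "\<iota>1 \<in> semilinear_maps R \<phi> M1 N1" "\<iota>2 \<in> semilinear_maps R \<phi> M2 N2"
    using se se1 se2 by (auto simp: scalar_extension_def)
  obtain f where f: "f \<in> linear_maps R M (direct_sum M1 M2)"
    and bij: "bij_betw f (carrier M) (carrier (direct_sum M1 M2))"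
    using iso by (auto simp: module_iso_def)
  define F where "F = inv_into (carrier M) f"
  have F: "F \<in> linear_maps R (direct_sum M1 M2) M" unfolding F_def by (rule inv_linear[OF M f bij])
  have Ff: "F (f x) = x" if "x \<in> carrier M" for x
    using bij_betw_inv_into_left[OF bij that] by (simp add: F_def)
  have fF: "f (F z) = z" if "z \<in> carrier (direct_sum M1 M2)" for z
    using bij_betw_inv_into_right[OF bij that] by (simp add: F_def)
  define p1 where "p1 x = fst (f x)" for x
  define p2 where "p2 x = snd (f x)" for x
  define j1 where "j1 x = F (x, \<zero>\<^bsub>M2\<^esub>)" for x
  define j2 where "j2 x = F (\<zero>\<^bsub>M1\<^esub>, x)" for x
  have fst: "fst \<in> linear_maps R (direct_sum M1 M2) M1" and snd: "snd \<in> linear_maps R (direct_sum M1 M2) M2"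
    by (auto simp: semilinear_maps_def)
  have p1: "p1 \<in> linear_maps R M M1" unfolding p1_def[abs_def] by (rule linear_maps_precomp[OF f fst])
  have p2: "p2 \<in> linear_maps R M M2" unfolding p2_def[abs_def] by (rule linear_maps_precomp[OF f snd])
  have "(\<lambda>x. (x, \<zero>\<^bsub>M2\<^esub>)) \<in> linear_maps R M1 (direct_sum M1 M2)"
    and "(\<lambda>x. (\<zero>\<^bsub>M1\<^esub>, x)) \<in> linear_maps R M2 (direct_sum M1 M2)"
    by (auto simp: semilinear_maps_def)
  then have j1: "j1 \<in> linear_maps R M1 M" and j2: "j2 \<in> linear_maps R M2 M"
    unfolding j1_def[abs_def] j2_def[abs_def] using linear_maps_precomp F by blast+
  have pj: "p1 (j1 x) = x" "p2 (j1 x) = \<zero>\<^bsub>M2\<^esub>" if "x \<in> carrier M1" for x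
    using that by (simp_all add: p1_def p2_def j1_def fF)
  have pj': "p1 (j2 x) = \<zero>\<^bsub>M1\<^esub>" "p2 (j2 x) = x" if "x \<in> carrier M2" for x
    using that by (simp_all add: p1_def p2_def j2_def fF)
  have jp: "j1 (p1 x) \<oplus>\<^bsub>M\<^esub> j2 (p2 x) = x" if x: "x \<in> carrier M" for x
  proof -
    have fx: "f x \<in> carrier (direct_sum M1 M2)" by (rule semilinear_closed[OF f x])
    then have c: "p1 x \<in> carrier M1" "p2 x \<in> carrier M2" by (auto simp: p1_def p2_def mem_Times_iff)
    have "j1 (p1 x) \<oplus>\<^bsub>M\<^esub> j2 (p2 x) = F ((p1 x, \<zero>\<^bsub>M2\<^esub>) \<oplus>\<^bsub>direct_sum M1 M2\<^esub> (\<zero>\<^bsub>M1\<^esub>, p2 x))"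
      unfolding j1_def j2_def using c by (intro semilinear_add[OF F, symmetric]) auto
    also have "\<dots> = F (f x)" using c by (simp add: p1_def p2_def)
    finally show ?thesis using Ff[OF x] by simp
  qed
  obtain g1 where g1: "g1 \<in> linear_maps S N N1" "\<And>x. x \<in> carrier M \<Longrightarrow> g1 (\<iota> x) = \<iota>1 (p1 x)"
    using scalar_extension_lift[OF se N1.module_axioms linear_maps_precomp[OF p1 \<iota>(2)]] by blast
  obtain g2 where g2: "g2 \<in> linear_maps S N N2" "\<And>x. x \<in> carrier M \<Longrightarrow> g2 (\<iota> x) = \<iota>2 (p2 x)"
    using scalar_extension_lift[OF se N2.module_axioms linear_maps_precomp[OF p2 \<iota>(3)]] by blast
  obtain k1 where k1: "k1 \<in> linear_maps S N1 N" "\<And>x. x \<in> carrier M1 \<Longrightarrow> k1 (\<iota>1 x) = \<iota> (j1 x)"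
    using scalar_extension_lift[OF se1 N.module_axioms linear_maps_precomp[OF j1 \<iota>(1)]] by blast
  obtain k2 where k2: "k2 \<in> linear_maps S N2 N" "\<And>x. x \<in> carrier M2 \<Longrightarrow> k2 (\<iota>2 x) = \<iota> (j2 x)"
    using scalar_extension_lift[OF se2 N.module_axioms linear_maps_precomp[OF j2 \<iota>(1)]] by blast
  note cl = semilinear_closed[OF p1] semilinear_closed[OF p2] semilinear_closed[OF j1] semilinear_closed[OF j2]
  note gl = semilinear_closed[OF g1(1)] semilinear_closed[OF g2(1)] semilinear_closed[OF k1(1)] semilinear_closed[OF k2(1)]
  have idS: "id \<in> carrier S \<rightarrow> carrier S" by simp
  have z1: "\<iota>1 \<zero>\<^bsub>M1\<^esub> = \<zero>\<^bsub>N1\<^esub>" by (rule semilinear_zero[OF M1 N1.module_axioms \<iota>(2)])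
  have z2: "\<iota>2 \<zero>\<^bsub>M2\<^esub> = \<zero>\<^bsub>N2\<^esub>" by (rule semilinear_zero[OF M2 N2.module_axioms \<iota>(3)])
  have gk11: "g1 (k1 y) = y" if "y \<in> carrier N1" for y
    by (rule scalar_extension_unique[OF se1 N1.module_axioms \<phi> linear_maps_precomp[OF k1(1) g1(1)] id_linear _ that])
      (simp add: k1 g1 cl pj)
  have gk21: "g2 (k1 y) = \<zero>\<^bsub>N2\<^esub>" if "y \<in> carrier N1" for y
    by (rule scalar_extension_unique[OF se1 N2.module_axioms \<phi> linear_maps_precomp[OF k1(1) g2(1)]
          zero_linear[OF N2.module_axioms] _ that])
      (simp add: k1 g2 cl pj z2)
  have gk12: "g1 (k2 y) = \<zero>\<^bsub>N1\<^esub>" if "y \<in> carrier N2" for y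
    by (rule scalar_extension_unique[OF se2 N1.module_axioms \<phi> linear_maps_precomp[OF k2(1) g1(1)]
          zero_linear[OF N1.module_axioms] _ that])
      (simp add: k2 g1 cl pj' z1)
  have gk22: "g2 (k2 y) = y" if "y \<in> carrier N2" for y
    by (rule scalar_extension_unique[OF se2 N2.module_axioms \<phi> linear_maps_precomp[OF k2(1) g2(1)] id_linear _ that])
      (simp add: k2 g2 cl pj')
  have kg: "k1 (g1 y) \<oplus>\<^bsub>N\<^esub> k2 (g2 y) = y" if "y \<in> carrier N" for y
  proof (rule scalar_extension_unique[OF se N.module_axioms \<phi> _ id_linear _ that])
    show "(\<lambda>y. k1 (g1 y) \<oplus>\<^bsub>N\<^esub> k2 (g2 y)) \<in> linear_maps S N N"
      by (intro linear_maps_sum N.module_axioms linear_maps_precomp[OF g1(1) k1(1)] linear_maps_precomp[OF g2(1) k2(1)])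
    fix x assume x: "x \<in> carrier M"
    have "k1 (g1 (\<iota> x)) \<oplus>\<^bsub>N\<^esub> k2 (g2 (\<iota> x)) = \<iota> (j1 (p1 x)) \<oplus>\<^bsub>N\<^esub> \<iota> (j2 (p2 x))"
      using x by (simp add: g1 g2 k1 k2 cl)
    also have "\<dots> = \<iota> (j1 (p1 x) \<oplus>\<^bsub>M\<^esub> j2 (p2 x))"
      by (rule semilinear_add[OF \<iota>(1), symmetric]) (use x cl in auto)
    finally show "k1 (g1 (\<iota> x)) \<oplus>\<^bsub>N\<^esub> k2 (g2 (\<iota> x)) = \<iota> x" using jp[OF x] by simp
  qed
  show ?thesis
  proof (rule module_isoI[where f = "\<lambda>y. (g1 y, g2 y)" and g = "\<lambda>z. k1 (fst z) \<oplus>\<^bsub>N\<^esub> k2 (snd z)"])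
    show "(\<lambda>y. (g1 y, g2 y)) \<in> linear_maps S N (direct_sum N1 N2)"
      using g1(1) g2(1) by (auto simp: semilinear_maps_def)
    show "(g1 (k1 (fst z) \<oplus>\<^bsub>N\<^esub> k2 (snd z)), g2 (k1 (fst z) \<oplus>\<^bsub>N\<^esub> k2 (snd z))) = z"
      if "z \<in> carrier (direct_sum N1 N2)" for z
      using that gl semilinear_add[OF g1(1)] semilinear_add[OF g2(1)]
      by (auto simp: gk11 gk12 gk21 gk22)
  qed (use gl kg in auto)
qed

text \<open>Extending scalars applies \<open>\<phi>\<close> to the entries of the idempotent. A
  semilinear map \<open>u\<close> extends by its values on the preimages of the columns, and
  uniquely so because the columns of \<open>e'\<close> generate.\<close>

lemma scalar_extension_fixmod:
  assumes R: "cring R" and S: "cring S" and \<phi>: "\<phi> \<in> ring_hom R S" and e: "idem_mat R n e"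
    and M: "module R M" and f: "f \<in> linear_maps R M (fixmod R n e)"
    and bij: "bij_betw f (carrier M) (carrier (fixmod R n e))"
  defines "e' \<equiv> \<lambda>i j. \<phi> (e i j)"
  shows "idem_mat S n e'" "scalar_extension R S \<phi> M (fixmod S n e') (\<lambda>x i. \<phi> (f x i))"
proof -
  interpret R: cring R by fact
  interpret S: cring S by fact
  interpret h: ring_hom_cring R S \<phi>
    by (intro ring_hom_cring.intro ring_hom_cring_axioms.intro R S \<phi>)
  interpret M: module R M by fact
  have em: "is_mat R n n e" and ee: "\<And>i j. i < n \<Longrightarrow> j < n \<Longrightarrow> matmul R n e e i j = e i j"
    using e by (auto simp: idem_mat_def)
  have ec: "e i j \<in> carrier R" if "i < n" "j < n" for i j using em that by (simp add: is_mat_def)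
  show e': "idem_mat S n e'"
  proof -
    have "matmul S n e' e' i j = e' i j" if ij: "i < n" "j < n" for i j
    proof -
      have "\<phi> (matmul R n e e i j) = finsum S (\<phi> \<circ> (\<lambda>l. e i l \<otimes>\<^bsub>R\<^esub> e l j)) {..<n}"
        unfolding matmul_def using ec ij by (intro h.hom_finsum) auto
      also have "\<dots> = matmul S n e' e' i j"
        unfolding matmul_def e'_def using ec ij by (intro S.finsum_cong') auto
      finally show ?thesis using ee[OF ij] by (simp add: e'_def)
    qed
    then show ?thesis using ec by (simp add: idem_mat_def is_mat_def e'_def)
  qed
  then have em': "is_mat S n n e'" by (simp add: idem_mat_def)
  let ?F = "fixmod R n e" and ?N = "fixmod S n e'"
  define \<iota> where "\<iota> x = (\<lambda>i. \<phi> (f x i))" for x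
  have Fm: "module R ?F" by (rule R.module_fixmod[OF em])
  have Nm: "module S ?N" by (rule S.module_fixmod[OF em'])
  interpret F: module R ?F by (rule Fm)
  interpret N: module S ?N by (rule Nm)
  have fV: "f x \<in> vecs R n" "matvec R n n e (f x) = f x" if "x \<in> carrier M" for x
    using semilinear_closed[OF f that] by (auto simp: fixmod_simps)
  have fc: "f x i \<in> carrier R" if "x \<in> carrier M" for x i using R.vecs_closed[OF fV(1)[OF that]] .
  have \<iota>c: "\<iota> x \<in> carrier ?N" if x: "x \<in> carrier M" for x
  proof -
    have "matvec S n n e' (\<iota> x) i = \<iota> x i" for i
    proof (cases "i < n")
      case True
      have "\<phi> (finsum R (\<lambda>j. e i j \<otimes>\<^bsub>R\<^esub> f x j) {..<n}) = finsum S (\<phi> \<circ> (\<lambda>j. e i j \<otimes>\<^bsub>R\<^esub> f x j)) {..<n}"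
        using ec fc[OF x] True by (intro h.hom_finsum) auto
      also have "\<dots> = finsum S (\<lambda>j. e' i j \<otimes>\<^bsub>S\<^esub> \<iota> x j) {..<n}"
        unfolding e'_def \<iota>_def using ec fc[OF x] True by (intro S.finsum_cong') auto
      moreover have "finsum R (\<lambda>j. e i j \<otimes>\<^bsub>R\<^esub> f x j) {..<n} = f x i"
        using fun_cong[OF fV(2)[OF x], of i] True by (simp add: matvec_def)
      ultimately show ?thesis using True by (simp add: matvec_def \<iota>_def)
    next
      case False
      then show ?thesis using fV(1)[OF x] by (simp add: matvec_def \<iota>_def vecs_def)
    qed
    moreover have "\<iota> x \<in> vecs S n" using fV(1)[OF x] by (auto simp: \<iota>_def vecs_def)
    ultimately show ?thesis by (auto simp: fixmod_simps)
  qed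
  have \<iota>: "\<iota> \<in> semilinear_maps R \<phi> M ?N"
    unfolding semilinear_maps_def
  proof (intro CollectI conjI ballI Pi_I)
    fix x y assume "x \<in> carrier M" "y \<in> carrier M"
    then show "\<iota> (x \<oplus>\<^bsub>M\<^esub> y) = \<iota> x \<oplus>\<^bsub>?N\<^esub> \<iota> y"
      using semilinear_add[OF f] fc by (auto simp: \<iota>_def fixmod_simps(3))
  next
    fix a x assume "a \<in> carrier R" "x \<in> carrier M"
    then show "\<iota> (a \<odot>\<^bsub>M\<^esub> x) = \<phi> a \<odot>\<^bsub>?N\<^esub> \<iota> x"
      using semilinear_smult[OF f] fc by (auto simp: \<iota>_def fixmod_simps(4))
  qed (rule \<iota>c)
  \<comment> \<open>The elements of \<open>M\<close> corresponding to the columns of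
    \<open>e\<close>: generators of \<open>M\<close> whose images under \<open>\<iota>\<close> are
    the columns of \<open>e'\<close>.\<close>
  define c where "c j = inv_into (carrier M) f (column R n e j)" for j
  have col: "column R n e j \<in> carrier ?F" if "j < n" for j by (rule R.column_fixmod[OF e that])
  have c: "c j \<in> carrier M" "f (c j) = column R n e j" if "j < n" for j
    using bij_betw_inv_into_right[OF bij col[OF that]] col[OF that] bij
    by (auto simp: c_def bij_betw_def intro: inv_into_into)
  have \<iota>col: "\<iota> (c j) = column S n e' j" if "j < n" for j
    using c(2)[OF that] by (auto simp: \<iota>_def column_def e'_def)
  have expand: "finsum M (\<lambda>j. f x j \<odot>\<^bsub>M\<^esub> c j) {..<n} = x" if x: "x \<in> carrier M" for x
  proof -
    have "f (finsum M (\<lambda>j. f x j \<odot>\<^bsub>M\<^esub> c j) {..<n}) = finsum ?F (\<lambda>j. f (f x j \<odot>\<^bsub>M\<^esub> c j)) {..<n}"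
      by (rule semilinear_finsum[OF M Fm f]) (use fc[OF x] c in auto)
    also have "\<dots> = finsum ?F (\<lambda>j. f x j \<odot>\<^bsub>?F\<^esub> column R n e j) {..<n}"
      using semilinear_smult[OF f fc[OF x] c(1)] c(2) fc[OF x] col
      by (intro F.M.finsum_cong') auto
    also have "\<dots> = f x" by (rule R.fixmod_expand[OF e semilinear_closed[OF f x]])
    finally have "f (finsum M (\<lambda>j. f x j \<odot>\<^bsub>M\<^esub> c j) {..<n}) = f x" .
    moreover have "finsum M (\<lambda>j. f x j \<odot>\<^bsub>M\<^esub> c j) {..<n} \<in> carrier M"
      using fc[OF x] c by (intro M.lincomb_closed) auto
    ultimately show ?thesis using bij x by (meson bij_betw_def inj_onD)
  qed
  have "scalar_extension R S \<phi> M ?N \<iota>"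
    unfolding scalar_extension_def
  proof (intro conjI allI impI ballI Nm \<iota>)
    fix P :: "('c, nat \<Rightarrow> 'c) module" and u assume P: "module S P" and u: "u \<in> semilinear_maps R \<phi> M P"
    interpret P: module S P by fact
    have uc: "u (c j) \<in> carrier P" if "j < n" for j by (rule semilinear_closed[OF u c(1)[OF that]])
    define g where "g y = finsum P (\<lambda>j. y j \<odot>\<^bsub>P\<^esub> u (c j)) {..<n}" for y
    have g: "g \<in> linear_maps S ?N P" unfolding g_def[abs_def] by (rule lincomb_linear[OF P uc])
    have g\<iota>: "g (\<iota> x) = u x" if x: "x \<in> carrier M" for x
    proof -
      have "g (\<iota> x) = finsum P (\<lambda>j. u (f x j \<odot>\<^bsub>M\<^esub> c j)) {..<n}"
        unfolding g_def using semilinear_smult[OF u fc[OF x] c(1)] fc[OF x] uc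
        by (intro P.M.finsum_cong') (auto simp: \<iota>_def)
      also have "\<dots> = u (finsum M (\<lambda>j. f x j \<odot>\<^bsub>M\<^esub> c j) {..<n})"
        by (rule semilinear_finsum[OF M P u, symmetric]) (use fc[OF x] c in auto)
      finally show ?thesis by (simp add: expand[OF x])
    qed
    show "\<exists>!g. g \<in> linear_maps S ?N P \<and> g \<in> extensional (carrier ?N) \<and> (\<forall>x\<in>carrier M. g (\<iota> x) = u x)"
    proof (rule ex1I[of _ "restrict g (carrier ?N)"])
      show "restrict g (carrier ?N) \<in> linear_maps S ?N P \<and> restrict g (carrier ?N) \<in> extensional (carrier ?N) \<and>
          (\<forall>x\<in>carrier M. restrict g (carrier ?N) (\<iota> x) = u x)"
        using restrict_linear[OF Nm g] g\<iota> \<iota>c by auto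
      fix g' assume g': "g' \<in> linear_maps S ?N P \<and> g' \<in> extensional (carrier ?N) \<and>
          (\<forall>x\<in>carrier M. g' (\<iota> x) = u x)"
      then have g'l: "g' \<in> linear_maps S ?N P" by blast
      show "g' = restrict g (carrier ?N)"
      proof (rule extensionalityI[of _ "carrier ?N"])
        fix y assume y: "y \<in> carrier ?N"
        have yc: "y j \<in> carrier S" for j using y S.vecs_closed by (auto simp: fixmod_simps)
        have colc: "column S n e' j \<in> carrier ?N" if "j < n" for j by (rule S.column_fixmod[OF e' that])
        have "g' y = g' (finsum ?N (\<lambda>j. y j \<odot>\<^bsub>?N\<^esub> column S n e' j) {..<n})"
          by (simp add: S.fixmod_expand[OF e' y])
        also have "\<dots> = finsum P (\<lambda>j. g' (y j \<odot>\<^bsub>?N\<^esub> column S n e' j)) {..<n}"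
          by (rule semilinear_finsum[OF Nm P g'l]) (use yc colc in auto)
        also have "\<dots> = g y"
          unfolding g_def
        proof (rule P.M.finsum_cong')
          fix j assume "j \<in> {..<n}"
          then have j: "j < n" by simp
          have "g' (y j \<odot>\<^bsub>?N\<^esub> column S n e' j) = y j \<odot>\<^bsub>P\<^esub> g' (column S n e' j)"
            using semilinear_smult[OF g'l yc colc[OF j]] by simp
          also have "g' (column S n e' j) = u (c j)" using g' c(1)[OF j] \<iota>col[OF j] by auto
          finally show "g' (y j \<odot>\<^bsub>?N\<^esub> column S n e' j) = y j \<odot>\<^bsub>P\<^esub> u (c j)" .
        qed (use yc uc in auto)
        finally show "g' y = restrict g (carrier ?N) y" using y by simp
      qed (use g' in auto)
    qed
  qed
  then show "scalar_extension R S \<phi> M ?N (\<lambda>x i. \<phi> (f x i))" unfolding \<iota>_def[abs_def] .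
qed

section \<open>The group \<open>K\<^sub>0\<close>\<close>

lemma K0_relations_subgroup: "subgroup (K0_relations R) (free_Abelian_group (fgp_modules R))"
proof -
  interpret F: comm_group "free_Abelian_group (fgp_modules R)"
    by (rule abelian_free_Abelian_group)
  show ?thesis unfolding K0_relations_def
  proof (rule F.generate_is_subgroup, safe)
    fix P P1 P2 assume "P \<in> fgp_modules R" "P1 \<in> fgp_modules R" "P2 \<in> fgp_modules R"
    then have "Poly_Mapping.keys (frag_of P - (frag_of P1 + frag_of P2)) \<subseteq> fgp_modules R"
      using keys_diff[of "frag_of P" "frag_of P1 + frag_of P2"]
        Poly_Mapping.keys_add[of "frag_of P1" "frag_of P2"] by fastforce
    then show "frag_of P - (frag_of P1 + frag_of P2) \<in> carrier (free_Abelian_group (fgp_modules R))"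
      by simp
  qed
qed

lemma K0_relations_keys: "c \<in> K0_relations R \<Longrightarrow> Poly_Mapping.keys c \<subseteq> fgp_modules R"
  using subgroup.mem_carrier[OF K0_relations_subgroup] by simp

lemma K0_relations_zero: "0 \<in> K0_relations R"
  using subgroup.one_closed[OF K0_relations_subgroup[of R]] by simp

lemma K0_relations_add: "c \<in> K0_relations R \<Longrightarrow> d \<in> K0_relations R \<Longrightarrow> c + d \<in> K0_relations R"
  using subgroup.m_closed[OF K0_relations_subgroup] by fastforce

lemma K0_relations_uminus: "c \<in> K0_relations R \<Longrightarrow> - c \<in> K0_relations R"
  using subgroup.m_inv_closed[OF K0_relations_subgroup[of R], of c] by (simp add: K0_relations_keys)

lemma K0_relations_diff: "c \<in> K0_relations R \<Longrightarrow> d \<in> K0_relations R \<Longrightarrow> c - d \<in> K0_relations R"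
  using K0_relations_add[of c R "- d"] by (simp add: K0_relations_uminus)

lemma K0_relations_sum:
  assumes "P \<in> fgp_modules R" "P1 \<in> fgp_modules R" "P2 \<in> fgp_modules R" "module_iso R P (direct_sum P1 P2)"
  shows "frag_of P - (frag_of P1 + frag_of P2) \<in> K0_relations R"
  unfolding K0_relations_def by (rule generate.incl) (use assms in blast)

lemma K0_relations_extend:
  assumes c: "c \<in> K0_relations R"
    and gen: "\<And>P P1 P2. P \<in> fgp_modules R \<Longrightarrow> P1 \<in> fgp_modules R \<Longrightarrow> P2 \<in> fgp_modules R \<Longrightarrow>
      module_iso R P (direct_sum P1 P2) \<Longrightarrow> b P - (b P1 + b P2) \<in> K0_relations S"
  shows "frag_extend b c \<in> K0_relations S"
  using c unfolding K0_relations_def[of R]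
proof (induction rule: generate.induct)
  case one
  then show ?case by (simp add: K0_relations_zero)
next
  case (incl h)
  then show ?case using gen by (auto simp: frag_extend_diff frag_extend_add)
next
  case (inv h)
  then have "h \<in> K0_relations R" unfolding K0_relations_def by (rule generate.incl)
  then have "inv\<^bsub>free_Abelian_group (fgp_modules R)\<^esub> h = - h" by (simp add: K0_relations_keys)
  moreover have "frag_extend b h \<in> K0_relations S" using inv gen by (auto simp: frag_extend_diff frag_extend_add)
  ultimately show ?case by (simp add: frag_extend_minus K0_relations_uminus)
next
  case (eng h1 h2)
  then show ?case by (simp add: frag_extend_add K0_relations_add)
qed

definition K0_class :: "('a, 'r) ring_scheme \<Rightarrow> (('a, nat \<Rightarrow> 'a) module \<Rightarrow>\<^sub>0 int) \<Rightarrow> (('a, nat \<Rightarrow> 'a) module \<Rightarrow>\<^sub>0 int) set"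
  where "K0_class R c = K0_relations R #>\<^bsub>free_Abelian_group (fgp_modules R)\<^esub> c"

lemma K0_class_mem: "x \<in> K0_class R c \<longleftrightarrow> x - c \<in> K0_relations R"
  by (auto simp: K0_class_def r_coset_def) (metis diff_add_cancel)

lemma K0_class_eq_iff: "K0_class R c = K0_class R d \<longleftrightarrow> c - d \<in> K0_relations R"
proof
  assume "K0_class R c = K0_class R d"
  then have "c \<in> K0_class R d" using K0_class_mem[of c R c] K0_relations_zero by auto
  then show "c - d \<in> K0_relations R" by (simp add: K0_class_mem)
next
  assume cd: "c - d \<in> K0_relations R"
  have "x - c \<in> K0_relations R \<longleftrightarrow> x - d \<in> K0_relations R" for x
    using K0_relations_add[OF _ cd, of "x - c"] K0_relations_diff[OF _ cd, of "x - d"] by auto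
  then show "K0_class R c = K0_class R d" by (intro Set.set_eqI) (simp add: K0_class_mem)
qed

lemma carrier_K0: "carrier (K0 R) = K0_class R ` {c. Poly_Mapping.keys c \<subseteq> fgp_modules R}"
  unfolding K0_def carrier_FactGroup K0_class_def by auto

lemma mult_K0: "K0_class R c \<otimes>\<^bsub>K0 R\<^esub> K0_class R d = K0_class R (c + d)"
proof (rule Set.set_eqI)
  fix x
  have "x \<in> K0_class R c \<otimes>\<^bsub>K0 R\<^esub> K0_class R d \<longleftrightarrow> (\<exists>a\<in>K0_class R c. \<exists>b\<in>K0_class R d. x = a + b)"
    by (simp add: K0_def set_mult_def)
  also have "\<dots> \<longleftrightarrow> x \<in> K0_class R (c + d)"
  proof
    assume "\<exists>a\<in>K0_class R c. \<exists>b\<in>K0_class R d. x = a + b"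
    then obtain a b where "a - c \<in> K0_relations R" "b - d \<in> K0_relations R" "x = a + b"
      by (auto simp: K0_class_mem)
    with K0_relations_add[OF this(1,2)] show "x \<in> K0_class R (c + d)"
      by (simp add: K0_class_mem algebra_simps)
  next
    assume "x \<in> K0_class R (c + d)"
    then have "x - d \<in> K0_class R c" "d \<in> K0_class R d" "x = (x - d) + d"
      by (simp_all add: K0_class_mem K0_relations_zero algebra_simps)
    then show "\<exists>a\<in>K0_class R c. \<exists>b\<in>K0_class R d. x = a + b" by blast
  qed
  finally show "x \<in> K0_class R c \<otimes>\<^bsub>K0 R\<^esub> K0_class R d \<longleftrightarrow> x \<in> K0_class R (c + d)" .
qed

text \<open>As 0 is isomorphic to its double, the relation reads [0] - 2 [0] = - [0].\<close>

lemma K0_relations_trivial_module: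
  assumes M: "M \<in> fgp_modules R" and c: "carrier M = {\<zero>\<^bsub>M\<^esub>}"
  shows "frag_of M \<in> K0_relations R"
proof -
  interpret M: module R M using M by (simp add: fgp_modules_def)
  have "module_iso R M (direct_sum M M)"
    by (rule module_isoI[where f = "\<lambda>x. (x, x)" and g = fst]) (auto simp: semilinear_maps_def c)
  from K0_relations_uminus[OF K0_relations_sum[OF M M M this]] show ?thesis by simp
qed

context cring
begin

abbreviation zmod :: "('a, nat \<Rightarrow> 'a) module" where "zmod \<equiv> fixmod R 0 (\<lambda>_ _. \<zero>)"

lemma zmod: "zmod \<in> fgp_modules R" "carrier zmod = {\<zero>\<^bsub>zmod\<^esub>}"
  by (rule fixmod_fgp) (auto simp: idem_mat_def is_mat_def fixmod_simps vecs_def matvec_def)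

lemma iso_add_zmod:
  assumes "module R N" "module_iso R M N"
  shows "module_iso R M (direct_sum N zmod)"
proof -
  obtain f where f: "f \<in> linear_maps R M N" "bij_betw f (carrier M) (carrier N)"
    using assms(2) by (auto simp: module_iso_def)
  have z: "module R zmod" using zmod(1) by (simp add: fgp_modules_def)
  interpret z: module R zmod by (rule z)
  show ?thesis
  proof (rule module_isoI[where f = "\<lambda>x. (f x, \<zero>\<^bsub>zmod\<^esub>)" and g = "\<lambda>y. inv_into (carrier M) f (fst y)"])
    show "(\<lambda>x. (f x, \<zero>\<^bsub>zmod\<^esub>)) \<in> linear_maps R M (direct_sum N zmod)"
      using f(1) z.smult_r_null z.M.zero_closed z.M.l_zero by (auto simp: semilinear_maps_def)
    show "inv_into (carrier M) f (fst y) \<in> carrier M" if "y \<in> carrier (direct_sum N zmod)" for y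
      using that f(2) by (auto simp: bij_betw_def intro: inv_into_into)
    show "(f (inv_into (carrier M) f (fst y)), \<zero>\<^bsub>zmod\<^esub>) = y" if "y \<in> carrier (direct_sum N zmod)" for y
      using that bij_betw_inv_into_right[OF f(2)] zmod(2) by auto
  qed (simp add: bij_betw_inv_into_left[OF f(2)])
qed

lemma K0_relations_iso:
  assumes M: "M \<in> fgp_modules R" and N: "N \<in> fgp_modules R" and iso: "module_iso R M N"
  shows "frag_of M - frag_of N \<in> K0_relations R"
proof -
  have "frag_of M - (frag_of N + frag_of zmod) \<in> K0_relations R"
    by (rule K0_relations_sum[OF M N zmod(1) iso_add_zmod[OF _ iso]]) (use N in \<open>simp add: fgp_modules_def\<close>)
  from K0_relations_add[OF this K0_relations_trivial_module[OF zmod]] show ?thesis by simp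
qed

end

section \<open>The map on K_0 induced by extension of scalars\<close>

locale two_crings =
  fixes R :: "('a, 'r) ring_scheme" and S :: "('b, 's) ring_scheme" and \<phi> :: "'a \<Rightarrow> 'b"
  assumes R: "cring R" and S: "cring S" and \<phi>: "\<phi> \<in> ring_hom R S"
begin

lemma \<phi>_fun: "\<phi> \<in> carrier R \<rightarrow> carrier S"
  using \<phi> by (auto simp: ring_hom_def)

lemma scalar_extension_exists:
  assumes "M \<in> fgp_modules R"
  shows "\<exists>N. N \<in> fgp_modules S \<and> (\<exists>\<iota>. scalar_extension R S \<phi> M N \<iota>)"
proof -
  obtain n e f where e: "idem_mat R n e" and f: "f \<in> linear_maps R M (fixmod R n e)"
    "bij_betw f (carrier M) (carrier (fixmod R n e))"
    using cring.fgp_iso_fixmod[OF R assms] by blast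
  have M: "module R M" using assms by (simp add: fgp_modules_def)
  note se = scalar_extension_fixmod[OF R S \<phi> e M f]
  show ?thesis using cring.fixmod_fgp[OF S se(1)] se(2) by blast
qed

abbreviation E where "E \<equiv> extend_scalars R S \<phi>"

lemma extend_scalars:
  assumes "M \<in> fgp_modules R"
  shows "E M \<in> fgp_modules S" "\<exists>\<iota>. scalar_extension R S \<phi> M (E M) \<iota>"
  using someI_ex[OF scalar_extension_exists[OF assms]] by (simp_all add: extend_scalars_def)

lemma scalar_extension_relation:
  assumes M: "M \<in> fgp_modules R" "M1 \<in> fgp_modules R" "M2 \<in> fgp_modules R"
    and N: "N \<in> fgp_modules S" "N1 \<in> fgp_modules S" "N2 \<in> fgp_modules S"
    and se: "scalar_extension R S \<phi> M N \<iota>" "scalar_extension R S \<phi> M1 N1 \<iota>1" "scalar_extension R S \<phi> M2 N2 \<iota>2"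
    and iso: "module_iso R M (direct_sum M1 M2)"
  shows "frag_of N - (frag_of N1 + frag_of N2) \<in> K0_relations S"
  by (rule K0_relations_sum[OF N scalar_extension_direct_sum[OF _ _ _ \<phi>_fun se iso]])
    (use M in \<open>auto simp: fgp_modules_def\<close>)

text \<open>Applying the direct sum relation to \<open>M \<cong> M' \<oplus> 0\<close> and \<open>0 \<cong> 0 \<oplus> 0\<close>.\<close>

lemma scalar_extension_iso_relation:
  assumes M: "M \<in> fgp_modules R" "M' \<in> fgp_modules R" and N: "N \<in> fgp_modules S" "N' \<in> fgp_modules S"
    and se: "scalar_extension R S \<phi> M N \<iota>" "scalar_extension R S \<phi> M' N' \<iota>'"
    and iso: "module_iso R M M'"
  shows "frag_of N - frag_of N' \<in> K0_relations S"
proof -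
  interpret R: cring R by (rule R)
  have mods: "module R M'" "module R R.zmod" using M(2) R.zmod(1) by (auto simp: fgp_modules_def)
  obtain \<kappa> where z: "scalar_extension R S \<phi> R.zmod (E R.zmod) \<kappa>" using extend_scalars(2)[OF R.zmod(1)] by blast
  note Ez = extend_scalars(1)[OF R.zmod(1)]
  have "module_iso R R.zmod R.zmod" by (rule module_isoI[OF id_linear, where g = "\<lambda>x. x"]) auto
  from scalar_extension_relation[OF R.zmod(1) R.zmod(1) R.zmod(1) Ez Ez Ez z z z R.iso_add_zmod[OF mods(2) this]]
  have 1: "- frag_of (E R.zmod) \<in> K0_relations S" by simp
  have 2: "frag_of N - (frag_of N' + frag_of (E R.zmod)) \<in> K0_relations S"
    by (rule scalar_extension_relation[OF M R.zmod(1) N Ez se z R.iso_add_zmod[OF mods(1) iso]])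
  show ?thesis using K0_relations_diff[OF 2 1] by simp
qed

abbreviation F where "F \<equiv> frag_extend (\<lambda>M. frag_of (extend_scalars R S \<phi> M))"

lemma F_relations: "c \<in> K0_relations R \<Longrightarrow> F c \<in> K0_relations S"
proof (rule K0_relations_extend)
  fix P P1 P2
  assume P: "P \<in> fgp_modules R" "P1 \<in> fgp_modules R" "P2 \<in> fgp_modules R" "module_iso R P (direct_sum P1 P2)"
  from extend_scalars(2)[OF P(1)] extend_scalars(2)[OF P(2)] extend_scalars(2)[OF P(3)]
  obtain \<iota> \<iota>1 \<iota>2 where "scalar_extension R S \<phi> P (E P) \<iota>" "scalar_extension R S \<phi> P1 (E P1) \<iota>1"
    "scalar_extension R S \<phi> P2 (E P2) \<iota>2" by blast
  then show "frag_of (E P) - (frag_of (E P1) + frag_of (E P2)) \<in> K0_relations S"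
    by (rule scalar_extension_relation[OF P(1-3) extend_scalars(1)[OF P(1)] extend_scalars(1)[OF P(2)]
          extend_scalars(1)[OF P(3)] _ _ _ P(4)])
qed

lemma F_keys: "Poly_Mapping.keys c \<subseteq> fgp_modules R \<Longrightarrow> Poly_Mapping.keys (F c) \<subseteq> fgp_modules S"
  using keys_frag_extend[of "\<lambda>M. frag_of (E M)" c] extend_scalars(1) by (fastforce simp: keys_frag_of)

lemma F_fixmod:
  assumes "idem_mat R n e"
  shows "F (frag_of (fixmod R n e)) - frag_of (fixmod S n (\<lambda>i j. \<phi> (e i j))) \<in> K0_relations S"
    and "idem_mat S n (\<lambda>i j. \<phi> (e i j))"
proof -
  interpret R: cring R by (rule R)
  let ?M = "fixmod R n e"
  have M: "?M \<in> fgp_modules R" by (rule R.fixmod_fgp[OF assms])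
  then have mod: "module R ?M" by (simp add: fgp_modules_def)
  note se = scalar_extension_fixmod[OF R S \<phi> assms mod id_linear bij_betw_id[unfolded id_def]]
  show "idem_mat S n (\<lambda>i j. \<phi> (e i j))" by (rule se(1))
  obtain \<iota> where \<iota>: "scalar_extension R S \<phi> ?M (E ?M) \<iota>" using extend_scalars(2)[OF M] by blast
  have iso: "module_iso R ?M ?M" by (rule module_isoI[OF id_linear, where g = "\<lambda>x. x"]) auto
  show "F (frag_of ?M) - frag_of (fixmod S n (\<lambda>i j. \<phi> (e i j))) \<in> K0_relations S"
    using scalar_extension_iso_relation[OF M M extend_scalars(1)[OF M] cring.fixmod_fgp[OF S se(1)] \<iota> se(2) iso]
    by simp
qed

lemma K0_map_class: "K0_map R S \<phi> (K0_class R c) = K0_class S (F c)"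
proof -
  have "K0_relations S #>\<^bsub>free_Abelian_group (fgp_modules S)\<^esub> F d = K0_class S (F c)" if "d \<in> K0_class R c" for d
  proof -
    have "F (d - c) \<in> K0_relations S" using that F_relations by (simp add: K0_class_mem)
    then show ?thesis unfolding K0_class_def[symmetric] K0_class_eq_iff by (simp add: frag_extend_diff)
  qed
  moreover have "c \<in> K0_class R c" by (simp add: K0_class_mem K0_relations_zero)
  ultimately show ?thesis unfolding K0_map_def by blast
qed

lemma K0_map_hom: "K0_map R S \<phi> \<in> hom (K0 R) (K0 S)"
proof (rule homI)
  fix x assume "x \<in> carrier (K0 R)"
  then show "K0_map R S \<phi> x \<in> carrier (K0 S)" using F_keys by (auto simp: carrier_K0 K0_map_class)
next
  fix x y assume "x \<in> carrier (K0 R)" "y \<in> carrier (K0 R)"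
  then show "K0_map R S \<phi> (x \<otimes>\<^bsub>K0 R\<^esub> y) = K0_map R S \<phi> x \<otimes>\<^bsub>K0 S\<^esub> K0_map R S \<phi> y"
    by (auto simp: carrier_K0 K0_map_class mult_K0 frag_extend_add)
qed

end

text \<open>A retraction of \<open>\<phi>\<close> induces a retraction of the map on \<open>K\<^sub>0\<close>.\<close>

lemma (in two_crings) K0_map_inj:
  assumes \<pi>: "\<pi> \<in> ring_hom S R" and \<pi>\<phi>: "\<And>a. a \<in> carrier R \<Longrightarrow> \<pi> (\<phi> a) = a"
  shows "inj_on (K0_map R S \<phi>) (carrier (K0 R))"
proof -
  interpret R: cring R by (rule R)
  interpret Q: two_crings S R \<pi> by (intro two_crings.intro R S \<pi>)
  \<comment> \<open>It suffices to treat images of idempotent matrices; there both extensions act on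
    the entries, which \<open>\<pi>\<close> after \<open>\<phi>\<close> leaves unchanged.\<close>
  have key: "Q.F (F c) - c \<in> K0_relations R" if "Poly_Mapping.keys c \<subseteq> fgp_modules R" for c
    using that
  proof (induction c rule: frag_induction)
    case zero
    then show ?case by (simp add: K0_relations_zero)
  next
    case (one M)
    obtain n e f where e: "idem_mat R n e" and f: "f \<in> linear_maps R M (fixmod R n e)"
      "bij_betw f (carrier M) (carrier (fixmod R n e))"
      using R.fgp_iso_fixmod[OF one] by blast
    let ?M' = "fixmod R n e" and ?N = "fixmod S n (\<lambda>i j. \<phi> (e i j))"
    have iso: "module_iso R M ?M'" using f by (auto simp: module_iso_def)
    have M: "module R M" using one by (simp add: fgp_modules_def)
    note se = scalar_extension_fixmod[OF R S \<phi> e M f]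
    obtain \<iota> where \<iota>: "scalar_extension R S \<phi> M (E M) \<iota>" using extend_scalars(2)[OF one] by blast
    have "module_iso R M M" by (rule module_isoI[OF id_linear, where g = "\<lambda>x. x"]) auto
    from scalar_extension_iso_relation[OF one one extend_scalars(1)[OF one] cring.fixmod_fgp[OF S se(1)] \<iota> se(2) this]
    have "frag_of (E M) - frag_of ?N \<in> K0_relations S" .
    from Q.F_relations[OF this] have 1: "Q.F (frag_of (E M)) - Q.F (frag_of ?N) \<in> K0_relations R"
      by (simp only: frag_extend_diff)
    have "fixmod R n (\<lambda>i j. \<pi> (\<phi> (e i j))) = ?M'"
      using e by (intro R.fixmod_cong) (auto simp: idem_mat_def is_mat_def \<pi>\<phi>)
    with Q.F_fixmod(1)[OF se(1)] have 2: "Q.F (frag_of ?N) - frag_of ?M' \<in> K0_relations R" by simp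
    have 3: "frag_of M - frag_of ?M' \<in> K0_relations R"
      by (rule R.K0_relations_iso[OF one R.fixmod_fgp[OF e] iso])
    from K0_relations_diff[OF K0_relations_add[OF 1 2] 3] show ?case by simp
  next
    case (diff a b)
    then show ?case using K0_relations_diff[OF diff]
      by (simp add: frag_extend_diff algebra_simps)
  qed
  show ?thesis
  proof (rule inj_onI)
    fix x y assume xy: "x \<in> carrier (K0 R)" "y \<in> carrier (K0 R)" "K0_map R S \<phi> x = K0_map R S \<phi> y"
    then obtain c d where c: "x = K0_class R c" "Poly_Mapping.keys c \<subseteq> fgp_modules R"
      and d: "y = K0_class R d" "Poly_Mapping.keys d \<subseteq> fgp_modules R" by (auto simp: carrier_K0)
    have "F c - F d \<in> K0_relations S" using xy(3) by (simp add: c d K0_map_class K0_class_eq_iff)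
    from Q.F_relations[OF this] have 1: "Q.F (F c) - Q.F (F d) \<in> K0_relations R" by (simp add: frag_extend_diff)
    from K0_relations_add[OF K0_relations_diff[OF 1 key[OF c(2)]] key[OF d(2)]]
    have "c - d \<in> K0_relations R" using K0_relations_uminus by fastforce
    then show "x = y" by (simp add: c d K0_class_eq_iff)
  qed
qed

text \<open>Surjectivity is only asked on images of idempotent matrices, since every generator of
  K_0 is isomorphic to one of them.\<close>

lemma (in two_crings) K0_map_iso:
  assumes \<pi>: "\<pi> \<in> ring_hom S R" "\<And>a. a \<in> carrier R \<Longrightarrow> \<pi> (\<phi> a) = a"
    and surj: "\<And>n e. idem_mat S n e \<Longrightarrow>
      \<exists>c. Poly_Mapping.keys c \<subseteq> fgp_modules R \<and> frag_of (fixmod S n e) - F c \<in> K0_relations S"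
  shows "K0_map R S \<phi> \<in> iso (K0 R) (K0 S)"
proof -
  interpret S: cring S by (rule S)
  have lift: "\<exists>c. Poly_Mapping.keys c \<subseteq> fgp_modules R \<and> d - F c \<in> K0_relations S"
    if "Poly_Mapping.keys d \<subseteq> fgp_modules S" for d
    using that
  proof (induction d rule: frag_induction)
    case zero
    then show ?case by (intro exI[of _ 0]) (simp add: K0_relations_zero)
  next
    case (one M)
    obtain n e f where e: "idem_mat S n e" and f: "f \<in> linear_maps S M (fixmod S n e)"
      "bij_betw f (carrier M) (carrier (fixmod S n e))"
      using S.fgp_iso_fixmod[OF one] by blast
    have iso: "module_iso S M (fixmod S n e)" using f by (auto simp: module_iso_def)
    obtain c where c: "Poly_Mapping.keys c \<subseteq> fgp_modules R" "frag_of (fixmod S n e) - F c \<in> K0_relations S"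
      using surj[OF e] by blast
    from K0_relations_add[OF S.K0_relations_iso[OF one S.fixmod_fgp[OF e] iso] c(2)] c(1)
    show ?case by auto
  next
    case (diff a b)
    then obtain c d where "Poly_Mapping.keys c \<subseteq> fgp_modules R" "a - F c \<in> K0_relations S"
      "Poly_Mapping.keys d \<subseteq> fgp_modules R" "b - F d \<in> K0_relations S" by blast
    with K0_relations_diff[OF this(2,4)] show ?case
      by (intro exI[of _ "c - d"]) (use keys_diff[of c d] in \<open>auto simp: frag_extend_diff algebra_simps\<close>)
  qed
  have "K0_map R S \<phi> ` carrier (K0 R) = carrier (K0 S)"
  proof
    show "K0_map R S \<phi> ` carrier (K0 R) \<subseteq> carrier (K0 S)"
      using K0_map_hom by (auto simp: hom_def)
    show "carrier (K0 S) \<subseteq> K0_map R S \<phi> ` carrier (K0 R)"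
    proof
      fix x assume "x \<in> carrier (K0 S)"
      then obtain d where d: "x = K0_class S d" "Poly_Mapping.keys d \<subseteq> fgp_modules S" by (auto simp: carrier_K0)
      from lift[OF d(2)] obtain c where c: "Poly_Mapping.keys c \<subseteq> fgp_modules R" "d - F c \<in> K0_relations S" by blast
      then have "x = K0_map R S \<phi> (K0_class R c)" by (simp add: d K0_map_class K0_class_eq_iff)
      then show "x \<in> K0_map R S \<phi> ` carrier (K0 R)" using c(1) by (auto simp: carrier_K0)
    qed
  qed
  then show ?thesis using K0_map_hom K0_map_inj[OF \<pi>] by (simp add: iso_def bij_betw_def)
qed

section \<open>Presentations by type class rings\<close>

text \<open>Used to pass from the polynomials with coefficients in the kernel of a presentation to
  the kernel of \<open>poly_map\<close>, which also contains the variables from \<open>m\<close>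
  on.\<close>

lemma finite_free_res_mono:
  assumes I: "cr_ideal I" and J: "cr_ideal J" and sub: "I \<subseteq> J"
    and "cr_ideal.finite_free_res I n e"
  shows "cr_ideal.finite_free_res J n e"
proof -
  interpret I: cr_ideal I by fact
  interpret J: cr_ideal J by fact
  have meq: "J.meq r c A B" if "I.meq r c A B" for r c A B
    using that sub by (auto simp: I.meq_def J.meq_def I.eqv_def J.eqv_def)
  show ?thesis using assms(4)
  proof (induction rule: I.finite_free_res.induct)
    case (zero n e)
    then show ?case by (intro J.finite_free_res.zero meq)
  next
    case (step n t \<phi> \<sigma> e)
    show ?case by (rule J.finite_free_res.step[OF meq[OF step(1)] meq[OF step(2)] step.IH])
  qed
qed

text \<open>In the expansion of (x + y)^(a + b) each term has a factor x^a or y^b.\<close>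

lemma (in cr_ideal) cr_ideal_radical: "cr_ideal {x. \<exists>k. x ^ k \<in> K}"
proof
  show "0 \<in> {x. \<exists>k. x ^ k \<in> K}" using zero_mem by (auto intro!: exI[of _ 1])
next
  fix x y :: 'p assume "x \<in> {x. \<exists>k. x ^ k \<in> K}"
  then show "y * x \<in> {x. \<exists>k. x ^ k \<in> K}" by (auto simp: power_mult_distrib intro: mult_mem)
next
  fix x y assume "x \<in> {x. \<exists>k. x ^ k \<in> K}" "y \<in> {x. \<exists>k. x ^ k \<in> K}"
  then obtain a b where a: "x ^ a \<in> K" and b: "y ^ b \<in> K" by blast
  have "of_nat ((a + b) choose i) * x ^ i * y ^ (a + b - i) \<in> K" for i
  proof (cases "a \<le> i")
    case True
    then have "x ^ i = x ^ (i - a) * x ^ a" by (simp flip: power_add)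
    then have "x ^ i \<in> K" using a mult_mem by simp
    then show ?thesis by (intro mult_mem_right mult_mem)
  next
    case False
    then have "y ^ (a + b - i) = y ^ (a - i) * y ^ b" by (simp flip: power_add)
    then have "y ^ (a + b - i) \<in> K" using b mult_mem by simp
    then show ?thesis by (rule mult_mem)
  qed
  then have "(x + y) ^ (a + b) \<in> K" unfolding binomial_ring by (intro sum_mem)
  then show "x + y \<in> {x. \<exists>k. x ^ k \<in> K}" by blast
qed

lemma (in cring) finsum_minus:
  assumes "finite A" "\<And>x. x \<in> A \<Longrightarrow> f x \<in> carrier R" "\<And>x. x \<in> A \<Longrightarrow> g x \<in> carrier R"
  shows "finsum R (\<lambda>x. f x \<ominus> g x) A = finsum R f A \<ominus> finsum R g A"
  using assms
proof (induction A rule: finite_induct)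
  case empty
  then show ?case by (simp add: minus_eq)
next
  case (insert x A)
  have c: "finsum R f A \<in> carrier R" "finsum R g A \<in> carrier R" "f x \<in> carrier R" "g x \<in> carrier R"
    using insert by (auto intro!: finsum_closed)
  have "finsum R (\<lambda>x. f x \<ominus> g x) (insert x A) = (f x \<ominus> g x) \<oplus> (finsum R f A \<ominus> finsum R g A)"
    using insert by (subst finsum_insert) auto
  also have "\<dots> = (f x \<oplus> finsum R f A) \<ominus> (g x \<oplus> finsum R g A)"
    using c by (simp add: minus_eq a_ac minus_add)
  also have "\<dots> = finsum R f (insert x A) \<ominus> finsum R g (insert x A)"
    using insert by (subst (1 2) finsum_insert) auto
  finally show ?case .
qed

lemma (in cring) matvec_null:
  assumes "\<And>i j. i < n \<Longrightarrow> j < k \<Longrightarrow> e i j \<otimes> v j = \<zero>"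
  shows "matvec R n k e v = (\<lambda>_. \<zero>)"
proof (rule ext)
  fix i
  have "finsum R (\<lambda>j. e i j \<otimes> v j) {..<k} = \<zero>" if "i < n"
    by (rule add.finprod_one_eqI) (use assms that in auto)
  then show "matvec R n k e v i = \<zero>" by (simp add: matvec_def)
qed

text \<open>R^t is the direct sum of the images of s p and of its complement \<open>f\<close>, and
  \<open>p\<close> maps the first isomorphically to the image of \<open>e\<close>. Explicitly, v
  goes to (p v, f v) and (x, y) goes back to s x + y.\<close>

lemma (in cring) fixmod_split:
  assumes e: "idem_mat R n e" and f: "idem_mat R t f" and p: "is_mat R n t p" and s: "is_mat R t n s"
    and ps: "\<And>i j. i < n \<Longrightarrow> j < n \<Longrightarrow> matmul R t p s i j = e i j"
    and ep: "\<And>i j. i < n \<Longrightarrow> j < t \<Longrightarrow> matmul R n e p i j = p i j"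
    and f_eq: "\<And>i j. i < t \<Longrightarrow> j < t \<Longrightarrow> f i j = idmat R i j \<ominus> matmul R n s p i j"
  shows "module_iso R (fixmod R t (idmat R)) (direct_sum (fixmod R n e) (fixmod R t f))"
proof -
  have em: "is_mat R n n e" and fm: "is_mat R t t f" using e f by (auto simp: idem_mat_def)
  have Fc: "carrier (fixmod R t (idmat R)) = vecs R t" using matvec_idmat by (auto simp: fixmod_simps)
  define P where "P v = matvec R n t p v" for v
  define Q where "Q v = matvec R t n s v" for v
  define f' where "f' v = matvec R t t f v" for v
  have Pc: "P v \<in> vecs R n" if "v \<in> vecs R t" for v unfolding P_def by (rule matvec_closed[OF p that])
  have Qc: "Q v \<in> vecs R t" if "v \<in> vecs R n" for v unfolding Q_def by (rule matvec_closed[OF s that])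
  have fc: "f' v \<in> vecs R t" if "v \<in> vecs R t" for v unfolding f'_def by (rule matvec_closed[OF fm that])
  have PQ: "P (Q v) = matvec R n n e v" if "v \<in> vecs R n" for v
    unfolding P_def Q_def matvec_matmul[OF p s that, symmetric] by (rule matvec_cong[OF ps em that])
  have eP: "matvec R n n e (P v) = P v" if "v \<in> vecs R t" for v
    unfolding P_def matvec_matmul[OF em p that, symmetric] by (rule matvec_cong[OF ep p that])
  have ff: "f' (f' v) = f' v" if "v \<in> vecs R t" for v
    unfolding f'_def matvec_matmul[OF fm fm that, symmetric]
    by (rule matvec_cong[OF _ fm that]) (use f in \<open>simp add: idem_mat_def\<close>)
  have f': "f' v = (\<lambda>i. v i \<ominus> Q (P v) i)" if v: "v \<in> vecs R t" for v
  proof (rule ext)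
    fix i
    note vc = vecs_closed[OF v]
    have sp: "is_mat R t t (matmul R n s p)" by (rule matmul_closed[OF s p])
    show "f' v i = v i \<ominus> Q (P v) i"
    proof (cases "i < t")
      case True
      have "finsum R (\<lambda>j. f i j \<otimes> v j) {..<t}
          = finsum R (\<lambda>j. idmat R i j \<otimes> v j \<ominus> matmul R n s p i j \<otimes> v j) {..<t}"
        using vc sp True by (intro finsum_cong') (auto simp: f_eq is_mat_def idmat_def l_distr l_minus minus_eq)
      also have "\<dots> = finsum R (\<lambda>j. idmat R i j \<otimes> v j) {..<t} \<ominus> finsum R (\<lambda>j. matmul R n s p i j \<otimes> v j) {..<t}"
        using vc sp True by (intro finsum_minus) (auto simp: is_mat_def idmat_def)
      also have "finsum R (\<lambda>j. idmat R i j \<otimes> v j) {..<t} = v i"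
        using fun_cong[OF matvec_idmat[OF v], of i] True by (simp add: matvec_def)
      also have "finsum R (\<lambda>j. matmul R n s p i j \<otimes> v j) {..<t} = Q (P v) i"
        using fun_cong[OF matvec_matmul[OF s p v], of i] True by (simp add: matvec_def P_def Q_def)
      finally show ?thesis using True by (simp add: f'_def matvec_def)
    next
      case False
      then have "Q (P v) i = \<zero>" "v i = \<zero>" using v by (auto simp: Q_def matvec_def vecs_def)
      then show ?thesis using False by (simp add: f'_def matvec_def minus_eq)
    qed
  qed
  have cM: "carrier (fixmod R n e) = {x \<in> vecs R n. matvec R n n e x = x}"
    "carrier (fixmod R t f) = {y \<in> vecs R t. f' y = y}" by (auto simp: fixmod_simps f'_def)
  have vadd: "(\<lambda>i. u i \<oplus> v i) \<in> vecs R l" if "u \<in> vecs R l" "v \<in> vecs R l" for u v l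
    using that by (auto simp: vecs_def)
  have fadd: "f' (\<lambda>i. u i \<oplus> v i) = (\<lambda>i. f' u i \<oplus> f' v i)" if "u \<in> vecs R t" "v \<in> vecs R t" for u v
    unfolding f'_def by (rule matvec_add[OF fm that])
  have Padd: "P (\<lambda>i. u i \<oplus> v i) = (\<lambda>i. P u i \<oplus> P v i)" if "u \<in> vecs R t" "v \<in> vecs R t" for u v
    unfolding P_def by (rule matvec_add[OF p that])
  \<comment> \<open>If f y = y then s p y = 0, so p y = e p y = p s p y = 0.\<close>
  have P0: "P y = (\<lambda>_. \<zero>)" if y: "y \<in> vecs R t" "f' y = y" for y
  proof -
    have "Q (P y) = (\<lambda>_. \<zero>)"
    proof (rule ext)
      fix i
      have "y i = y i \<ominus> Q (P y) i" using fun_cong[OF f'[OF y(1)], of i] y(2) by simp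
      then show "Q (P y) i = \<zero>"
        using vecs_closed[OF y(1)] vecs_closed[OF Qc[OF Pc[OF y(1)]]]
        by (metis a_minus_def add.inv_closed add.l_cancel_one' minus_minus minus_zero)
    qed
    then have "P (\<lambda>_. \<zero>) = P y" using PQ[OF Pc[OF y(1)]] eP[OF y(1)] by simp
    moreover have "P (\<lambda>_. \<zero>) = (\<lambda>_. \<zero>)"
      unfolding P_def by (rule matvec_null) (use p in \<open>simp add: is_mat_def\<close>)
    ultimately show ?thesis by simp
  qed
  show ?thesis
  proof (rule module_isoI[where f = "\<lambda>v. (P v, f' v)" and g = "\<lambda>z i. Q (fst z) i \<oplus> snd z i"])
    show "(\<lambda>v. (P v, f' v)) \<in> linear_maps R (fixmod R t (idmat R)) (direct_sum (fixmod R n e) (fixmod R t f))"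
      unfolding semilinear_maps_def
    proof (intro CollectI conjI ballI Pi_I)
      fix v assume "v \<in> carrier (fixmod R t (idmat R))"
      then show "(P v, f' v) \<in> carrier (direct_sum (fixmod R n e) (fixmod R t f))"
        using Pc fc eP ff by (auto simp: Fc cM)
    next
      fix u v assume "u \<in> carrier (fixmod R t (idmat R))" "v \<in> carrier (fixmod R t (idmat R))"
      then show "(P (u \<oplus>\<^bsub>fixmod R t (idmat R)\<^esub> v), f' (u \<oplus>\<^bsub>fixmod R t (idmat R)\<^esub> v))
          = (P u, f' u) \<oplus>\<^bsub>direct_sum (fixmod R n e) (fixmod R t f)\<^esub> (P v, f' v)"
        using Padd fadd by (simp add: Fc fixmod_simps(3))
    next
      fix a v assume "a \<in> carrier R" "v \<in> carrier (fixmod R t (idmat R))"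
      then show "(P (a \<odot>\<^bsub>fixmod R t (idmat R)\<^esub> v), f' (a \<odot>\<^bsub>fixmod R t (idmat R)\<^esub> v))
          = id a \<odot>\<^bsub>direct_sum (fixmod R n e) (fixmod R t f)\<^esub> (P v, f' v)"
        using matvec_smult[OF p] matvec_smult[OF fm] by (simp add: Fc fixmod_simps(4) P_def f'_def)
    qed
  next
    fix z assume "z \<in> carrier (direct_sum (fixmod R n e) (fixmod R t f))"
    then obtain x y where z: "z = (x, y)" and x: "x \<in> vecs R n" "matvec R n n e x = x"
      and y: "y \<in> vecs R t" "f' y = y" by (auto simp: cM)
    have Qx: "Q x \<in> vecs R t" by (rule Qc[OF x(1)])
    show "(\<lambda>i. Q (fst z) i \<oplus> snd z i) \<in> carrier (fixmod R t (idmat R))"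
      using vadd[OF Qx y(1)] by (simp add: Fc z)
    have "P (\<lambda>i. Q x i \<oplus> y i) = x"
      using Padd[OF Qx y(1)] PQ[OF x(1)] x(2) P0[OF y] vecs_closed[OF x(1)] by simp
    moreover have "f' (\<lambda>i. Q x i \<oplus> y i) = y"
    proof -
      have "f' (Q x) = (\<lambda>_. \<zero>)"
        using f'[OF Qx] PQ[OF x(1)] x(2) vecs_closed[OF Qx] by (simp add: minus_eq r_neg)
      then show ?thesis using fadd[OF Qx y(1)] y vecs_closed[OF y(1)] by simp
    qed
    ultimately show "(P (\<lambda>i. Q (fst z) i \<oplus> snd z i), f' (\<lambda>i. Q (fst z) i \<oplus> snd z i)) = z"
      by (simp add: z)
  next
    fix v assume "v \<in> carrier (fixmod R t (idmat R))"
    then have v: "v \<in> vecs R t" by (simp add: Fc)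
    have "Q (P v) i \<oplus> (v i \<ominus> Q (P v) i) = v i" for i
      using vecs_closed[OF v, of i] vecs_closed[OF Qc[OF Pc[OF v]], of i]
      by (simp add: minus_eq a_lcomm[of "Q (P v) i" "v i"] r_neg)
    then show "(\<lambda>i. Q (fst (P v, f' v)) i \<oplus> snd (P v, f' v) i) = v" by (simp add: f'[OF v])
  qed
qed

text \<open>A presentation of a carrier-based ring by a type of class \<^class>\<open>comm_ring_1\<close>.\<close>

locale class_hom = cring S for S :: "('b, 's) ring_scheme" (structure) +
  fixes h :: "'p::comm_ring_1 \<Rightarrow> 'b"
  assumes h_closed: "h x \<in> carrier S"
    and h_add: "h (x + y) = h x \<oplus> h y"
    and h_mult: "h (x * y) = h x \<otimes> h y"
    and h_one: "h 1 = \<one>"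
begin

lemma h_zero: "h 0 = \<zero>"
  using h_add[of 0 0] h_closed by (simp add: add.r_cancel_one')

lemma h_uminus: "h (- x) = \<ominus> h x"
  using h_add[of x "- x"] h_closed h_zero by (metis add.inv_equality add.m_comm right_minus)

lemma h_diff: "h (x - y) = h x \<ominus> h y"
  using h_add[of x "- y"] by (simp add: h_uminus minus_eq)

lemma h_eq_iff: "h x = h y \<longleftrightarrow> h (x - y) = \<zero>"
  using h_closed by (simp add: h_diff)

lemma h_sum: "finite A \<Longrightarrow> h (sum f A) = finsum S (\<lambda>i. h (f i)) A"
  by (induction A rule: finite_induct) (simp_all add: h_zero h_add h_closed Pi_iff)

lemma h_power: "h (x ^ k) = h x [^] k"
  by (induction k) (simp_all add: h_one h_mult m_comm h_closed)

definition ker :: "'p set" where "ker = {x. h x = \<zero>}"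

sublocale ker: cr_ideal ker
  by unfold_locales (auto simp: ker_def h_zero h_add h_mult h_closed)

lemma eqv_iff: "ker.eqv x y \<longleftrightarrow> h x = h y"
  unfolding ker.eqv_def h_eq_iff[of x y] by (simp add: ker_def)

lemma h_mm: "h (mm k A B i j) = matmul S k (\<lambda>i j. h (A i j)) (\<lambda>i j. h (B i j)) i j"
  by (simp add: mm_def matmul_def h_sum h_mult)

lemma h_mid: "h (mid i j) = idmat S i j"
  by (simp add: mid_def idmat_def h_one h_zero)

lemma is_mat_h: "is_mat S n k (\<lambda>i j. h (A i j))"
  by (simp add: is_mat_def h_closed)

lemma idem_mat_h: "idem_mat S n (\<lambda>i j. h (A i j)) \<longleftrightarrow> ker.meq n n (mm n A A) A"
  by (simp add: idem_mat_def is_mat_h ker.meq_def eqv_iff h_mm)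

text \<open>Each step of the resolution says [image of e] = [free module] - [kernel] in K_0. The
  predicate \<open>Q\<close> stands for membership in a subgroup containing the relations and the
  free modules.\<close>

lemma finite_free_res_class:
  assumes "ker.finite_free_res n A" "ker.meq n n (mm n A A) A"
    and rel: "\<And>c. c \<in> K0_relations S \<Longrightarrow> Q c" and diff: "\<And>a b. Q a \<Longrightarrow> Q b \<Longrightarrow> Q (a - b)"
    and free: "\<And>t. Q (frag_of (fixmod S t (idmat S)))"
  shows "Q (frag_of (fixmod S n (\<lambda>i j. h (A i j))))"
  using assms(1,2)
proof (induction rule: ker.finite_free_res.induct)
  case (zero n e)
  let ?e = "\<lambda>i j. h (e i j)"
  have e: "idem_mat S n ?e" using zero(2) by (simp only: idem_mat_h)
  have z: "h (e i j) = \<zero>" if "i < n" "j < n" for i j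
    using zero(1) that by (simp add: ker.meq_def eqv_iff h_zero)
  have M: "fixmod S n ?e \<in> fgp_modules S" by (rule fixmod_fgp[OF e])
  then interpret M: module S "fixmod S n ?e" by (simp add: fgp_modules_def)
  have "v = \<zero>\<^bsub>fixmod S n ?e\<^esub>" if "v \<in> carrier (fixmod S n ?e)" for v
  proof -
    have "v \<in> vecs S n" "v = matvec S n n ?e v" using that by (auto simp: fixmod_simps)
    moreover have "matvec S n n ?e v = (\<lambda>_. \<zero>)"
      by (rule matvec_null) (use z vecs_closed[OF \<open>v \<in> vecs S n\<close>] in simp)
    ultimately show ?thesis by (simp add: fixmod_simps(2))
  qed
  then have "carrier (fixmod S n ?e) = {\<zero>\<^bsub>fixmod S n ?e\<^esub>}"
    using M.M.zero_closed by blast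
  then show ?case by (intro rel K0_relations_trivial_module M)
next
  case (step n t \<phi> \<sigma> e)
  let ?f = "\<lambda>i j. mid i j - mm n \<sigma> \<phi> i j"
  let ?e = "\<lambda>i j. h (e i j)"
  have fi: "ker.meq t t (mm t ?f ?f) ?f" by (rule ker.kernel_idempotent[OF step(1,2)])
  have e: "idem_mat S n ?e" and f: "idem_mat S t (\<lambda>i j. h (?f i j))"
    using step.prems fi by (simp_all only: idem_mat_h)
  have i: "idem_mat S t (idmat S)"
  proof -
    have "ker.meq t t (mm t mid mid) mid" by (rule ker.meq_mid_left)
    then have "idem_mat S t (\<lambda>i j. h (mid i j))" by (simp only: idem_mat_h)
    then show ?thesis by (simp add: h_mid)
  qed
  have "module_iso S (fixmod S t (idmat S)) (direct_sum (fixmod S n ?e) (fixmod S t (\<lambda>i j. h (?f i j))))"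
  proof (rule fixmod_split[OF e f is_mat_h is_mat_h])
    show "matmul S t (\<lambda>i j. h (\<phi> i j)) (\<lambda>i j. h (\<sigma> i j)) i j = h (e i j)" if "i < n" "j < n" for i j
      using step(1) that by (simp add: ker.meq_def eqv_iff h_mm)
    show "matmul S n ?e (\<lambda>i j. h (\<phi> i j)) i j = h (\<phi> i j)" if "i < n" "j < t" for i j
      using step(2) that by (simp add: ker.meq_def eqv_iff h_mm)
    show "h (?f i j) = idmat S i j \<ominus> matmul S n (\<lambda>i j. h (\<sigma> i j)) (\<lambda>i j. h (\<phi> i j)) i j" for i j
      by (simp add: h_diff h_mid h_mm)
  qed
  note relQ = rel[OF K0_relations_sum[OF fixmod_fgp[OF i] fixmod_fgp[OF e] fixmod_fgp[OF f] this]]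
  from diff[OF diff[OF free[of t] step.IH[OF fi]] relQ]
  show ?case by (simp add: algebra_simps)
qed

end

text \<open>Brings the product into the form used in \<open>mpoly_ring\<close>.\<close>

lemma lookup_mult_submultisets:
  fixes p q :: "'t::comm_ring_1 mpoly"
  shows "Poly_Mapping.lookup (p * q) \<mu> =
    (\<Sum>\<nu>\<in>{\<nu>. \<nu> \<subseteq># \<mu>}. Poly_Mapping.lookup p \<nu> * Poly_Mapping.lookup q (\<mu> - \<nu>))"
proof -
  have fin: "finite {\<nu>. \<nu> \<subseteq># \<mu>}" by (rule cring.finite_submultisets[OF int_is_cring])
  let ?f = "\<lambda>\<nu>. if \<nu> \<subseteq># \<mu> then Poly_Mapping.lookup p \<nu> * Poly_Mapping.lookup q (\<mu> - \<nu>) else 0"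
  have "p * q = (\<Sum>\<nu>\<in>Poly_Mapping.keys p. Poly_Mapping.single \<nu> (Poly_Mapping.lookup p \<nu>) * q)"
    by (subst poly_mapping_sum_single[of "Poly_Mapping.keys p" p]) (auto simp: sum_distrib_right)
  then have "Poly_Mapping.lookup (p * q) \<mu> = sum ?f (Poly_Mapping.keys p)"
    by (simp add: lookup_sum lookup_single_mult)
  also have "\<dots> = sum ?f (Poly_Mapping.keys p \<union> {\<nu>. \<nu> \<subseteq># \<mu>})"
    by (rule sum.mono_neutral_left) (use fin in \<open>auto simp: in_keys_iff\<close>)
  also have "\<dots> = sum ?f {\<nu>. \<nu> \<subseteq># \<mu>}"
    by (rule sum.mono_neutral_right) (use fin in auto)
  finally show ?thesis by simp
qed

text \<open>The surjection from the polynomial ring \<open>\<int>[X\<^sub>a | a]\<close> that sends \<open>X\<^sub>a\<close> to \<open>a\<close>.\<close>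

context cring
begin

text \<open>All elements of the type serve as indeterminates; those outside the carrier are
  evaluated at 1, so that the map is total.\<close>

definition mon_val :: "'a multiset \<Rightarrow> 'a"
  where "mon_val \<mu> = finprod R (\<lambda>x. (if x \<in> carrier R then x else \<one>) [^] count \<mu> x) (set_mset \<mu>)"

definition int_poly_val :: "('a multiset \<Rightarrow>\<^sub>0 int) \<Rightarrow> 'a"
  where "int_poly_val p =
    finsum R (\<lambda>\<mu>. [Poly_Mapping.lookup p \<mu>] \<cdot> mon_val \<mu>) (Poly_Mapping.keys p)"

lemma mon_val_superset:
  assumes "finite A" "set_mset \<mu> \<subseteq> A"
  shows "mon_val \<mu> = finprod R (\<lambda>x. (if x \<in> carrier R then x else \<one>) [^] count \<mu> x) A"
  unfolding mon_val_def
  by (rule finprod_mono_neutral_cong_left[OF assms]) (auto simp: not_in_iff)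

lemma mon_val_closed: "mon_val \<mu> \<in> carrier R"
  unfolding mon_val_def by (rule finprod_closed) auto

lemma mon_val_add: "mon_val (\<mu> + \<nu>) = mon_val \<mu> \<otimes> mon_val \<nu>"
proof -
  let ?A = "set_mset \<mu> \<union> set_mset \<nu>"
  let ?r = "\<lambda>x. if x \<in> carrier R then x else \<one>"
  have "mon_val (\<mu> + \<nu>) = finprod R (\<lambda>x. ?r x [^] count (\<mu> + \<nu>) x) ?A"
    by (rule mon_val_superset) auto
  also have "\<dots> = finprod R (\<lambda>x. ?r x [^] count \<mu> x \<otimes> ?r x [^] count \<nu> x) ?A"
    by (rule finprod_cong') (auto simp: nat_pow_mult)
  also have "\<dots> = finprod R (\<lambda>x. ?r x [^] count \<mu> x) ?A \<otimes> finprod R (\<lambda>x. ?r x [^] count \<nu> x) ?A"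
    by (rule finprod_multf) auto
  also have "\<dots> = mon_val \<mu> \<otimes> mon_val \<nu>"
    by (simp add: mon_val_superset[of ?A])
  finally show ?thesis .
qed

lemma mon_val_empty: "mon_val {#} = \<one>"
  by (simp add: mon_val_def)

lemma mon_val_single: "a \<in> carrier R \<Longrightarrow> mon_val {#a#} = a"
  by (simp add: mon_val_def)

lemma int_poly_val_superset:
  assumes "finite A" "Poly_Mapping.keys p \<subseteq> A"
  shows "int_poly_val p = finsum R (\<lambda>\<mu>. [Poly_Mapping.lookup p \<mu>] \<cdot> mon_val \<mu>) A"
  unfolding int_poly_val_def
  by (rule add.finprod_mono_neutral_cong_left[OF assms])
    (auto simp: in_keys_iff mon_val_closed add_pow_def[of R 0] intro!: add.int_pow_closed)

lemma int_poly_val_closed: "int_poly_val p \<in> carrier R"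
  unfolding int_poly_val_def by (rule finsum_closed) (auto simp: mon_val_closed intro!: add.int_pow_closed)

lemma int_poly_val_add: "int_poly_val (p + q) = int_poly_val p \<oplus> int_poly_val q"
proof -
  let ?A = "Poly_Mapping.keys p \<union> Poly_Mapping.keys q"
  have "int_poly_val (p + q) = finsum R (\<lambda>\<mu>. [Poly_Mapping.lookup (p + q) \<mu>] \<cdot> mon_val \<mu>) ?A"
    by (rule int_poly_val_superset) (use Poly_Mapping.keys_add[of p q] in auto)
  also have "\<dots> = finsum R (\<lambda>\<mu>. [Poly_Mapping.lookup p \<mu>] \<cdot> mon_val \<mu> \<oplus> [Poly_Mapping.lookup q \<mu>] \<cdot> mon_val \<mu>) ?A"
    by (rule finsum_cong') (auto simp: lookup_add add.int_pow_mult mon_val_closed intro!: add.int_pow_closed)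
  also have "\<dots> = finsum R (\<lambda>\<mu>. [Poly_Mapping.lookup p \<mu>] \<cdot> mon_val \<mu>) ?A \<oplus>
      finsum R (\<lambda>\<mu>. [Poly_Mapping.lookup q \<mu>] \<cdot> mon_val \<mu>) ?A"
    by (rule finsum_addf) (auto simp: mon_val_closed intro!: add.int_pow_closed)
  also have "\<dots> = int_poly_val p \<oplus> int_poly_val q"
    by (simp add: int_poly_val_superset[of ?A])
  finally show ?thesis .
qed

lemma int_poly_val_single: "int_poly_val (Poly_Mapping.single \<mu> k) = [k] \<cdot> mon_val \<mu>"
  using int_poly_val_superset[of "{\<mu>}" "Poly_Mapping.single \<mu> k"] mon_val_closed[of \<mu>]
  by (simp add: add.int_pow_closed)

lemma int_poly_val_zero: "int_poly_val 0 = \<zero>"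
  by (simp add: int_poly_val_def)

lemma int_poly_val_mult: "int_poly_val (p * q) = int_poly_val p \<otimes> int_poly_val q"
proof -
  have single: "int_poly_val (Poly_Mapping.single \<mu> k * Poly_Mapping.single \<nu> l)
      = int_poly_val (Poly_Mapping.single \<mu> k) \<otimes> int_poly_val (Poly_Mapping.single \<nu> l)" for \<mu> \<nu> k l
    using mon_val_closed[of \<mu>] mon_val_closed[of \<nu>]
    by (simp add: mult_single int_poly_val_single mon_val_add add_pow_ldistr_int add_pow_rdistr_int
        add.int_pow_pow mult.commute add.int_pow_closed)
  have sum: "int_poly_val (sum f A) = finsum R (\<lambda>i. int_poly_val (f i)) A" if "finite A" for f :: "'a multiset \<Rightarrow> _" and A
    using that by (induction A rule: finite_induct)
      (simp_all add: int_poly_val_zero int_poly_val_add int_poly_val_closed Pi_iff)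
  let ?p = "\<lambda>\<mu>. Poly_Mapping.single \<mu> (Poly_Mapping.lookup p \<mu>)"
  let ?q = "\<lambda>\<nu>. Poly_Mapping.single \<nu> (Poly_Mapping.lookup q \<nu>)"
  have p: "p = sum ?p (Poly_Mapping.keys p)" and q: "q = sum ?q (Poly_Mapping.keys q)"
    by (rule poly_mapping_sum_single; simp)+
  have 1: "int_poly_val (?p \<mu> * q) = int_poly_val (?p \<mu>) \<otimes> int_poly_val q" for \<mu>
  proof -
    have "int_poly_val (?p \<mu> * q) = int_poly_val (\<Sum>\<nu>\<in>Poly_Mapping.keys q. ?p \<mu> * ?q \<nu>)"
      by (subst q) (simp add: sum_distrib_left)
    also have "\<dots> = finsum R (\<lambda>\<nu>. int_poly_val (?p \<mu>) \<otimes> int_poly_val (?q \<nu>)) (Poly_Mapping.keys q)"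
      by (simp add: sum single)
    also have "\<dots> = int_poly_val (?p \<mu>) \<otimes> finsum R (\<lambda>\<nu>. int_poly_val (?q \<nu>)) (Poly_Mapping.keys q)"
      by (rule finsum_rdistr[symmetric]) (auto simp: int_poly_val_closed)
    also have "finsum R (\<lambda>\<nu>. int_poly_val (?q \<nu>)) (Poly_Mapping.keys q) = int_poly_val q"
      by (rule trans[OF sum[OF finite_keys, symmetric] arg_cong[OF q, of int_poly_val, symmetric]])
    finally show ?thesis .
  qed
  have "int_poly_val (p * q) = int_poly_val (\<Sum>\<mu>\<in>Poly_Mapping.keys p. ?p \<mu> * q)"
    by (subst p) (simp add: sum_distrib_right)
  also have "\<dots> = finsum R (\<lambda>\<mu>. int_poly_val (?p \<mu>) \<otimes> int_poly_val q) (Poly_Mapping.keys p)"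
    by (simp add: sum 1)
  also have "\<dots> = finsum R (\<lambda>\<mu>. int_poly_val (?p \<mu>)) (Poly_Mapping.keys p) \<otimes> int_poly_val q"
    by (rule finsum_ldistr[symmetric]) (auto simp: int_poly_val_closed)
  also have "finsum R (\<lambda>\<mu>. int_poly_val (?p \<mu>)) (Poly_Mapping.keys p) = int_poly_val p"
    by (rule trans[OF sum[OF finite_keys, symmetric] arg_cong[OF p, of int_poly_val, symmetric]])
  finally show ?thesis .
qed

lemma class_hom_int_poly_val: "class_hom R int_poly_val"
proof (intro class_hom.intro class_hom_axioms.intro cring_axioms)
  have "int_poly_val (Poly_Mapping.single {#} 1) = \<one>"
    unfolding int_poly_val_single mon_val_empty by simp
  then show "int_poly_val 1 = \<one>" unfolding single_one .
qed (simp_all add: int_poly_val_closed int_poly_val_add int_poly_val_mult)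

lemma int_poly_val_surj: "a \<in> carrier R \<Longrightarrow> \<exists>p. int_poly_val p = a"
  by (rule exI[of _ "Poly_Mapping.single {#a#} 1"]) (simp add: int_poly_val_single mon_val_single)

end

section \<open>Extending a presentation to polynomial rings\<close>

context class_hom
begin

text \<open>Besides applying \<open>h\<close> to the coefficients, the variables from
  \<open>m\<close> on are evaluated at 0. This gives a homomorphism on the whole type, whose
  variables are indexed by all of \<open>nat\<close>.\<close>

definition poly_map :: "nat \<Rightarrow> 'p mpoly \<Rightarrow> nat multiset \<Rightarrow> 'b"
  where "poly_map m p = (\<lambda>\<mu>. if set_mset \<mu> \<subseteq> {..<m} then h (Poly_Mapping.lookup p \<mu>) else \<zero>)"

lemma poly_map_add: "poly_map m (p + q) = indexed_padd (poly_map m p) (poly_map m q)"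
  by (auto simp: poly_map_def indexed_padd_def lookup_add h_add fun_eq_iff)

lemma poly_map_var:
  assumes "i < m"
  shows "poly_map m (Poly_Mapping.single {#i#} 1 * p) = indexed_pmult (poly_map m p) i"
proof (rule ext)
  fix \<mu>
  have "set_mset \<mu> \<subseteq> {..<m} \<longleftrightarrow> set_mset (\<mu> - {#i#}) \<subseteq> {..<m}" if "i \<in># \<mu>"
  proof -
    have "set_mset \<mu> = insert i (set_mset (\<mu> - {#i#}))"
      using insert_DiffM[OF that] by (metis set_mset_add_mset_insert)
    then show ?thesis using assms by auto
  qed
  then show "poly_map m (Poly_Mapping.single {#i#} 1 * p) \<mu> = indexed_pmult (poly_map m p) i \<mu>"
    by (auto simp: poly_map_def indexed_pmult_def lookup_single_mult h_zero)
qed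

lemma poly_map_const: "poly_map m (Poly_Mapping.single {#} c) = indexed_const (h c)"
  by (auto simp: poly_map_def indexed_const_def lookup_single when_def h_zero fun_eq_iff)

lemma poly_map_single_closed: "poly_map m (Poly_Mapping.single \<alpha> c) \<in> indexed_pset {..<m} (carrier S)"
proof (cases "set_mset \<alpha> \<subseteq> {..<m}")
  case True
  then show ?thesis
  proof (induction \<alpha>)
    case empty
    then show ?case unfolding poly_map_const by (intro indexed_pset.indexed_const h_closed)
  next
    case (add i \<alpha>)
    have "Poly_Mapping.single (add_mset i \<alpha>) c = Poly_Mapping.single {#i#} 1 * Poly_Mapping.single \<alpha> c"
      by (simp add: mult_single)
    with add show ?case by (simp add: poly_map_var indexed_pset.indexed_pmult)
  qed
next
  case False
  then have "poly_map m (Poly_Mapping.single \<alpha> c) = indexed_const \<zero>"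
    by (auto simp: poly_map_def indexed_const_def lookup_single when_def h_zero fun_eq_iff)
  then show ?thesis by (simp add: indexed_pset.indexed_const)
qed

lemma poly_map_closed: "poly_map m p \<in> indexed_pset {..<m} (carrier S)"
proof -
  have "poly_map m (sum f A) \<in> indexed_pset {..<m} (carrier S)"
    if "finite A" "\<And>x. x \<in> A \<Longrightarrow> poly_map m (f x) \<in> indexed_pset {..<m} (carrier S)"
    for f :: "nat multiset \<Rightarrow> 'p mpoly" and A
    using that
  proof (induction A rule: finite_induct)
    case empty
    have "poly_map m (sum f {}) = poly_map m (Poly_Mapping.single {#} 0)" by simp
    then show ?case using poly_map_single_closed by metis
  next
    case (insert x A)
    then show ?case by (simp add: poly_map_add indexed_pset.indexed_padd)
  qed
  then show ?thesis
    using poly_mapping_sum_single[of "Poly_Mapping.keys p" p] poly_map_single_closed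
    by (metis finite_keys order_refl)
qed

lemma poly_map_mult: "poly_map m (p * q) = poly_map m p \<otimes>\<^bsub>mpoly_ring S {..<m}\<^esub> poly_map m q"
proof (rule ext)
  fix \<mu> :: "nat multiset"
  have fin: "finite {\<nu>. \<nu> \<subseteq># \<mu>}" by (rule finite_submultisets)
  have c: "poly_map m r \<nu> \<in> carrier S" for r \<nu> by (simp add: poly_map_def h_closed)
  show "poly_map m (p * q) \<mu> = (poly_map m p \<otimes>\<^bsub>mpoly_ring S {..<m}\<^esub> poly_map m q) \<mu>"
  proof (cases "set_mset \<mu> \<subseteq> {..<m}")
    case True
    have sub: "set_mset \<nu> \<subseteq> {..<m}" "set_mset (\<mu> - \<nu>) \<subseteq> {..<m}" if "\<nu> \<subseteq># \<mu>" for \<nu>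
      using True set_mset_mono[OF that] set_mset_mono[OF diff_subset_eq_self[of \<mu> \<nu>]] by auto
    have "poly_map m (p * q) \<mu> = finsum S (\<lambda>\<nu>. h (Poly_Mapping.lookup p \<nu>) \<otimes> h (Poly_Mapping.lookup q (\<mu> - \<nu>))) {\<nu>. \<nu> \<subseteq># \<mu>}"
      using True by (simp add: poly_map_def lookup_mult_submultisets h_sum[OF fin] h_mult)
    also have "\<dots> = finsum S (\<lambda>\<nu>. poly_map m p \<nu> \<otimes> poly_map m q (\<mu> - \<nu>)) {\<nu>. \<nu> \<subseteq># \<mu>}"
      by (rule finsum_cong') (use sub c in \<open>auto simp: poly_map_def h_closed\<close>)
    finally show ?thesis by (simp add: mpoly_ring_simps)
  next
    case False
    have "poly_map m p \<nu> \<otimes> poly_map m q (\<mu> - \<nu>) = \<zero>" if "\<nu> \<subseteq># \<mu>" for \<nu>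
    proof -
      have "\<mu> = \<nu> + (\<mu> - \<nu>)" using that by simp
      then have "set_mset \<mu> = set_mset \<nu> \<union> set_mset (\<mu> - \<nu>)" by (metis set_mset_union)
      then have "\<not> set_mset \<nu> \<subseteq> {..<m} \<or> \<not> set_mset (\<mu> - \<nu>) \<subseteq> {..<m}" using False by auto
      then show ?thesis using c by (auto simp: poly_map_def h_closed)
    qed
    then have "finsum S (\<lambda>\<nu>. poly_map m p \<nu> \<otimes> poly_map m q (\<mu> - \<nu>)) {\<nu>. \<nu> \<subseteq># \<mu>} = \<zero>"
      by (intro add.finprod_one_eqI) auto
    moreover have "poly_map m (p * q) \<mu> = \<zero>" using False by (simp add: poly_map_def)
    ultimately show ?thesis by (simp add: mpoly_ring_simps)
  qed
qed

lemma class_hom_poly_map: "class_hom (mpoly_ring S {..<m}) (poly_map m)"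
proof (intro class_hom.intro class_hom_axioms.intro cring_mpoly_ring)
  show "poly_map m x \<in> carrier (mpoly_ring S {..<m})" for x
    by (simp add: mpoly_ring_simps poly_map_closed)
  show "poly_map m (x + y) = poly_map m x \<oplus>\<^bsub>mpoly_ring S {..<m}\<^esub> poly_map m y" for x y
    by (simp add: mpoly_ring_simps poly_map_add)
  have "poly_map m (Poly_Mapping.single {#} 1) = \<one>\<^bsub>mpoly_ring S {..<m}\<^esub>"
    unfolding poly_map_const by (simp add: mpoly_ring_simps h_one)
  then show "poly_map m 1 = \<one>\<^bsub>mpoly_ring S {..<m}\<^esub>" unfolding single_one .
qed (rule poly_map_mult)

lemma poly_map_surj:
  assumes surj: "\<And>a. a \<in> carrier S \<Longrightarrow> \<exists>x. h x = a"
    and q: "q \<in> carrier (mpoly_ring S {..<m})"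
  shows "\<exists>p\<in>vars_lt m. poly_map m p = q"
proof -
  have "q \<in> indexed_pset {..<m} (carrier S)" using q by (simp add: mpoly_ring_simps)
  then show ?thesis
  proof induction
    case (indexed_const k)
    then obtain c where "h c = k" using surj by blast
    then show ?case
      by (intro bexI[of _ "Poly_Mapping.single {#} c"]) (simp_all add: poly_map_const vars_lt_single)
  next
    case (indexed_padd P Q)
    then obtain p q where "p \<in> vars_lt m" "q \<in> vars_lt m" "poly_map m p = P" "poly_map m q = Q" by blast
    then show ?case by (intro bexI[of _ "p + q"]) (simp_all add: poly_map_add vars_lt_add)
  next
    case (indexed_pmult P i)
    then obtain p where "p \<in> vars_lt m" "poly_map m p = P" by blast
    with indexed_pmult(2) show ?case
      by (intro bexI[of _ "Poly_Mapping.single {#i#} 1 * p"])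
        (simp_all add: poly_map_var vars_lt_mult vars_lt_single)
  qed
qed

lemma poly_map_zero_iff:
  assumes "p \<in> vars_lt m"
  shows "poly_map m p = \<zero>\<^bsub>mpoly_ring S {..<m}\<^esub> \<longleftrightarrow> p \<in> coeffs_in ker"
proof -
  have "Poly_Mapping.lookup p \<mu> = 0" if "\<not> set_mset \<mu> \<subseteq> {..<m}" for \<mu>
    using assms that by (auto simp: vars_lt_def in_keys_iff)
  then have "poly_map m p \<mu> = h (Poly_Mapping.lookup p \<mu>)" for \<mu>
    by (cases "set_mset \<mu> \<subseteq> {..<m}") (simp_all add: poly_map_def h_zero)
  then have "p \<in> coeffs_in ker \<longleftrightarrow> (\<forall>\<mu>. poly_map m p \<mu> = \<zero>)"
    by (simp add: coeffs_in_def ker_def)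
  then show ?thesis by (auto simp: mpoly_ring_simps indexed_zero_def fun_eq_iff)
qed

end

section \<open>Valuation rings\<close>

context valuation_ring
begin

text \<open>The preimage of the nilradical of \<open>R\<close> under the presentation, so that the
  quotient by it is V.\<close>

definition nil_preimage :: "('a multiset \<Rightarrow>\<^sub>0 int) set"
  where "nil_preimage = {x. \<exists>k::nat. int_poly_val x [^] k = \<zero>}"

lemma principal_total':
  assumes "x \<in> carrier R" "y \<in> carrier R"
  shows "(\<exists>z\<in>carrier R. x = z \<otimes> y) \<or> (\<exists>z\<in>carrier R. y = z \<otimes> x)"
  using principal_total[OF assms] by (auto simp: cgenideal_def)

lemma nilpotent_mult:
  fixes k :: nat
  assumes "x \<in> carrier R" "z \<in> carrier R" "x [^] k = \<zero>"
  shows "(z \<otimes> x) [^] k = \<zero>"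
  using assms by (simp add: nat_pow_distrib)

text \<open>Why the nilradical is prime: one of two factors divides the other, and if x = z y then
  x^2 = z (x y) is nilpotent with the product.\<close>

lemma nilpotent_mult_cancel:
  fixes k :: nat
  assumes c: "x \<in> carrier R" "y \<in> carrier R" "z \<in> carrier R" and "x = z \<otimes> y" "(x \<otimes> y) [^] k = \<zero>"
  shows "\<exists>l::nat. x [^] l = \<zero>"
proof -
  have "x [^] (2 * k) = (x \<otimes> x) [^] k"
    using c(1) by (simp add: nat_pow_distrib nat_pow_mult mult_2)
  also have "x \<otimes> x = z \<otimes> (x \<otimes> y)" using c assms(4) by (simp add: m_ac)
  also have "(z \<otimes> (x \<otimes> y)) [^] k = \<zero>" using c by (intro nilpotent_mult[OF _ _ assms(5)]) auto
  finally show ?thesis by blast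
qed

sublocale val: class_hom R int_poly_val by (rule class_hom_int_poly_val)

lemma chain_prime_nil_preimage:
  assumes "\<one> \<noteq> \<zero>"
  shows "chain_prime nil_preimage"
proof -
  have total: "(\<exists>z. int_poly_val x = int_poly_val z \<otimes> int_poly_val y) \<or>
      (\<exists>z. int_poly_val y = int_poly_val z \<otimes> int_poly_val x)" for x y
    using principal_total'[OF val.h_closed[of x] val.h_closed[of y]] int_poly_val_surj by metis
  have mult: "y * x \<in> nil_preimage" if "x \<in> nil_preimage" for x y
  proof -
    from that obtain k :: nat where "int_poly_val x [^] k = \<zero>" by (auto simp: nil_preimage_def)
    then have "int_poly_val (y * x) [^] k = \<zero>"
      unfolding val.h_mult by (rule nilpotent_mult[OF val.h_closed val.h_closed])
    then show ?thesis unfolding nil_preimage_def by blast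
  qed
  have *: "x + y \<in> nil_preimage" if "y \<in> nil_preimage" "int_poly_val x = int_poly_val z \<otimes> int_poly_val y" for x y z
  proof -
    have "int_poly_val (x + y) = int_poly_val ((z + 1) * y)"
      using that(2) by (simp add: val.h_add val.h_mult val.h_one val.h_closed l_distr)
    then show ?thesis using mult[OF that(1), of "z + 1"] by (simp add: nil_preimage_def)
  qed
  show ?thesis
  proof unfold_locales
    have "int_poly_val 0 [^] (1::nat) = \<zero>" by (simp add: val.h_zero)
    then show "0 \<in> nil_preimage" unfolding nil_preimage_def by blast
  next
    fix x y assume xy: "x \<in> nil_preimage" "y \<in> nil_preimage"
    show "x + y \<in> nil_preimage"
      using total[of x y] *[OF xy(2), of x] *[OF xy(1), of y] by (auto simp: add.commute)
  next
    fix x y :: "'a multiset \<Rightarrow>\<^sub>0 int" assume "x \<in> nil_preimage"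
    then show "y * x \<in> nil_preimage" by (rule mult)
  next
    fix x y assume "x * y \<in> nil_preimage"
    then obtain k :: nat where k: "(int_poly_val x \<otimes> int_poly_val y) [^] k = \<zero>"
      by (auto simp: nil_preimage_def val.h_mult)
    note c = val.h_closed[of x] val.h_closed[of y] val.h_closed
    have k': "(int_poly_val y \<otimes> int_poly_val x) [^] k = \<zero>" using k c by (simp add: m_comm)
    from total[of x y] show "x \<in> nil_preimage \<or> y \<in> nil_preimage"
    proof
      assume "\<exists>z. int_poly_val x = int_poly_val z \<otimes> int_poly_val y"
      then show ?thesis using nilpotent_mult_cancel[OF c(1,2) c(3) _ k] by (auto simp: nil_preimage_def)
    next
      assume "\<exists>z. int_poly_val y = int_poly_val z \<otimes> int_poly_val x"
      then show ?thesis using nilpotent_mult_cancel[OF c(2,1) c(3) _ k'] by (auto simp: nil_preimage_def)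
    qed
  next
    show "1 \<notin> nil_preimage" using assms by (auto simp: nil_preimage_def val.h_one)
  next
    fix x y :: "'a multiset \<Rightarrow>\<^sub>0 int"
    have nil: "a - z * b \<in> nil_preimage" if "int_poly_val a = int_poly_val z \<otimes> int_poly_val b" for a b z
    proof -
      have "int_poly_val (a - z * b) [^] (1::nat) = \<zero>"
        using that val.h_closed by (simp add: val.h_diff val.h_mult minus_eq r_neg)
      then show ?thesis unfolding nil_preimage_def by blast
    qed
    show "\<exists>z. x - z * y \<in> nil_preimage \<or> y - z * x \<in> nil_preimage"
      using total[of x y] nil by blast
  qed
qed

text \<open>A monomial with nilpotent coefficient is nilpotent, and a polynomial is a finite sum of
  monomials, so the radical being an ideal suffices.\<close>

lemma nil_preimage_nil:
  assumes "x \<in> coeffs_in nil_preimage"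
  shows "\<exists>k. x ^ k \<in> coeffs_in val.ker"
proof -
  interpret I: cr_ideal "coeffs_in val.ker" by (rule val.ker.cr_ideal_coeffs_in)
  interpret N: cr_ideal "{x. \<exists>k. x ^ k \<in> coeffs_in val.ker}" by (rule I.cr_ideal_radical)
  have "Poly_Mapping.single \<alpha> c \<in> {x. \<exists>k. x ^ k \<in> coeffs_in val.ker}" if "c \<in> nil_preimage" for \<alpha> :: "nat multiset" and c
  proof -
    from that obtain k :: nat where "int_poly_val c [^] k = \<zero>" by (auto simp: nil_preimage_def)
    then have "c ^ k \<in> val.ker" by (simp add: val.ker_def val.h_power)
    moreover have "Poly_Mapping.single ({#} :: nat multiset) c ^ k = Poly_Mapping.single {#} (c ^ k)"
      by (induction k) (simp_all add: mult_single)
    ultimately have "Poly_Mapping.single ({#} :: nat multiset) c ^ k \<in> coeffs_in val.ker"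
      by (simp add: coeffs_in_def lookup_single when_def val.ker.zero_mem)
    then have "Poly_Mapping.single \<alpha> 1 * Poly_Mapping.single {#} c \<in> {x. \<exists>k. x ^ k \<in> coeffs_in val.ker}"
      by (intro N.mult_mem) blast
    then show ?thesis by (simp add: mult_single)
  qed
  then have "(\<Sum>\<alpha>\<in>Poly_Mapping.keys x. Poly_Mapping.single \<alpha> (Poly_Mapping.lookup x \<alpha>)) \<in> {x. \<exists>k. x ^ k \<in> coeffs_in val.ker}"
    using assms by (intro N.sum_mem) (simp add: coeffs_in_def)
  then show ?thesis using poly_mapping_sum_single[of "Poly_Mapping.keys x" x] by simp
qed

theorem K0_regular_valuation_ring: "K0_regular R"
  unfolding K0_regular_def
proof (intro allI impI)
  fix m :: nat
  let ?S = "mpoly_ring R {..<m}"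
  interpret S: cring ?S by (rule cring_mpoly_ring)
  interpret T: two_crings R ?S "indexed_const :: 'a \<Rightarrow> nat multiset \<Rightarrow> 'a"
    by (intro two_crings.intro cring_axioms cring_mpoly_ring indexed_const_ring_hom)
  interpret H: class_hom ?S "val.poly_map m" by (rule val.class_hom_poly_map)
  show "K0_map R ?S indexed_const \<in> iso (K0 R) (K0 ?S)"
  proof (rule T.K0_map_iso)
    \<comment> \<open>The constant coefficient, that is, evaluation at the origin.\<close>
    show "(\<lambda>p. p {#}) \<in> ring_hom ?S R"
      by (rule ring_hom_memI)
        (auto simp: mpoly_ring_simps(2-5) indexed_padd_def indexed_const_def mpoly_coeff_closed)
    show "indexed_const a {#} = a" for a by (simp add: indexed_const_def)
  next
    fix n and e :: "nat \<Rightarrow> nat \<Rightarrow> nat multiset \<Rightarrow> 'a" assume e: "idem_mat ?S n e"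
    have "\<exists>p\<in>vars_lt m. i < n \<and> j < n \<longrightarrow> val.poly_map m p = e i j" for i j
      using val.poly_map_surj[OF int_poly_val_surj, of "e i j" m] e vars_lt_zero
      by (cases "i < n \<and> j < n") (auto simp: idem_mat_def is_mat_def)
    then obtain A where A: "\<And>i j. A i j \<in> vars_lt m" "\<And>i j. i < n \<Longrightarrow> j < n \<Longrightarrow> val.poly_map m (A i j) = e i j"
      by metis
    have fix_eq: "fixmod ?S n (\<lambda>i j. val.poly_map m (A i j)) = fixmod ?S n e"
      by (rule S.fixmod_cong) (use A(2) e in \<open>auto simp: idem_mat_def\<close>)
    have idem: "H.ker.meq n n (mm n A A) A"
    proof -
      have "matmul ?S n (\<lambda>i j. val.poly_map m (A i j)) (\<lambda>i j. val.poly_map m (A i j)) i j = matmul ?S n e e i j"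
        if "i < n" "j < n" for i j
        unfolding matmul_def
        by (rule S.finsum_cong') (use A(2) e that in \<open>auto simp: idem_mat_def is_mat_def\<close>)
      then show ?thesis using A(2) e by (simp add: H.ker.meq_def H.eqv_iff H.h_mm idem_mat_def)
    qed
    interpret I: cr_ideal "coeffs_in val.ker" by (rule val.ker.cr_ideal_coeffs_in)
    have sub: "coeffs_in val.ker \<subseteq> H.ker"
      by (auto simp: coeffs_in_def val.ker_def H.ker_def val.poly_map_def mpoly_ring_simps indexed_zero_def)
    \<comment> \<open>The entries involve only the first \<open>m\<close> variables, and for such
      polynomials lying in \<open>H.ker\<close> means having all coefficients in
      \<open>val.ker\<close>.\<close>
    have idemI: "I.meq n n (mm n A A) A"
    proof -
      have "mm n A A i j - A i j \<in> coeffs_in val.ker" if "i < n" "j < n" for i j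
      proof -
        have "mm n A A i j - A i j \<in> vars_lt m"
          unfolding mm_def by (intro vars_lt_diff vars_lt_sum vars_lt_mult A(1))
        moreover have "mm n A A i j - A i j \<in> H.ker"
          using idem that unfolding H.ker.meq_def H.ker.eqv_def by blast
        then have "val.poly_map m (mm n A A i j - A i j) = \<zero>\<^bsub>?S\<^esub>" by (simp add: H.ker_def)
        ultimately show ?thesis using val.poly_map_zero_iff by blast
      qed
      then show ?thesis by (simp add: I.meq_def I.eqv_def)
    qed
    have "H.ker.finite_free_res n A"
    proof (cases "\<one> = \<zero>")
      case True
      \<comment> \<open>The zero ring is separate: its nilradical is not a proper ideal, but all
        congruences hold and every matrix is congruent to zero.\<close>
      have "val.poly_map m x = \<zero>\<^bsub>?S\<^esub>" for x
      proof -
        have "\<one>\<^bsub>?S\<^esub> = \<zero>\<^bsub>?S\<^esub>" by (simp add: mpoly_ring_simps True)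
        then show ?thesis using S.l_one[OF H.h_closed[of x]] S.l_null[OF H.h_closed[of x]] by simp
      qed
      then show ?thesis by (intro H.ker.finite_free_res.zero) (simp add: H.ker.meq_def H.eqv_iff)
    next
      case False
      interpret J: chain_prime nil_preimage by (rule chain_prime_nil_preimage[OF False])
      have IJ: "coeffs_in val.ker \<subseteq> coeffs_in nil_preimage"
      proof -
        have "x \<in> nil_preimage" if "x \<in> val.ker" for x
        proof -
          have "int_poly_val x [^] (1::nat) = \<zero>" using that by (simp add: val.ker_def)
          then show ?thesis unfolding nil_preimage_def by blast
        qed
        then show ?thesis by (auto simp: coeffs_in_def)
      qed
      have "J.JJ.meq n n (mm n A A) A"
        using idemI IJ by (auto simp: I.meq_def I.eqv_def J.JJ.meq_def J.JJ.eqv_def)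
      note res = J.finite_free_res_polynomials[OF A(1) this]
      have "I.finite_free_res n A"
        by (rule finite_free_res_nil_lift[OF I.cr_ideal_axioms J.JJ.cr_ideal_axioms IJ nil_preimage_nil res idemI])
      then show ?thesis by (rule finite_free_res_mono[OF I.cr_ideal_axioms H.ker.cr_ideal_axioms sub])
    qed
    \<comment> \<open>The subgroup used here consists of the elements that agree, up to relations,
      with an extension of an element over \<open>R\<close>.\<close>
    from this idem
    have "\<exists>c. Poly_Mapping.keys c \<subseteq> fgp_modules R \<and>
        frag_of (fixmod ?S n (\<lambda>i j. val.poly_map m (A i j))) - T.F c \<in> K0_relations ?S"
    proof (rule H.finite_free_res_class[where
        Q = "\<lambda>d. \<exists>c. Poly_Mapping.keys c \<subseteq> fgp_modules R \<and> d - T.F c \<in> K0_relations ?S"])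
      show "\<exists>c. Poly_Mapping.keys c \<subseteq> fgp_modules R \<and> d - T.F c \<in> K0_relations ?S" if "d \<in> K0_relations ?S" for d
        using that by (intro exI[of _ 0]) simp
    next
      fix a b
      assume "\<exists>c. Poly_Mapping.keys c \<subseteq> fgp_modules R \<and> a - T.F c \<in> K0_relations ?S"
        and "\<exists>c. Poly_Mapping.keys c \<subseteq> fgp_modules R \<and> b - T.F c \<in> K0_relations ?S"
      then obtain c d where "Poly_Mapping.keys c \<subseteq> fgp_modules R" "a - T.F c \<in> K0_relations ?S"
        "Poly_Mapping.keys d \<subseteq> fgp_modules R" "b - T.F d \<in> K0_relations ?S" by blast
      with K0_relations_diff[OF this(2,4)]
      show "\<exists>c. Poly_Mapping.keys c \<subseteq> fgp_modules R \<and> a - b - T.F c \<in> K0_relations ?S"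
        by (intro exI[of _ "c - d"]) (use keys_diff[of c d] in \<open>auto simp: frag_extend_diff algebra_simps\<close>)
    next
      fix t
      have i: "idem_mat R t (idmat R)"
      proof -
        have "val.ker.meq t t (mm t mid mid) mid" by (rule val.ker.meq_mid_left)
        then have "idem_mat R t (\<lambda>i j. int_poly_val (mid i j))" by (simp only: val.idem_mat_h)
        then show ?thesis by (simp add: val.h_mid)
      qed
      have "(\<lambda>i j. indexed_const (idmat R i j)) = idmat ?S"
        by (auto simp: fun_eq_iff idmat_def mpoly_ring_simps)
      with T.F_fixmod(1)[OF i]
      have "T.F (frag_of (fixmod R t (idmat R))) - frag_of (fixmod ?S t (idmat ?S)) \<in> K0_relations ?S" by simp
      from K0_relations_uminus[OF this]
      have "frag_of (fixmod ?S t (idmat ?S)) - T.F (frag_of (fixmod R t (idmat R))) \<in> K0_relations ?S" by simp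
      moreover have "Poly_Mapping.keys (frag_of (fixmod R t (idmat R))) \<subseteq> fgp_modules R"
        using fixmod_fgp[OF i] by simp
      ultimately show "\<exists>c. Poly_Mapping.keys c \<subseteq> fgp_modules R \<and>
          frag_of (fixmod ?S t (idmat ?S)) - T.F c \<in> K0_relations ?S" by blast
    qed
    then show "\<exists>c. Poly_Mapping.keys c \<subseteq> fgp_modules R \<and> frag_of (fixmod ?S n e) - T.F c \<in> K0_relations ?S"
      by (simp only: fix_eq)
  qed
qed

end

theorem proposition8p6:
  fixes R :: "('a, 'r) ring_scheme"
  assumes "valuation_ring R"
    and "\<And>x. zero_divisor R x \<Longrightarrow> x \<noteq> \<zero>\<^bsub>R\<^esub> \<Longrightarrow> \<not> fin_gen_ideal R (annihilator R x)"
  shows "K0_regular R"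
  by (rule valuation_ring.K0_regular_valuation_ring[OF assms(1)])

end
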